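(* Let $m,n_1,\ldots,n_m$ be positive integers, $N=n_1+\cdots+n_m$, and let $p_1,\ldots,p_m$ be real numbers. Suppose that for $1\le i\le m$, $X_i$ is an $n_i$-dimensional random vector such that $\mathbf{X}=(X_1,\ldots,X_m)$ is a centered jointly Gaussian random vector in $\mathbb{R}^N$ with covariance matrix $T=(T_{ij})_{1\le i,j\le m}$, where $T_{ij}$ is the $n_i\times n_j$ covariance matrix between $X_i$ and $X_j$. Let $P$ be the $N\times N$ block diagonal matrix $$P=\mathrm{diag}(p_1T_{11},\ldots,p_mT_{mm}).$$ Then for any nonnegative measurable functions $f_i$ on $\mathbb{R}^{n_i}$, $1\le i\le m$, the following hold. (i) If $T\le P$, then $$\mathbb{E}\prod_{i=1}^m f_i(X_i)\le \prod_{i=1}^m\Big(\mathbb{E} f_i(X_i)^{p_i}\Big)^{1/p_i}.$$ (ii) If $T\ge P$, then $$\mathbb{E}\prod_{i=1}^m f_i(X_i)\ge \prod_{i=1}^m\Big(\mathbb{E} f_i(X_i)^{p_i}\Big)^{1/p_i}.$$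
   Context: For real symmetric matrices $A,B$ of the same size, $A\le B$ (equivalently $B\ge A$) means that $B-A$ is positive semi-definite. Gaussian vectors may be degenerate. Conventions: on the right-hand sides, $\infty\cdot 0=0$; for $p<0$, $0^{p}=\infty$ and $\infty^{1/p}=0$; for $p=0$, $(\mathbb{E} f(Y)^{p})^{1/p}$ is read as $\exp(\mathbb{E}\log f(Y))$ (with $\log 0=-\infty$, $\exp(-\infty)=0$), whenever $\mathbb{E}\log f(Y)$ is well-defined in $[-\infty,\infty]$. *)

theory Defs
  imports "HOL-Probability.Probability"
begin

subsection \<open>Real matrices indexed by a finite set\<close>

text \<open>
  A square matrix is a function of two indices, of which only the entries over a finite index
  set \<open>I\<close> matter.
\<close>

definition psd_on :: "'i set \<Rightarrow> ('i \<Rightarrow> 'i \<Rightarrow> real) \<Rightarrow> bool" where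
  "psd_on I A \<longleftrightarrow>
     (\<forall>a\<in>I. \<forall>b\<in>I. A a b = A b a) \<and>
     (\<forall>v::'i \<Rightarrow> real. 0 \<le> (\<Sum>a\<in>I. \<Sum>b\<in>I. v a * A a b * v b))"

definition matrix_le_on :: "'i set \<Rightarrow> ('i \<Rightarrow> 'i \<Rightarrow> real) \<Rightarrow> ('i \<Rightarrow> 'i \<Rightarrow> real) \<Rightarrow> bool" where
  "matrix_le_on I A B \<longleftrightarrow> psd_on I (\<lambda>a b. B a b - A a b)"

text \<open>
  The coordinates of \<open>\<real>\<^sup>N = \<real>\<^bsup>n\<^sub>0\<^esup> \<times> \<dots> \<times> \<real>\<^bsup>n\<^sub>m\<^sub>-\<^sub>1\<^esup>\<close> are indexed by pairs: \<open>(i, k)\<close> is coordinate \<open>k\<close>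
  of block \<open>i\<close>. Blocks and coordinates are counted from 0.
\<close>

definition block_index :: "nat \<Rightarrow> (nat \<Rightarrow> nat) \<Rightarrow> (nat \<times> nat) set" where
  "block_index m n = (SIGMA i:{..<m}. {..<n i})"

definition block :: "(nat \<times> nat \<Rightarrow> nat \<times> nat \<Rightarrow> real) \<Rightarrow> nat \<Rightarrow> nat \<Rightarrow> nat \<Rightarrow> nat \<Rightarrow> real" where
  "block A i j = (\<lambda>k l. A (i, k) (j, l))"

definition block_diag :: "(nat \<Rightarrow> nat \<Rightarrow> nat \<Rightarrow> real) \<Rightarrow> nat \<times> nat \<Rightarrow> nat \<times> nat \<Rightarrow> real" where
  "block_diag D = (\<lambda>(i, k) (j, l). if i = j then D i k l else 0)"

subsection \<open>Gaussian random vectors\<close>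

text \<open>The normal law with mean \<open>\<mu>\<close> and standard deviation \<open>\<sigma> \<ge> 0\<close>; a point mass if \<open>\<sigma> = 0\<close>.\<close>

definition normal_law :: "real \<Rightarrow> real \<Rightarrow> real measure" where
  "normal_law \<mu> \<sigma> = (if \<sigma> = 0 then return borel \<mu> else density lborel (normal_density \<mu> \<sigma>))"

definition gaussian_vector :: "'a measure \<Rightarrow> 'i set \<Rightarrow> ('i \<Rightarrow> 'a \<Rightarrow> real) \<Rightarrow> bool" where
  "gaussian_vector M I Y \<longleftrightarrow>
     (\<forall>a\<in>I. Y a \<in> borel_measurable M) \<and>
     (\<forall>c::'i \<Rightarrow> real. \<exists>\<mu> \<sigma>. 0 \<le> \<sigma> \<and>
        distr M borel (\<lambda>\<omega>. \<Sum>a\<in>I. c a * Y a \<omega>) = normal_law \<mu> \<sigma>)"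

definition centered :: "'a measure \<Rightarrow> 'i set \<Rightarrow> ('i \<Rightarrow> 'a \<Rightarrow> real) \<Rightarrow> bool" where
  "centered M I Y \<longleftrightarrow> (\<forall>a\<in>I. (\<integral>\<omega>. Y a \<omega> \<partial>M) = 0)"

definition covariance_matrix :: "'a measure \<Rightarrow> ('i \<Rightarrow> 'a \<Rightarrow> real) \<Rightarrow> 'i \<Rightarrow> 'i \<Rightarrow> real" where
  "covariance_matrix M Y =
     (\<lambda>a b. \<integral>\<omega>. (Y a \<omega> - (\<integral>\<omega>'. Y a \<omega>' \<partial>M)) * (Y b \<omega> - (\<integral>\<omega>'. Y b \<omega>' \<partial>M)) \<partial>M)"

text \<open>The vector \<open>(X\<^sub>0, \<dots>, X\<^sub>m\<^sub>-\<^sub>1)\<close> in the coordinates described above.\<close>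

definition joint_vector :: "(nat \<Rightarrow> 'a \<Rightarrow> nat \<Rightarrow> real) \<Rightarrow> nat \<times> nat \<Rightarrow> 'a \<Rightarrow> real" where
  "joint_vector X = (\<lambda>(i, k) \<omega>. X i \<omega> k)"

subsection \<open>Power means with exponents of any sign\<close>

text \<open>
  Powers on \<open>[0, \<infinity>]\<close> with \<open>0\<^sup>p = \<infinity>\<close> and \<open>\<infinity>\<^sup>p = 0\<close> for \<open>p < 0\<close>. This differs from \<^const>\<open>powr\<close> on the
  reals, for which \<open>0 powr p = 0\<close>.
\<close>

definition epowr :: "ennreal \<Rightarrow> real \<Rightarrow> ennreal" where
  "epowr x p =
     (if p = 0 then 1
      else if x = 0 then (if p > 0 then 0 else \<infinity>)
      else if x = \<infinity> then (if p > 0 then \<infinity> else 0)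
      else ennreal (enn2real x powr p))"

definition elog :: "real \<Rightarrow> ereal" where
  "elog x = (if x \<le> 0 then - \<infinity> else ereal (ln x))"

definition eexp :: "ereal \<Rightarrow> ennreal" where
  "eexp x = (case x of ereal r \<Rightarrow> ennreal (exp r) | PInfty \<Rightarrow> \<infinity> | MInfty \<Rightarrow> 0)"

text \<open>
  The expectation of a \<open>[-\<infinity>, \<infinity>]\<close>-valued function as the difference of the integrals of its positive
  and negative parts (\<^const>\<open>e2ennreal\<close> maps negative values to 0), well-defined unless both are
  infinite.
\<close>

definition eexpectation_defined :: "'a measure \<Rightarrow> ('a \<Rightarrow> ereal) \<Rightarrow> bool" where
  "eexpectation_defined M g \<longleftrightarrow>
     (\<integral>\<^sup>+\<omega>. e2ennreal (g \<omega>) \<partial>M) < \<infinity> \<or> (\<integral>\<^sup>+\<omega>. e2ennreal (- g \<omega>) \<partial>M) < \<infinity>"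

definition eexpectation :: "'a measure \<Rightarrow> ('a \<Rightarrow> ereal) \<Rightarrow> ereal" where
  "eexpectation M g =
     enn2ereal (\<integral>\<^sup>+\<omega>. e2ennreal (g \<omega>) \<partial>M) - enn2ereal (\<integral>\<^sup>+\<omega>. e2ennreal (- g \<omega>) \<partial>M)"

text \<open>\<open>(\<bbbE> g\<^sup>p)\<^bsup>1/p\<^esup>\<close>, read as \<open>exp (\<bbbE> log g)\<close> for \<open>p = 0\<close>.\<close>

definition power_mean :: "'a measure \<Rightarrow> real \<Rightarrow> ('a \<Rightarrow> real) \<Rightarrow> ennreal" where
  "power_mean M p g =
     (if p = 0 then eexp (eexpectation M (\<lambda>\<omega>. elog (g \<omega>)))
      else epowr (\<integral>\<^sup>+\<omega>. epowr (ennreal (g \<omega>)) p \<partial>M) (1 / p))"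

end

theory Submission
  imports Defs "HOL-Real_Asymp.Real_Asymp"
begin

text \<open>
  For functions \<open>F\<^sub>i = f\<^sub>i\<^bsup>p\<^sub>i\<^esup>\<close> bounded away from \<open>0\<close> and \<open>\<infinity>\<close>, let \<open>U s F x = E F(x + \<surd>s X)\<close> be the heat
  semigroup of the law of \<open>X\<close>, and interpolate between the two sides of the inequality by
  \<open>U (1 - s) (\<Prod>i. (U s F\<^sub>i)\<^bsup>1/p\<^sub>i\<^esup>)\<close> at the origin. For smooth \<open>F\<^sub>i\<close>, increasing \<open>s\<close> by
  \<open>1/K\<close> decreases this quantity by \<open>b\<^sup>T (T - P) b / (2 K)\<close>, up to a positive factor and an error
  \<open>O(K\<^bsup>-3/2\<^esup>)\<close>, where \<open>b\<^sub>i\<close> is the gradient of \<open>log (U s F\<^sub>i)\<close> divided by \<open>p\<^sub>i\<close>. Summing the \<open>K\<close> steps and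
  letting \<open>K \<rightarrow> \<infinity>\<close> gives the inequality in the direction prescribed by the sign of \<open>T - P\<close>. Density of
  smooth functions in \<open>L\<^sup>1\<close> and truncation extend it to all nonnegative measurable functions.
  The semigroup law only needs that \<open>\<surd>s X + \<surd>t X'\<close> and \<open>\<surd>(s + t) X\<close> have the same law for independent
  copies, so degenerate covariances need no special treatment.
\<close>

section \<open>Second-order expansion of products of powers\<close>

text \<open>The sign of T - P enters through the quadratic term of a product of powers: with q_i = 1
  / p_i it is (\<Sum> q_i l_i)^2 - \<Sum> q_i l_i^2, and putting b_i = q_i l_i turns the second sum
  into \<Sum> p_i b_i^2. The linear term is exactly centered, because each factor is divided by its
  own mean. Finite steps replace differentiation in s; their errors can be added up because the
  constant of one step depends on the functions only through a lower bound \<open>lo\<close> and a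
  regularity bound \<open>B\<close>, and the semigroup keeps both. The obstacle is that exponents
  may have either sign: powers are harmless only away from 0 and infinity, so the core is proved for
  min (f, K) + \<epsilon>, and the conventions at 0 and infinity matter only in the final limits. A
  vanishing exponent has no reciprocal. If T <= P it can belong only to a block that is almost
  surely zero, where any exponent gives the same mean; if T >= P it is approached through negative
  exponents.\<close>

text \<open>Mean value theorem on the segment from 0 to \<open>x\<close>: each difference vanishes
  at 0, and its derivative \<open>- t / (1 + t)\<close>, \<open>t\<^sup>2 / (1 + t)\<close> or
  \<open>1 / (1 + t)\<close> has a denominator of at least \<open>r\<close> there, since this holds
  at both endpoints.\<close>

lemma ln_bounds:
  fixes r x :: real
  assumes r: "0 < r" "r \<le> 1" and x: "r \<le> 1 + x"
  shows "\<bar>ln (1 + x) - x\<bar> \<le> x\<^sup>2 / r"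
    and "\<bar>ln (1 + x) - x + x\<^sup>2 / 2\<bar> \<le> \<bar>x\<bar> ^ 3 / r"
    and "\<bar>ln (1 + x)\<bar> \<le> \<bar>x\<bar> / r"
proof -
  have pos: "r \<le> 1 + t" if "t \<in> closed_segment 0 x" for t
    using that x r by (auto simp: closed_segment_eq_real_ivl split: if_splits)
  have small: "\<bar>t\<bar> \<le> \<bar>x\<bar>" if "t \<in> closed_segment 0 x" for t
    using that by (auto simp: closed_segment_eq_real_ivl split: if_splits)
  have mvt: "\<bar>g x - g 0\<bar> \<le> K * \<bar>x\<bar>"
    if d: "\<And>t. t \<in> closed_segment 0 x \<Longrightarrow> (g has_real_derivative g' t) (at t)"
      and b: "\<And>t. t \<in> closed_segment 0 x \<Longrightarrow> \<bar>g' t\<bar> \<le> K" for g g' :: "real \<Rightarrow> real" and K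
    using field_differentiable_bound[of "closed_segment 0 x" g g' K x 0] d b
    by (auto intro: DERIV_subset)
  have "\<bar>(ln (1 + x) - x) - (ln (1 + 0) - 0)\<bar> \<le> (\<bar>x\<bar> / r) * \<bar>x\<bar>"
  proof (rule mvt[where g' = "\<lambda>t. - t / (1 + t)"])
    fix t assume t: "t \<in> closed_segment 0 x"
    note p = pos[OF t]
    show "((\<lambda>t. ln (1 + t) - t) has_real_derivative - t / (1 + t)) (at t)"
      using p r by (auto intro!: derivative_eq_intros simp: field_simps)
    have "\<bar>- t / (1 + t)\<bar> = \<bar>t\<bar> / (1 + t)" using p r by (simp add: abs_divide)
    also have "\<dots> \<le> \<bar>x\<bar> / r" using p r small[OF t] by (intro frac_le) auto
    finally show "\<bar>- t / (1 + t)\<bar> \<le> \<bar>x\<bar> / r" .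
  qed
  thus "\<bar>ln (1 + x) - x\<bar> \<le> x\<^sup>2 / r"
    by (simp add: power2_eq_square abs_mult[symmetric])
  have "\<bar>(ln (1 + x) - x + x\<^sup>2 / 2) - (ln (1 + 0) - 0 + 0\<^sup>2 / 2)\<bar> \<le> (x\<^sup>2 / r) * \<bar>x\<bar>"
  proof (rule mvt[where g' = "\<lambda>t. t\<^sup>2 / (1 + t)"])
    fix t assume t: "t \<in> closed_segment 0 x"
    note p = pos[OF t]
    show "((\<lambda>t. ln (1 + t) - t + t\<^sup>2 / 2) has_real_derivative t\<^sup>2 / (1 + t)) (at t)"
      using p r by (auto intro!: derivative_eq_intros simp: field_simps power2_eq_square)
    have "\<bar>t\<^sup>2 / (1 + t)\<bar> = t\<^sup>2 / (1 + t)" using p r by (simp add: abs_divide)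
    also have "\<dots> \<le> x\<^sup>2 / r" using p r small[OF t] by (intro frac_le) (auto simp: abs_le_square_iff)
    finally show "\<bar>t\<^sup>2 / (1 + t)\<bar> \<le> x\<^sup>2 / r" .
  qed
  thus "\<bar>ln (1 + x) - x + x\<^sup>2 / 2\<bar> \<le> \<bar>x\<bar> ^ 3 / r"
    by (simp add: power2_eq_square power3_eq_cube abs_mult[symmetric] mult.commute)
  have "\<bar>ln (1 + x) - ln (1 + 0)\<bar> \<le> (1 / r) * \<bar>x\<bar>"
  proof (rule mvt[where g' = "\<lambda>t. 1 / (1 + t)"])
    fix t assume t: "t \<in> closed_segment 0 x"
    note p = pos[OF t]
    show "((\<lambda>t. ln (1 + t)) has_real_derivative 1 / (1 + t)) (at t)"
      using p r by (auto intro!: derivative_eq_intros simp: field_simps)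
    show "\<bar>1 / (1 + t)\<bar> \<le> 1 / r" using p r by (auto intro: frac_le)
  qed
  thus "\<bar>ln (1 + x)\<bar> \<le> \<bar>x\<bar> / r" by simp
qed

lemma exp_quadratic_bound:
  fixes L :: real
  shows "\<bar>exp L - (1 + L + L\<^sup>2 / 2)\<bar> \<le> exp \<bar>L\<bar> * \<bar>L\<bar> ^ 3"
proof -
  have "\<bar>exp L - (\<Sum>k\<le>2. L ^ k / fact k)\<bar> \<le> exp \<bar>L\<bar> * \<bar>L\<bar> ^ Suc 2 / fact 2"
    using Taylor_exp_field[of L 2] by simp
  also have "\<dots> = exp \<bar>L\<bar> * \<bar>L\<bar> ^ 3 / 2" by (simp add: eval_nat_numeral)
  also have "\<dots> \<le> exp \<bar>L\<bar> * \<bar>L\<bar> ^ 3" using mult_nonneg_nonneg[of "exp \<bar>L\<bar>" "\<bar>L\<bar> ^ 3"] by simp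
  finally show ?thesis by (simp add: numeral_2_eq_2 atMost_Suc)
qed

lemma sum_abs_bound:
  fixes q :: "'b \<Rightarrow> real"
  assumes "\<And>i. i \<in> A \<Longrightarrow> \<bar>g i\<bar> \<le> K"
  shows "\<bar>\<Sum>i\<in>A. q i * g i\<bar> \<le> (\<Sum>i\<in>A. \<bar>q i\<bar>) * K"
proof -
  have "\<bar>\<Sum>i\<in>A. q i * g i\<bar> \<le> (\<Sum>i\<in>A. \<bar>q i * g i\<bar>)" by (rule sum_abs)
  also have "\<dots> \<le> (\<Sum>i\<in>A. \<bar>q i\<bar> * K)"
    by (intro sum_mono) (auto simp: abs_mult intro!: mult_left_mono assms)
  finally show ?thesis by (simp add: sum_distrib_right)
qed

text \<open>The product is exp L with L = \<Sum> q_i ln (1 + \<xi>_i). The first-order term keeps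
  the exact \<xi>_i, because an error of order u^2 could not be absorbed there; in the quadratic
  terms \<xi>_i may be traded for its linear part l_i at a cost of order u^3.\<close>

lemma prod_powr_expansion:
  fixes q :: "'b \<Rightarrow> real" and r R K :: real
  assumes A: "finite A" and r: "0 < r" "r \<le> 1" and K: "0 \<le> K"
  shows "\<exists>C\<ge>0. \<forall>\<xi> l u. 0 \<le> u \<longrightarrow>
    (\<forall>i\<in>A. r \<le> 1 + \<xi> i \<and> 1 + \<xi> i \<le> R \<and> \<bar>\<xi> i\<bar> \<le> K * u \<and> \<bar>l i\<bar> \<le> K * u \<and> \<bar>\<xi> i - l i\<bar> \<le> K * u\<^sup>2) \<longrightarrow>
    \<bar>(\<Prod>i\<in>A. (1 + \<xi> i) powr q i) -
      (1 + (\<Sum>i\<in>A. q i * \<xi> i) + ((\<Sum>i\<in>A. q i * l i)\<^sup>2 - (\<Sum>i\<in>A. q i * (l i)\<^sup>2)) / 2)\<bar> \<le> C * u ^ 3"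
proof -
  define Q where "Q = (\<Sum>i\<in>A. \<bar>q i\<bar>)"
  have Q: "0 \<le> Q" by (auto simp: Q_def intro: sum_nonneg)
  \<comment> \<open>A bound on |L| independent of \<open>u\<close>, obtained from r <= 1 + \<xi>_i
    <= R: the scale \<open>u\<close> is unrestricted, and the factor exp |L| of the remainder must
    stay bounded.\<close>
  define D where "D = Q * ((\<bar>ln r\<bar> + \<bar>ln R\<bar>))"
  \<comment> \<open>One summand for each of the errors \<open>a1\<close> to \<open>a4\<close> below:
    the remainder of exp, the cubic remainder of ln, the exchange of the squares of \<xi>_i and l_i,
    and the exchange of L^2 and Y^2.\<close>
  define C where "C = exp D * (Q * (K / r)) ^ 3 + Q * (K ^ 3 / r) + Q * (2 * K\<^sup>2)
     + (Q * (K\<^sup>2 / r) + Q * K) * (Q * (K / r) + Q * K)"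
  have C: "0 \<le> C" using Q K r by (auto simp: C_def intro!: add_nonneg_nonneg mult_nonneg_nonneg)
  show ?thesis
  proof (intro exI[of _ C] conjI C allI impI)
    fix \<xi> l :: "'b \<Rightarrow> real" and u :: real
    assume u: "0 \<le> u"
    assume h: "\<forall>i\<in>A. r \<le> 1 + \<xi> i \<and> 1 + \<xi> i \<le> R \<and> \<bar>\<xi> i\<bar> \<le> K * u \<and> \<bar>l i\<bar> \<le> K * u \<and> \<bar>\<xi> i - l i\<bar> \<le> K * u\<^sup>2"
    define L where "L = (\<Sum>i\<in>A. q i * ln (1 + \<xi> i))"
    define X where "X = (\<Sum>i\<in>A. q i * \<xi> i)"
    define Y where "Y = (\<Sum>i\<in>A. q i * l i)"
    have "(\<Prod>i\<in>A. (1 + \<xi> i) powr q i) = (\<Prod>i\<in>A. exp (q i * ln (1 + \<xi> i)))"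
      using h r by (intro prod.cong) (force simp: powr_def)+
    hence prod: "(\<Prod>i\<in>A. (1 + \<xi> i) powr q i) = exp L" by (simp add: L_def exp_sum A)
    have lnD: "\<bar>ln (1 + \<xi> i)\<bar> \<le> \<bar>ln r\<bar> + \<bar>ln R\<bar>" if "i \<in> A" for i
    proof -
      have "ln r \<le> ln (1 + \<xi> i)" "ln (1 + \<xi> i) \<le> ln R" using h that r by force+
      thus ?thesis by linarith
    qed
    have LD: "\<bar>L\<bar> \<le> D" unfolding L_def D_def Q_def by (intro sum_abs_bound lnD)
    have L1: "\<bar>L\<bar> \<le> Q * (K / r) * u"
    proof -
      have "\<bar>ln (1 + \<xi> i)\<bar> \<le> K * u / r" if "i \<in> A" for i
        using ln_bounds(3)[of r "\<xi> i"] h that r by (smt (verit) divide_right_mono)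
      hence "\<bar>\<Sum>i\<in>A. q i * ln (1 + \<xi> i)\<bar> \<le> Q * (K * u / r)"
        unfolding Q_def by (rule sum_abs_bound) thus ?thesis by (simp add: L_def Q_def)
    qed
    have a1: "\<bar>exp L - (1 + L + L\<^sup>2 / 2)\<bar> \<le> exp D * (Q * (K / r)) ^ 3 * u ^ 3"
    proof -
      have "\<bar>exp L - (1 + L + L\<^sup>2 / 2)\<bar> \<le> exp \<bar>L\<bar> * \<bar>L\<bar> ^ 3" by (rule exp_quadratic_bound)
      also have "\<dots> \<le> exp D * (Q * (K / r) * u) ^ 3"
        using LD L1 by (intro mult_mono power_mono) auto
      finally show ?thesis by (simp add: power_mult_distrib power_divide)
    qed
    have a2: "\<bar>L - (X - (\<Sum>i\<in>A. q i * (\<xi> i)\<^sup>2) / 2)\<bar> \<le> Q * (K ^ 3 / r) * u ^ 3"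
    proof -
      have "\<bar>ln (1 + \<xi> i) - \<xi> i + (\<xi> i)\<^sup>2 / 2\<bar> \<le> K ^ 3 * u ^ 3 / r" if "i \<in> A" for i
      proof -
        have "\<bar>\<xi> i\<bar> ^ 3 \<le> (K * u) ^ 3" using h that by (intro power_mono) auto
        thus ?thesis using ln_bounds(2)[of r "\<xi> i"] h that r
          by (smt (verit) divide_right_mono power_mult_distrib)
      qed
      hence "\<bar>\<Sum>i\<in>A. q i * (ln (1 + \<xi> i) - \<xi> i + (\<xi> i)\<^sup>2 / 2)\<bar> \<le> Q * (K ^ 3 * u ^ 3 / r)"
        unfolding Q_def by (rule sum_abs_bound)
      moreover have "(\<Sum>i\<in>A. q i * (ln (1 + \<xi> i) - \<xi> i + (\<xi> i)\<^sup>2 / 2)) = L - (X - (\<Sum>i\<in>A. q i * (\<xi> i)\<^sup>2) / 2)"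
        by (simp add: L_def X_def algebra_simps sum.distrib sum_subtractf sum_divide_distrib)
      ultimately show ?thesis by simp
    qed
    have a3: "\<bar>(\<Sum>i\<in>A. q i * (\<xi> i)\<^sup>2) - (\<Sum>i\<in>A. q i * (l i)\<^sup>2)\<bar> \<le> Q * (2 * K\<^sup>2) * u ^ 3"
    proof -
      have "\<bar>(\<xi> i)\<^sup>2 - (l i)\<^sup>2\<bar> \<le> 2 * K\<^sup>2 * u ^ 3" if "i \<in> A" for i
      proof -
        have "\<bar>(\<xi> i)\<^sup>2 - (l i)\<^sup>2\<bar> = \<bar>\<xi> i - l i\<bar> * \<bar>\<xi> i + l i\<bar>"
          by (simp add: abs_mult[symmetric] power2_eq_square algebra_simps)
        also have "\<dots> \<le> (K * u\<^sup>2) * (2 * (K * u))"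
          using h that K u by (intro mult_mono) (auto intro: order_trans[OF abs_triangle_ineq])
        finally show ?thesis by (simp add: power2_eq_square power3_eq_cube mult_ac)
      qed
      hence "\<bar>\<Sum>i\<in>A. q i * ((\<xi> i)\<^sup>2 - (l i)\<^sup>2)\<bar> \<le> Q * (2 * K\<^sup>2 * u ^ 3)"
        unfolding Q_def by (rule sum_abs_bound)
      thus ?thesis by (simp add: Q_def algebra_simps sum_subtractf)
    qed
    have XY: "\<bar>X - Y\<bar> \<le> Q * K * u\<^sup>2"
    proof -
      have "\<bar>\<Sum>i\<in>A. q i * (\<xi> i - l i)\<bar> \<le> Q * (K * u\<^sup>2)"
        unfolding Q_def using h by (intro sum_abs_bound) auto
      thus ?thesis by (simp add: X_def Y_def algebra_simps sum_subtractf)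
    qed
    have LX: "\<bar>L - X\<bar> \<le> Q * (K\<^sup>2 / r) * u\<^sup>2"
    proof -
      have "\<bar>ln (1 + \<xi> i) - \<xi> i\<bar> \<le> K\<^sup>2 * u\<^sup>2 / r" if "i \<in> A" for i
      proof -
        have "(\<xi> i)\<^sup>2 \<le> (K * u)\<^sup>2" using h that K u by (subst abs_le_square_iff[symmetric]) auto
        thus ?thesis using ln_bounds(1)[of r "\<xi> i"] h that r
          by (smt (verit) divide_right_mono power_mult_distrib)
      qed
      hence "\<bar>\<Sum>i\<in>A. q i * (ln (1 + \<xi> i) - \<xi> i)\<bar> \<le> Q * (K\<^sup>2 * u\<^sup>2 / r)"
        unfolding Q_def by (rule sum_abs_bound)
      thus ?thesis by (simp add: Q_def L_def X_def algebra_simps sum_subtractf)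
    qed
    have Yb: "\<bar>Y\<bar> \<le> Q * K * u"
    proof -
      have "\<bar>\<Sum>i\<in>A. q i * l i\<bar> \<le> Q * (K * u)"
        unfolding Q_def using h by (intro sum_abs_bound) auto
      thus ?thesis by (simp add: Y_def)
    qed
    have a4: "\<bar>L\<^sup>2 - Y\<^sup>2\<bar> \<le> (Q * (K\<^sup>2 / r) + Q * K) * (Q * (K / r) + Q * K) * u ^ 3"
    proof -
      have "\<bar>L\<^sup>2 - Y\<^sup>2\<bar> = \<bar>L - Y\<bar> * \<bar>L + Y\<bar>"
        by (simp add: abs_mult[symmetric] power2_eq_square algebra_simps)
      also have "\<dots> \<le> (Q * (K\<^sup>2 / r) * u\<^sup>2 + Q * K * u\<^sup>2) * (Q * (K / r) * u + Q * K * u)"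
        using LX XY Yb L1 by (intro mult_mono) auto
      finally show ?thesis by (simp add: power2_eq_square power3_eq_cube algebra_simps)
    qed
    have "\<bar>exp L - (1 + X + (Y\<^sup>2 - (\<Sum>i\<in>A. q i * (l i)\<^sup>2)) / 2)\<bar>
       \<le> exp D * (Q * (K / r)) ^ 3 * u ^ 3 + Q * (K ^ 3 / r) * u ^ 3 + Q * (2 * K\<^sup>2) * u ^ 3
         + (Q * (K\<^sup>2 / r) + Q * K) * (Q * (K / r) + Q * K) * u ^ 3"
    proof -
      have "\<bar>x - (1 + X + (y2 - sl) / 2)\<bar> \<le> e1 + e2 + e3 + e4"
        if "\<bar>x - (1 + L + l2 / 2)\<bar> \<le> e1" "\<bar>L - (X - sx / 2)\<bar> \<le> e2" "\<bar>sx - sl\<bar> \<le> e3" "\<bar>l2 - y2\<bar> \<le> e4"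
        for x l2 y2 sx sl e1 e2 e3 e4 :: real
        using that by (simp add: abs_le_iff field_simps)
      from this[OF a1 a2 a3 a4] show ?thesis .
    qed
    also have "\<dots> = C * u ^ 3" by (simp only: C_def distrib_right)
    finally show "\<bar>(\<Prod>i\<in>A. (1 + \<xi> i) powr q i) -
      (1 + (\<Sum>i\<in>A. q i * \<xi> i) + ((\<Sum>i\<in>A. q i * l i)\<^sup>2 - (\<Sum>i\<in>A. q i * (l i)\<^sup>2)) / 2)\<bar> \<le> C * u ^ 3"
      by (simp add: prod X_def Y_def)
  qed
qed

text \<open>By monotonicity \<open>t powr r\<close> lies between its values at the endpoints, in an
  order that depends on the sign of \<open>r\<close>; the sum dominates in both cases.\<close>

lemma powr_le_sum:
  fixes t lo hi r :: real
  assumes "0 < lo" "lo \<le> t" "t \<le> hi"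
  shows "t powr r \<le> lo powr r + hi powr r"
proof (cases "0 \<le> r")
  case True
  hence "t powr r \<le> hi powr r" using assms by (intro powr_mono2) auto
  thus ?thesis by (simp add: add_increasing)
next
  case False
  hence "t powr r \<le> lo powr r" using assms by (intro powr_mono2') auto
  thus ?thesis by (simp add: add_increasing2)
qed

section \<open>Laws on function spaces and characteristic functions\<close>

abbreviation coords :: "('i \<Rightarrow> real) measure" where
  "coords \<equiv> PiM UNIV (\<lambda>_. borel)"

text \<open>Scaled to total mass 1, \<open>w\<close> is a density, and the hypothesis at phases 0
  and - pi / 2 gives the real and imaginary parts of the characteristic function of \<open>Y\<close>
  under it, so one-dimensional uniqueness applies. If the total mass is 0 there is no such density,
  but then \<open>w\<close> vanishes almost everywhere under both measures.\<close>

lemma weighted_Levy_uniqueness: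
  fixes M N :: "'b measure" and Y w :: "'b \<Rightarrow> real"
  assumes sets: "sets M = sets N"
    and M: "finite_measure M" and N: "finite_measure N"
    and Y[measurable]: "Y \<in> borel_measurable M" and w[measurable]: "w \<in> borel_measurable M"
    and w0: "\<And>x. 0 \<le> w x" and wB: "\<And>x. w x \<le> B"
    and eq: "\<And>t \<theta>. (\<integral>x. w x * cos (t * Y x + \<theta>) \<partial>M) = (\<integral>x. w x * cos (t * Y x + \<theta>) \<partial>N)"
    and A: "A \<in> sets borel"
  shows "(\<integral>x. w x * indicator A (Y x) \<partial>M) = (\<integral>x. w x * indicator A (Y x) \<partial>N)"
proof -
  have YN[measurable]: "Y \<in> borel_measurable N" and wN[measurable]: "w \<in> borel_measurable N"
    using Y w by (simp_all add: measurable_cong_sets[OF sets refl])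
  note A[measurable]
  have spc: "space M = space N" by (rule sets_eq_imp_space_eq[OF sets])
  have int: "integrable L (\<lambda>x. w x * g x)"
    if "finite_measure L" "w \<in> borel_measurable L" "g \<in> borel_measurable L" "\<And>x. \<bar>g x\<bar> \<le> 1" for L and g :: "'b \<Rightarrow> real"
    using that w0 wB
    by (intro finite_measure.integrable_const_bound[where B = B])
       (auto simp: abs_mult intro!: AE_I2 order_trans[OF mult_left_le])
  define W where "W = (\<integral>x. w x \<partial>M)"
  have WN: "W = (\<integral>x. w x \<partial>N)" using eq[of 0 0] by (simp add: W_def)
  have W0: "0 \<le> W" by (auto simp: W_def w0)
  show ?thesis
  proof (cases "W = 0")
    case True
    have "(\<integral>x. w x * indicator A (Y x) \<partial>L) = 0"
      if L: "finite_measure L" "w \<in> borel_measurable L" "(\<integral>x. w x \<partial>L) = 0" for L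
    proof -
      have "integrable L w" using int[OF L(1,2), of "\<lambda>_. 1"] by simp
      hence "AE x in L. w x = 0" using L(3) w0 by (subst (asm) integral_nonneg_eq_0_iff_AE) auto
      thus ?thesis by (intro integral_eq_zero_AE) auto
    qed
    from this[OF M w] this[OF N wN] True WN show ?thesis by (simp add: W_def)
  next
    case False
    hence Wp: "0 < W" using W0 by simp
    define D where "D L = distr (density L (\<lambda>x. ennreal (w x / W))) borel Y" for L
    have D: "real_distribution (D L) \<and> char (D L) t = complex_of_real ((\<integral>x. w x * cos (t * Y x) \<partial>L) / W)
         + \<i> * complex_of_real ((\<integral>x. w x * cos (t * Y x + - (pi / 2)) \<partial>L) / W)
         \<and> measure (D L) A = (\<integral>x. w x * indicator A (Y x) \<partial>L) / W"
      if L: "finite_measure L" "w \<in> borel_measurable L" "Y \<in> borel_measurable L" "(\<integral>x. w x \<partial>L) = W" for L t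
    proof -
      note [measurable] = L(2,3)
      have iw: "integrable L w" using int[OF L(1,2), of "\<lambda>_. 1"] by simp
      have "(\<integral>\<^sup>+x. ennreal (w x / W) \<partial>L) = ennreal (\<integral>x. w x / W \<partial>L)"
        using iw w0 Wp by (intro nn_integral_eq_integral) auto
      also have "\<dots> = 1" using L(4) Wp by simp
      finally have "prob_space (density L (\<lambda>x. ennreal (w x / W)))"
        by (intro prob_spaceI) (auto simp: emeasure_density cong: nn_integral_cong)
      then interpret P: prob_space "density L (\<lambda>x. ennreal (w x / W))" .
      have r: "real_distribution (D L)" unfolding D_def
        by (rule P.real_distribution_distr) simp
      have ic: "integrable L (\<lambda>x. w x * cos (t * Y x))" "integrable L (\<lambda>x. w x * sin (t * Y x))"
        by (rule int[OF L(1,2)]; simp)+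
      have "char (D L) t = (CLINT x|L. (w x / W) *\<^sub>R iexp (t * Y x))"
        unfolding char_def D_def using w0 Wp by (subst integral_distr) (auto simp: integral_density)
      also have "\<dots> = (CLINT x|L. complex_of_real (w x * cos (t * Y x) / W) + \<i> * complex_of_real (w x * sin (t * Y x) / W))"
        by (intro Bochner_Integration.integral_cong) (auto simp: complex_eq_iff Re_exp Im_exp)
      also have "\<dots> = complex_of_real ((\<integral>x. w x * cos (t * Y x) \<partial>L) / W)
         + \<i> * complex_of_real ((\<integral>x. w x * sin (t * Y x) \<partial>L) / W)"
      proof -
        have "integrable L (\<lambda>x. complex_of_real (w x * cos (t * Y x) / W))"
          "integrable L (\<lambda>x. \<i> * complex_of_real (w x * sin (t * Y x) / W))"
          by (intro integrable_mult_right integrable_of_real integrable_divide_zero ic)+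
        thus ?thesis
          by (simp add: Bochner_Integration.integral_add del: of_real_mult of_real_divide)
      qed
      also have "(\<lambda>x. w x * sin (t * Y x)) = (\<lambda>x. w x * cos (t * Y x + - (pi / 2)))"
        by (simp add: cos_diff)
      finally have c: "char (D L) t = complex_of_real ((\<integral>x. w x * cos (t * Y x) \<partial>L) / W)
         + \<i> * complex_of_real ((\<integral>x. w x * cos (t * Y x + - (pi / 2)) \<partial>L) / W)" .
      interpret R: real_distribution "D L" by (rule r)
      have "measure (D L) A = (\<integral>y. indicator A y \<partial>D L)" by simp
      also have "\<dots> = (\<integral>x. (w x / W) *\<^sub>R indicator A (Y x) \<partial>L)"
        unfolding D_def using w0 Wp by (subst integral_distr) (auto simp: integral_density)
      also have "\<dots> = (\<integral>x. w x * indicator A (Y x) \<partial>L) / W"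
        by simp
      finally show ?thesis using r c by blast
    qed
    note DM = D[OF M w Y W_def[symmetric]] and DN = D[OF N wN YN WN[symmetric]]
    have "D M = D N"
      using DM DN by (intro Levy_uniqueness) (auto simp: fun_eq_iff eq eq[where \<theta> = 0, simplified] eq[where \<theta> = "- (pi / 2)", simplified])
    hence "(\<integral>x. w x * indicator A (Y x) \<partial>M) / W = (\<integral>x. w x * indicator A (Y x) \<partial>N) / W"
      by (metis DM DN)
    thus ?thesis using Wp by simp
  qed
qed

text \<open>The cosines are traded for indicators of boxes one coordinate at a time: \<open>1 + cos \<ge> 0\<close> serves as
  a density, to which one-dimensional uniqueness applies.\<close>

lemma coords_measure_eqI:
  fixes \<mu> \<nu> :: "('i \<Rightarrow> real) measure"
  assumes sets: "sets \<mu> = sets coords" "sets \<nu> = sets coords"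
    and "prob_space \<mu>" "prob_space \<nu>"
    and eq: "\<And>J c \<theta>. finite J \<Longrightarrow>
      (\<integral>x. cos ((\<Sum>a\<in>J. c a * x a) + \<theta>) \<partial>\<mu>) = (\<integral>x. cos ((\<Sum>a\<in>J. c a * x a) + \<theta>) \<partial>\<nu>)"
  shows "\<mu> = \<nu>"
proof -
  interpret m: prob_space \<mu> by fact
  interpret n: prob_space \<nu> by fact
  have mm: "measurable \<mu> borel = measurable coords (borel :: real measure)"
     "measurable \<nu> borel = measurable coords (borel :: real measure)"
    by (rule measurable_cong_sets; simp add: sets)+
  \<comment> \<open>Intermediate stage of the exchange: coordinates in \<open>K\<close> already
    carry indicators, those in \<open>J\<close> still carry a cosine. Empty \<open>K\<close> is the
    hypothesis; empty \<open>J\<close> with phase 0 gives the measure of a box.\<close>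
  have main: "(\<integral>x. (\<Prod>a\<in>K. indicator (A a) (x a)) * cos ((\<Sum>a\<in>J. c a * x a) + \<theta>) \<partial>\<mu>)
      = (\<integral>x. (\<Prod>a\<in>K. indicator (A a) (x a)) * cos ((\<Sum>a\<in>J. c a * x a) + \<theta>) \<partial>\<nu>)"
    if "finite K" "finite J" "K \<inter> J = {}" "\<And>a. a \<in> K \<Longrightarrow> A a \<in> sets borel"
    for K J A and c :: "'i \<Rightarrow> real" and \<theta>
    using that
  proof (induction K arbitrary: J c \<theta>)
    case empty
    thus ?case using eq by simp
  next
    case (insert k K)
    have A[measurable]: "A a \<in> sets borel" if "a \<in> insert k K" for a using insert.prems that by auto
    define I where "I x = (\<Prod>a\<in>K. indicator (A a) (x a) :: real)" for x :: "'i \<Rightarrow> real"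
    have I[measurable]: "I \<in> borel_measurable coords" unfolding I_def[abs_def]
      by (intro borel_measurable_prod borel_measurable_indicator' measurable_component_singleton)
         (auto intro: A)
    have I01: "0 \<le> I x" "I x \<le> 1" for x unfolding I_def by (auto intro!: prod_nonneg prod_le_1)
    have cs[measurable]: "(\<lambda>x. cos ((\<Sum>a\<in>J'. c a * x a) + \<theta>)) \<in> borel_measurable coords" for J' c \<theta>
      by measurable
    have comp[measurable]: "(\<lambda>x. x k) \<in> borel_measurable coords" by measurable
    have IH: "(\<integral>x. I x * cos ((\<Sum>a\<in>J. c a * x a) + \<theta>) \<partial>\<mu>) = (\<integral>x. I x * cos ((\<Sum>a\<in>J. c a * x a) + \<theta>) \<partial>\<nu>)"
      if "finite J" "K \<inter> J = {}" for J c \<theta>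
      unfolding I_def by (rule insert.IH) (use that insert.prems in auto)
    have int: "integrable \<mu> (\<lambda>x. I x * g x)" "integrable \<nu> (\<lambda>x. I x * g x)"
      if [measurable]: "g \<in> borel_measurable coords" and "\<And>x. \<bar>g x\<bar> \<le> 2" for g :: "('i \<Rightarrow> real) \<Rightarrow> real"
    proof -
      have "norm (I x * g x) \<le> 2" for x
        using mult_mono[of "I x" 1 "\<bar>g x\<bar>" 2] I01[of x] that(2)[of x] by (simp add: abs_mult)
      thus "integrable \<mu> (\<lambda>x. I x * g x)" "integrable \<nu> (\<lambda>x. I x * g x)"
        by (auto intro!: m.integrable_const_bound[where B = 2] n.integrable_const_bound[where B = 2] simp: mm)
    qed
    \<comment> \<open>The choice \<open>s = 1\<close> brings in the cosine and \<open>s = 0\<close>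
      leaves it out. Both weights are nonnegative, and the difference of the two identities isolates
      the cosine.\<close>
    have step: "(\<integral>x. (I x * (1 + s * cos ((\<Sum>a\<in>J. c a * x a) + \<theta>))) * indicator (A k) (x k) \<partial>\<mu>)
       = (\<integral>x. (I x * (1 + s * cos ((\<Sum>a\<in>J. c a * x a) + \<theta>))) * indicator (A k) (x k) \<partial>\<nu>)"
      if s: "s \<in> {0, 1}" for s
    proof (rule weighted_Levy_uniqueness[where B = 2])
      fix x
      have c1: "\<bar>s * cos ((\<Sum>a\<in>J. c a * x a) + \<theta>)\<bar> \<le> 1" using s by (auto simp: abs_mult)
      thus "0 \<le> I x * (1 + s * cos ((\<Sum>a\<in>J. c a * x a) + \<theta>))"
        using I01 by (intro mult_nonneg_nonneg) (auto simp: abs_le_iff)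
      show "I x * (1 + s * cos ((\<Sum>a\<in>J. c a * x a) + \<theta>)) \<le> 2"
        using c1 I01[of x] mult_mono[of "I x" 1 "1 + s * cos ((\<Sum>a\<in>J. c a * x a) + \<theta>)" 2] by (auto simp: abs_le_iff)
    next
      fix t \<phi>
      have kJ: "k \<notin> J" using insert.prems by auto
      have sumk: "(\<Sum>a\<in>insert k J. (c(k := u)) a * x a) = u * x k + (\<Sum>a\<in>J. c a * x a)" for u and x :: "'i \<Rightarrow> real"
        using kJ insert.prems by (auto intro!: sum.cong)
      \<comment> \<open>Product-to-sum formula: the frequency of the new coordinate \<open>k\<close>
        enters with both signs, and every term is the cosine of a single linear form, to which the
        induction hypothesis applies.\<close>
      have e: "I x * (1 + s * cos ((\<Sum>a\<in>J. c a * x a) + \<theta>)) * cos (t * x k + \<phi>)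
        = I x * cos ((\<Sum>a\<in>{k}. t * x a) + \<phi>)
          + (s / 2) * (I x * cos ((\<Sum>a\<in>insert k J. (c(k := t)) a * x a) + (\<theta> + \<phi>)))
          + (s / 2) * (I x * cos ((\<Sum>a\<in>insert k J. (c(k := - t)) a * x a) + (\<theta> - \<phi>)))" for x
        unfolding sumk by (simp add: cos_add cos_diff sin_add sin_diff algebra_simps)
      have K: "K \<inter> insert k J = {}" "finite (insert k J)" using insert by auto
      have i: "integrable \<mu> (\<lambda>x. I x * cos ((\<Sum>a\<in>J. c a * x a) + \<theta>))"
         "integrable \<nu> (\<lambda>x. I x * cos ((\<Sum>a\<in>J. c a * x a) + \<theta>))" for J c \<theta>
        by (rule int; force intro: order_trans[OF abs_cos_le_one])+
      show "(\<integral>x. I x * (1 + s * cos ((\<Sum>a\<in>J. c a * x a) + \<theta>)) * cos (t * x k + \<phi>) \<partial>\<mu>)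
         = (\<integral>x. I x * (1 + s * cos ((\<Sum>a\<in>J. c a * x a) + \<theta>)) * cos (t * x k + \<phi>) \<partial>\<nu>)"
      proof -
        have Kk: "K \<inter> {k} = {}" using insert.hyps by auto
        have lin: "(\<integral>x. f1 x + r * f2 x + r * f3 x \<partial>L) = (\<integral>x. f1 x \<partial>L) + r * (\<integral>x. f2 x \<partial>L) + r * (\<integral>x. f3 x \<partial>L)"
          if "integrable L f1" "integrable L f2" "integrable L f3" for L :: "('i \<Rightarrow> real) measure" and f1 f2 f3 and r :: real
          using that by simp
        show ?thesis unfolding e
          by (simp only: lin[OF i(1) i(1) i(1)] lin[OF i(2) i(2) i(2)] IH[OF K(2,1)] IH[OF _ Kk] finite.intros)
      qed
    qed (use A in \<open>auto simp: sets mm m.finite_measure_axioms n.finite_measure_axioms\<close>)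
    have meas2: "(\<lambda>x. indicator (A k) (x k) * cos ((\<Sum>a\<in>J. c a * x a) + \<theta>)) \<in> borel_measurable coords"
      "(\<lambda>x. indicator (A k) (x k) :: real) \<in> borel_measurable coords"
      using A by measurable
    have i2: "integrable L (\<lambda>x. I x * (indicator (A k) (x k) * cos ((\<Sum>a\<in>J. c a * x a) + \<theta>)))"
      "integrable L (\<lambda>x. I x * indicator (A k) (x k))" if "L = \<mu> \<or> L = \<nu>" for L
    proof -
      have "\<bar>indicator (A k) (x k) * cos ((\<Sum>a\<in>J. c a * x a) + \<theta>)\<bar> \<le> 2" for x
        by (auto simp: indicator_def intro: order_trans[OF abs_cos_le_one])
      moreover have "\<bar>indicator (A k) (x k) :: real\<bar> \<le> 2" for x by (simp add: indicator_def)
      ultimately show "integrable L (\<lambda>x. I x * (indicator (A k) (x k) * cos ((\<Sum>a\<in>J. c a * x a) + \<theta>)))"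
        "integrable L (\<lambda>x. I x * indicator (A k) (x k))"
        using that int[OF meas2(1)] int[OF meas2(2)] by blast+
    qed
    have e2: "(\<integral>x. (\<Prod>a\<in>insert k K. indicator (A a) (x a)) * cos ((\<Sum>a\<in>J. c a * x a) + \<theta>) \<partial>L)
      = (\<integral>x. (I x * (1 + 1 * cos ((\<Sum>a\<in>J. c a * x a) + \<theta>))) * indicator (A k) (x k) \<partial>L)
        - (\<integral>x. (I x * (1 + 0 * cos ((\<Sum>a\<in>J. c a * x a) + \<theta>))) * indicator (A k) (x k) \<partial>L)" if "L = \<mu> \<or> L = \<nu>" for L
      using insert.hyps i2[OF that]
      by (simp add: I_def[symmetric] ring_distribs mult_ac)
    show ?case unfolding e2[of \<mu>, simplified] e2[of \<nu>, simplified] using step[of 0] step[of 1] by simp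
  qed
  show ?thesis
  proof (rule measure_eqI_PiM_infinite[OF sets])
    fix A :: "'i \<Rightarrow> real set" and J :: "'i set"
    assume J: "finite J" and A: "\<And>i. i \<in> J \<Longrightarrow> A i \<in> sets borel"
    have "measure \<mu> (prod_emb UNIV (\<lambda>_. borel) J (Pi\<^sub>E J A)) = measure \<nu> (prod_emb UNIV (\<lambda>_. borel) J (Pi\<^sub>E J A))"
    proof -
      have S: "prod_emb UNIV (\<lambda>_. borel) J (Pi\<^sub>E J A) \<in> sets coords"
        using J A by (intro sets_PiM_I) auto
      have ind: "(\<Prod>a\<in>J. indicator (A a) (x a)) * cos ((\<Sum>a\<in>{}. 0 * x a) + 0)
        = (indicator (prod_emb UNIV (\<lambda>_. borel) J (Pi\<^sub>E J A)) x :: real)" for x :: "'i \<Rightarrow> real"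
        using J by (auto simp: indicator_def prod_emb_def PiE_iff prod_zero_iff)
      show ?thesis using main[OF J, of "{}" A "\<lambda>_. 0" 0] A S unfolding ind
        by (simp add: sets)
    qed
    thus "\<mu> (prod_emb UNIV (\<lambda>_. borel) J (Pi\<^sub>E J A)) = \<nu> (prod_emb UNIV (\<lambda>_. borel) J (Pi\<^sub>E J A))"
      by (simp add: m.emeasure_eq_measure n.emeasure_eq_measure)
  qed (rule m.finite_measure_axioms)
qed

lemma lincomb_measurable [measurable]:
  "(\<lambda>(x, y) c. s * x c + t * y c) \<in> coords \<Otimes>\<^sub>M coords \<rightarrow>\<^sub>M coords"
  by (rule measurable_PiM_single') (auto simp: split_beta')

lemma scale_measurable [measurable]: "(\<lambda>x c. s * x c) \<in> coords \<rightarrow>\<^sub>M coords"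
  by (rule measurable_PiM_single') auto

text \<open>Here \<open>v\<close> stands for half the variance of the linear form with coefficients
  \<open>c\<close>. Vanishing sine integrals make the cosine integral with phase \<theta> equal to
  exp (- v) cos \<theta>; homogeneity of degree 2 then gives s v + t v = (s + t) v in the exponents
  of the two sides, and the cosine integrals determine the law.\<close>

lemma gaussian_char_stable:
  fixes \<mu> :: "('i \<Rightarrow> real) measure" and v :: "'i set \<Rightarrow> ('i \<Rightarrow> real) \<Rightarrow> real"
  assumes "prob_space \<mu>" and sets: "sets \<mu> = sets coords"
    and cos: "\<And>J c. finite J \<Longrightarrow> (\<integral>x. cos (\<Sum>a\<in>J. c a * x a) \<partial>\<mu>) = exp (- v J c)"
    and sin: "\<And>J c. finite J \<Longrightarrow> (\<integral>x. sin (\<Sum>a\<in>J. c a * x a) \<partial>\<mu>) = 0"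
    and v: "\<And>J c s. finite J \<Longrightarrow> v J (\<lambda>a. s * c a) = s\<^sup>2 * v J c"
    and st: "0 \<le> s" "0 \<le> t"
  shows "distr (\<mu> \<Otimes>\<^sub>M \<mu>) coords (\<lambda>(x, y) c. sqrt s * x c + sqrt t * y c)
    = distr \<mu> coords (\<lambda>x c. sqrt (s + t) * x c)"
proof -
  interpret prob_space \<mu> by fact
  interpret P: pair_prob_space \<mu> \<mu> by standard
  have M[measurable_cong]: "sets \<mu> = sets coords" by (rule sets)
  have meas[measurable]: "(\<lambda>(x, y) c. sqrt s * x c + sqrt t * y c) \<in> \<mu> \<Otimes>\<^sub>M \<mu> \<rightarrow>\<^sub>M coords"
    "(\<lambda>x c. sqrt (s + t) * x c) \<in> \<mu> \<rightarrow>\<^sub>M coords"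
    by measurable
  have int: "integrable \<mu> (\<lambda>x. cos (\<Sum>a\<in>J. c a * x a))" "integrable \<mu> (\<lambda>x. sin (\<Sum>a\<in>J. c a * x a))" for J c
    by (auto intro!: integrable_const_bound[where B = 1])
  have C: "(\<integral>x. cos ((\<Sum>a\<in>J. c a * x a) + \<theta>) \<partial>\<mu>) = exp (- v J c) * cos \<theta>"
     "(\<integral>x. sin ((\<Sum>a\<in>J. c a * x a) + \<theta>) \<partial>\<mu>) = exp (- v J c) * sin \<theta>" if "finite J" for J c \<theta>
    using int by (simp_all add: cos_add sin_add cos[OF that] sin[OF that])
  show ?thesis
  proof (rule coords_measure_eqI)
    fix J :: "'i set" and c \<theta> assume J: "finite J"
    have scale: "(\<Sum>a\<in>J. c a * (r * x a)) = (\<Sum>a\<in>J. (r * c a) * x a)" for r and x :: "'i \<Rightarrow> real"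
      by (simp add: mult_ac)
    have "(\<integral>x. cos ((\<Sum>a\<in>J. c a * x a) + \<theta>) \<partial>distr (\<mu> \<Otimes>\<^sub>M \<mu>) coords (\<lambda>(x, y) c. sqrt s * x c + sqrt t * y c))
      = (\<integral>(x, y). cos ((\<Sum>a\<in>J. (sqrt t * c a) * y a) + ((\<Sum>a\<in>J. (sqrt s * c a) * x a) + \<theta>)) \<partial>(\<mu> \<Otimes>\<^sub>M \<mu>))"
    proof -
      have "(\<Sum>a\<in>J. c a * (sqrt s * x a + sqrt t * y a)) + \<theta>
        = (\<Sum>a\<in>J. (sqrt t * c a) * y a) + ((\<Sum>a\<in>J. (sqrt s * c a) * x a) + \<theta>)" for x y :: "'i \<Rightarrow> real"
        by (simp add: distrib_left sum.distrib scale)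
      thus ?thesis by (subst integral_distr) (auto simp: split_beta' add.assoc)
    qed
    also have "\<dots> = (\<integral>x. \<integral>y. cos ((\<Sum>a\<in>J. (sqrt t * c a) * y a) + ((\<Sum>a\<in>J. (sqrt s * c a) * x a) + \<theta>)) \<partial>\<mu> \<partial>\<mu>)"
      by (rule P.integral_fst[symmetric]) (auto intro!: P.P.integrable_const_bound[where B = 1])
    also have "\<dots> = exp (- v J (\<lambda>a. sqrt t * c a)) * (exp (- v J (\<lambda>a. sqrt s * c a)) * cos \<theta>)"
      by (simp add: C[OF J])
    also have "\<dots> = exp (- v J (\<lambda>a. sqrt (s + t) * c a)) * cos \<theta>"
    proof -
      have "exp (- ((s + t) * v J c)) = exp (- (t * v J c)) * exp (- (s * v J c))"
        by (simp add: exp_add[symmetric] algebra_simps)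
      thus ?thesis using st by (simp add: v[OF J])
    qed
    also have "\<dots> = (\<integral>x. cos ((\<Sum>a\<in>J. (sqrt (s + t) * c a) * x a) + \<theta>) \<partial>\<mu>)"
      by (simp add: C[OF J])
    also have "\<dots> = (\<integral>x. cos ((\<Sum>a\<in>J. c a * x a) + \<theta>) \<partial>distr \<mu> coords (\<lambda>x c. sqrt (s + t) * x c))"
      by (subst integral_distr) (auto simp: scale)
    finally show "(\<integral>x. cos ((\<Sum>a\<in>J. c a * x a) + \<theta>) \<partial>distr (\<mu> \<Otimes>\<^sub>M \<mu>) coords (\<lambda>(x, y) c. sqrt s * x c + sqrt t * y c))
      = (\<integral>x. cos ((\<Sum>a\<in>J. c a * x a) + \<theta>) \<partial>distr \<mu> coords (\<lambda>x c. sqrt (s + t) * x c))" .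
  qed (auto intro!: P.prob_space_distr prob_space_distr)
qed

section \<open>Approximation by smooth functions\<close>

text \<open>Quantitative \<open>C\<^sup>1\<^sup>,\<^sup>1\<close> regularity with gradient \<open>a\<close>. Averaging over translations preserves it
  with the same constant \<open>B\<close>, and the one-step estimate below needs no second derivatives.\<close>

definition C11 :: "'i set \<Rightarrow> (('i \<Rightarrow> real) \<Rightarrow> real) \<Rightarrow> (('i \<Rightarrow> real) \<Rightarrow> 'i \<Rightarrow> real) \<Rightarrow> real \<Rightarrow> bool" where
  "C11 J F a B \<longleftrightarrow> F \<in> borel_measurable coords \<and> (\<forall>c\<in>J. (\<lambda>x. a x c) \<in> borel_measurable coords) \<and>
     (\<forall>x. \<bar>F x\<bar> \<le> B) \<and>
     (\<forall>x v. \<bar>\<Sum>c\<in>J. a x c * v c\<bar> \<le> B * (\<Sum>c\<in>J. \<bar>v c\<bar>)) \<and>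
     (\<forall>x v. \<bar>F (\<lambda>c. x c + v c) - F x\<bar> \<le> B * (\<Sum>c\<in>J. \<bar>v c\<bar>)) \<and>
     (\<forall>x v. \<bar>F (\<lambda>c. x c + v c) - F x - (\<Sum>c\<in>J. a x c * v c)\<bar> \<le> B * (\<Sum>c\<in>J. \<bar>v c\<bar>)\<^sup>2)"

lemma C11D:
  assumes "C11 J F a B"
  shows "F \<in> borel_measurable coords" "\<And>c. c \<in> J \<Longrightarrow> (\<lambda>x. a x c) \<in> borel_measurable coords"
    "\<bar>F x\<bar> \<le> B" "\<bar>\<Sum>c\<in>J. a x c * v c\<bar> \<le> B * (\<Sum>c\<in>J. \<bar>v c\<bar>)"
    "\<bar>F (\<lambda>c. x c + v c) - F x\<bar> \<le> B * (\<Sum>c\<in>J. \<bar>v c\<bar>)"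
    "\<bar>F (\<lambda>c. x c + v c) - F x - (\<Sum>c\<in>J. a x c * v c)\<bar> \<le> B * (\<Sum>c\<in>J. \<bar>v c\<bar>)\<^sup>2" "0 \<le> B"
  using assms unfolding C11_def by (blast, blast, blast, blast, blast, blast, meson abs_ge_zero order_trans)

lemma C11_mono: "C11 J F a B \<Longrightarrow> B \<le> B' \<Longrightarrow> C11 J F a B'"
  unfolding C11_def
  by (meson abs_ge_zero order_trans mult_right_mono sum_nonneg zero_le_power2)

lemma C11_const: "C11 J (\<lambda>_. k) (\<lambda>_ _. 0) \<bar>k\<bar>"
  unfolding C11_def by (auto intro!: mult_nonneg_nonneg sum_nonneg)

lemma C11_add:
  assumes F: "C11 J F a B" and G: "C11 J G b B'"
  shows "C11 J (\<lambda>x. F x + G x) (\<lambda>x c. a x c + b x c) (B + B')"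
proof -
  note f = C11D[OF F] and g = C11D[OF G]
  have [measurable]: "F \<in> borel_measurable coords" "G \<in> borel_measurable coords" using f(1) g(1) .
  have tri: "\<bar>(p::real) + q\<bar> \<le> u + w" if "\<bar>p\<bar> \<le> u" "\<bar>q\<bar> \<le> w" for p q u w using that by linarith
  show ?thesis unfolding C11_def
  proof (intro conjI allI ballI)
    fix x v
    show "\<bar>F x + G x\<bar> \<le> B + B'" by (rule tri[OF f(3) g(3)])
    show "\<bar>\<Sum>c\<in>J. (a x c + b x c) * v c\<bar> \<le> (B + B') * (\<Sum>c\<in>J. \<bar>v c\<bar>)"
      using tri[OF f(4) g(4)] by (simp add: distrib_right sum.distrib)
    show "\<bar>F (\<lambda>c. x c + v c) + G (\<lambda>c. x c + v c) - (F x + G x)\<bar> \<le> (B + B') * (\<Sum>c\<in>J. \<bar>v c\<bar>)"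
      using tri[OF f(5) g(5), of x v x v] by (simp add: distrib_right algebra_simps)
    show "\<bar>F (\<lambda>c. x c + v c) + G (\<lambda>c. x c + v c) - (F x + G x) - (\<Sum>c\<in>J. (a x c + b x c) * v c)\<bar> \<le> (B + B') * (\<Sum>c\<in>J. \<bar>v c\<bar>)\<^sup>2"
      using tri[OF f(6) g(6), of x v x v] by (simp add: distrib_right sum.distrib algebra_simps)
  qed (use f(2) g(2) in measurable)
qed

text \<open>The remainder splits as F' (G' - G - w) + (F' - F) w + G (F' - F - u), where primes mark
  shifted values and u, w are the linear parts. Each of the three terms is at most B B' n^2 with n
  the sum of |v c| over \<open>J\<close>, whence the factor 3.\<close>

lemma C11_mult:
  assumes F: "C11 J F a B" and G: "C11 J G b B'"
  shows "C11 J (\<lambda>x. F x * G x) (\<lambda>x c. F x * b x c + G x * a x c) (3 * (B * B'))"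
proof -
  note f = C11D[OF F] and g = C11D[OF G]
  have [measurable]: "F \<in> borel_measurable coords" "G \<in> borel_measurable coords" using f(1) g(1) .
  show ?thesis unfolding C11_def
  proof (intro conjI allI ballI)
    fix x v :: "'a \<Rightarrow> real"
    define n where "n = (\<Sum>c\<in>J. \<bar>v c\<bar>)"
    have n: "0 \<le> n" by (auto simp: n_def intro: sum_nonneg)
    have D: "0 \<le> B * B'" using f(7) g(7) by simp
    define F' G' u w where "F' = F (\<lambda>c. x c + v c)" and "G' = G (\<lambda>c. x c + v c)"
      and "u = (\<Sum>c\<in>J. a x c * v c)" and "w = (\<Sum>c\<in>J. b x c * v c)"
    have lin: "(\<Sum>c\<in>J. (F x * b x c + G x * a x c) * v c) = F x * w + G x * u"
      by (simp add: u_def w_def sum_distrib_left sum.distrib[symmetric] algebra_simps)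
    have m: "\<bar>p * q\<bar> \<le> P * Q" if "\<bar>p\<bar> \<le> P" "\<bar>q\<bar> \<le> Q" for p q P Q :: real
      using that unfolding abs_mult by (intro mult_mono) auto
    have b: "\<bar>F x\<bar> \<le> B" "\<bar>F'\<bar> \<le> B" "\<bar>G x\<bar> \<le> B'" "\<bar>u\<bar> \<le> B * n" "\<bar>w\<bar> \<le> B' * n"
      "\<bar>F' - F x\<bar> \<le> B * n" "\<bar>G' - G x\<bar> \<le> B' * n" "\<bar>F' - F x - u\<bar> \<le> B * n\<^sup>2" "\<bar>G' - G x - w\<bar> \<le> B' * n\<^sup>2"
      using f(3-6) g(3-6) by (auto simp: F'_def G'_def u_def w_def n_def)
    have DN: "0 \<le> (B * B') * n" using D n by simp
    show "\<bar>F x * G x\<bar> \<le> 3 * (B * B')" using m[OF b(1,3)] D by linarith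
    have "\<bar>F x * w + G x * u\<bar> \<le> 2 * (B * B') * n"
      using m[OF b(1,5)] m[OF b(3,4)] by (simp add: mult_ac)
    thus "\<bar>\<Sum>c\<in>J. (F x * b x c + G x * a x c) * v c\<bar> \<le> 3 * (B * B') * (\<Sum>c\<in>J. \<bar>v c\<bar>)"
      unfolding lin n_def[symmetric] using DN by linarith
    have "\<bar>F' * (G' - G x) + G x * (F' - F x)\<bar> \<le> 2 * (B * B') * n"
      using m[OF b(2,7)] m[OF b(3,6)] by (simp add: mult_ac)
    hence "\<bar>F' * G' - F x * G x\<bar> \<le> 3 * (B * B') * n"
      using DN by (simp add: algebra_simps) 
    thus "\<bar>F (\<lambda>c. x c + v c) * G (\<lambda>c. x c + v c) - F x * G x\<bar> \<le> 3 * (B * B') * (\<Sum>c\<in>J. \<bar>v c\<bar>)"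
      by (simp add: F'_def G'_def n_def)
    have "\<bar>F' * (G' - G x - w) + (F' - F x) * w + G x * (F' - F x - u)\<bar> \<le> 3 * (B * B') * n\<^sup>2"
      using m[OF b(2,9)] m[OF b(6,5)] m[OF b(3,8)] by (simp add: mult_ac power2_eq_square)
    moreover have "F' * (G' - G x - w) + (F' - F x) * w + G x * (F' - F x - u) = F' * G' - F x * G x - (F x * w + G x * u)"
      by (simp add: algebra_simps)
    ultimately show "\<bar>F (\<lambda>c. x c + v c) * G (\<lambda>c. x c + v c) - F x * G x - (\<Sum>c\<in>J. (F x * b x c + G x * a x c) * v c)\<bar>
        \<le> 3 * (B * B') * (\<Sum>c\<in>J. \<bar>v c\<bar>)\<^sup>2"
      unfolding lin by (simp add: F'_def G'_def n_def)
  qed (use f(2) g(2) in measurable)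
qed

text \<open>The arctangent is the smooth step from which indicators of half-spaces are built. Both
  bounds are mean value estimates, the second one after subtracting the tangent at
  \<open>u\<close>.\<close>

lemma arctan_bounds:
  fixes u w :: real
  shows "\<bar>arctan (u + w) - arctan u\<bar> \<le> \<bar>w\<bar>"
    and "\<bar>arctan (u + w) - arctan u - w / (1 + u\<^sup>2)\<bar> \<le> w\<^sup>2"
proof -
  have one: "1 + t\<^sup>2 \<noteq> 0" "1 \<le> 1 + t\<^sup>2" for t :: real
    using sum_power2_gt_zero_iff[of 1 t] by (auto simp: add_nonneg_eq_0_iff)
  have mvt: "\<bar>g (u + w) - g u\<bar> \<le> K * \<bar>w\<bar>"
    if d: "\<And>t. (g has_real_derivative g' t) (at t)"
      and b: "\<And>t. \<bar>t - u\<bar> \<le> \<bar>w\<bar> \<Longrightarrow> \<bar>g' t\<bar> \<le> K" for g g' :: "real \<Rightarrow> real" and K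
  proof -
    have "\<bar>t - u\<bar> \<le> \<bar>w\<bar>" if "t \<in> closed_segment u (u + w)" for t
      using that by (auto simp: closed_segment_eq_real_ivl split: if_splits)
    thus ?thesis
      using field_differentiable_bound[of "closed_segment u (u + w)" g g' K "u + w" u]
      by (auto intro: DERIV_subset d b)
  qed
  have "\<bar>arctan (u + w) - arctan u\<bar> \<le> 1 * \<bar>w\<bar>"
  proof (rule mvt)
    fix t show "(arctan has_real_derivative inverse (1 + t\<^sup>2)) (at t)" by (rule DERIV_arctan)
    show "\<bar>inverse (1 + t\<^sup>2)\<bar> \<le> 1" using one[of t] by (simp add: inverse_le_1_iff)
  qed
  thus "\<bar>arctan (u + w) - arctan u\<bar> \<le> \<bar>w\<bar>" by simp
  have "\<bar>(arctan (u + w) - (u + w) / (1 + u\<^sup>2)) - (arctan u - u / (1 + u\<^sup>2))\<bar> \<le> \<bar>w\<bar> * \<bar>w\<bar>"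
  proof (rule mvt)
    fix t show "((\<lambda>t. arctan t - t / (1 + u\<^sup>2)) has_real_derivative inverse (1 + t\<^sup>2) - 1 / (1 + u\<^sup>2)) (at t)"
      by (auto intro!: derivative_eq_intros simp: one)
    assume t: "\<bar>t - u\<bar> \<le> \<bar>w\<bar>"
    have "inverse (1 + t\<^sup>2) - 1 / (1 + u\<^sup>2) = (u\<^sup>2 - t\<^sup>2) / ((1 + t\<^sup>2) * (1 + u\<^sup>2))"
      using one(1)[of t] one(1)[of u] by (simp add: field_simps)
    also have "\<bar>\<dots>\<bar> = \<bar>t - u\<bar> * (\<bar>t + u\<bar> / ((1 + t\<^sup>2) * (1 + u\<^sup>2)))"
    proof -
      have "\<bar>u\<^sup>2 - t\<^sup>2\<bar> = \<bar>t - u\<bar> * \<bar>t + u\<bar>"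
        unfolding abs_mult[symmetric] by (subst abs_minus_commute) (simp add: power2_eq_square algebra_simps)
      moreover have "\<bar>(1 + t\<^sup>2) * (1 + u\<^sup>2)\<bar> = (1 + t\<^sup>2) * (1 + u\<^sup>2)" by (intro abs_of_nonneg) auto
      ultimately show ?thesis by (simp only: abs_divide times_divide_eq_right)
    qed
    also have "\<dots> \<le> \<bar>w\<bar> * 1"
    proof (intro mult_mono t)
      \<comment> \<open>Follows from 2 |t| <= 1 + t^2 and 2 |u| <= 1 + u^2; it makes the derivative
        of the arctangent Lipschitz with constant 1.\<close>
      have "\<bar>t + u\<bar> \<le> (1 + t\<^sup>2) * (1 + u\<^sup>2)"
      proof -
        have "0 \<le> (\<bar>t\<bar> - 1)\<^sup>2" "0 \<le> (\<bar>u\<bar> - 1)\<^sup>2" "0 \<le> t\<^sup>2 * u\<^sup>2" by auto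
        hence "2 * \<bar>t\<bar> \<le> 1 + t\<^sup>2" "2 * \<bar>u\<bar> \<le> 1 + u\<^sup>2" by (simp_all add: power2_eq_square algebra_simps)
        moreover have "0 \<le> t\<^sup>2" "0 \<le> u\<^sup>2" "0 \<le> t\<^sup>2 * u\<^sup>2" by auto
        moreover have "(1 + t\<^sup>2) * (1 + u\<^sup>2) = 1 + t\<^sup>2 + u\<^sup>2 + t\<^sup>2 * u\<^sup>2" by (simp add: algebra_simps)
        ultimately show ?thesis by linarith
      qed
      moreover have "0 < (1 + t\<^sup>2) * (1 + u\<^sup>2)"
        using one[of t] one[of u] by (intro mult_pos_pos) linarith+
      ultimately show "\<bar>t + u\<bar> / ((1 + t\<^sup>2) * (1 + u\<^sup>2)) \<le> 1" by simp
    qed auto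
    finally show "\<bar>inverse (1 + t\<^sup>2) - 1 / (1 + u\<^sup>2)\<bar> \<le> \<bar>w\<bar>" by simp
  qed
  thus "\<bar>arctan (u + w) - arctan u - w / (1 + u\<^sup>2)\<bar> \<le> w\<^sup>2"
    by (simp add: power2_eq_square add_divide_distrib algebra_simps)
qed

text \<open>The constant adds up three demands: 2 covers the supremum pi / 2, |k| the slope, and k^2
  the quadratic remainder.\<close>

lemma C11_arctan:
  assumes J: "finite J" and c: "c \<in> J"
  shows "C11 J (\<lambda>x. arctan (k * x c + d)) (\<lambda>x c'. if c' = c then k / (1 + (k * x c + d)\<^sup>2) else 0) (2 + \<bar>k\<bar> + k\<^sup>2)"
  unfolding C11_def
proof (intro conjI allI ballI)
  fix x v :: "'a \<Rightarrow> real"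
  define n where "n = (\<Sum>c\<in>J. \<bar>v c\<bar>)"
  have vn: "\<bar>v c\<bar> \<le> n" unfolding n_def using J c by (intro member_le_sum) auto
  have n: "0 \<le> n" using vn by linarith
  have lin: "(\<Sum>c'\<in>J. (if c' = c then k / (1 + (k * x c + d)\<^sup>2) else 0) * v c') = (k * v c) / (1 + (k * x c + d)\<^sup>2)"
  proof -
    have "(\<Sum>c'\<in>J. (if c' = c then k / (1 + (k * x c + d)\<^sup>2) else 0) * v c')
      = (\<Sum>c'\<in>J. if c' = c then (k * v c) / (1 + (k * x c + d)\<^sup>2) else 0)"
      by (intro sum.cong) auto
    thus ?thesis using J c by simp
  qed
  have kv: "\<bar>k * v c\<bar> \<le> \<bar>k\<bar> * n" using vn by (simp add: abs_mult mult_left_mono)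
  have kn: "\<bar>k\<bar> * n \<le> (2 + \<bar>k\<bar> + k\<^sup>2) * n" using n by (intro mult_right_mono) auto
  have "\<bar>arctan (k * x c + d)\<bar> \<le> pi / 2" using arctan_lbound[of "k * x c + d"] arctan_ubound[of "k * x c + d"] by linarith
  also have "pi / 2 \<le> 2 + \<bar>k\<bar> + k\<^sup>2" using pi_less_4 zero_le_power2[of k] by linarith
  finally show "\<bar>arctan (k * x c + d)\<bar> \<le> 2 + \<bar>k\<bar> + k\<^sup>2" .
  have "\<bar>(k * v c) / (1 + (k * x c + d)\<^sup>2)\<bar> \<le> \<bar>k * v c\<bar> / 1"
    unfolding abs_divide by (intro divide_left_mono) (auto simp: abs_of_pos add_pos_nonneg)
  thus "\<bar>\<Sum>c'\<in>J. (if c' = c then k / (1 + (k * x c + d)\<^sup>2) else 0) * v c'\<bar> \<le> (2 + \<bar>k\<bar> + k\<^sup>2) * (\<Sum>c\<in>J. \<bar>v c\<bar>)"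
    unfolding lin n_def[symmetric] using kv kn by simp
  have e: "k * (x c + v c) + d = (k * x c + d) + k * v c" by (simp add: algebra_simps)
  show "\<bar>arctan (k * (x c + v c) + d) - arctan (k * x c + d)\<bar> \<le> (2 + \<bar>k\<bar> + k\<^sup>2) * (\<Sum>c\<in>J. \<bar>v c\<bar>)"
    unfolding e n_def[symmetric] using arctan_bounds(1)[of "k * x c + d" "k * v c"] kv kn by linarith
  have "(k * v c)\<^sup>2 \<le> (\<bar>k\<bar> * n)\<^sup>2" using kv n by (subst abs_le_square_iff[symmetric]) (simp add: abs_mult)
  also have "\<dots> \<le> (2 + \<bar>k\<bar> + k\<^sup>2) * n\<^sup>2"
    unfolding power_mult_distrib by (intro mult_right_mono) auto
  finally show "\<bar>arctan (k * (x c + v c) + d) - arctan (k * x c + d)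
     - (\<Sum>c'\<in>J. (if c' = c then k / (1 + (k * x c + d)\<^sup>2) else 0) * v c')\<bar> \<le> (2 + \<bar>k\<bar> + k\<^sup>2) * (\<Sum>c\<in>J. \<bar>v c\<bar>)\<^sup>2"
    unfolding e lin n_def[symmetric] using arctan_bounds(2)[of "k * x c + d" "k * v c"] by linarith
next
  fix c' show "(\<lambda>x. if c' = c then k / (1 + (k * x c + d)\<^sup>2) else 0) \<in> borel_measurable coords"
    by (cases "c' = c") auto
qed measurable

text \<open>Approximants are confined to [0, 1] like \<open>F\<close> itself: on that range products
  and complements stay in the class and are Lipschitz for the L^1 distance.\<close>

definition C11_approximable :: "('i \<Rightarrow> real) measure \<Rightarrow> 'i set \<Rightarrow> (('i \<Rightarrow> real) \<Rightarrow> real) \<Rightarrow> bool" where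
  "C11_approximable \<mu> J F \<longleftrightarrow> F \<in> borel_measurable coords \<and> (\<forall>x. 0 \<le> F x \<and> F x \<le> 1) \<and>
     (\<forall>e>0. \<exists>G a B. C11 J G a B \<and> (\<forall>x. 0 \<le> G x \<and> G x \<le> 1) \<and> (\<integral>x. \<bar>G x - F x\<bar> \<partial>\<mu>) < e)"

lemma C11_approximableE:
  assumes "C11_approximable \<mu> J F" "0 < e"
  obtains G a B where "C11 J G a B" "\<And>x. 0 \<le> G x \<and> G x \<le> 1" "(\<integral>x. \<bar>G x - F x\<bar> \<partial>\<mu>) < e"
  using assms unfolding C11_approximable_def by blast

locale coords_prob_space = prob_space \<mu> for \<mu> :: "('i \<Rightarrow> real) measure" +
  assumes sets_eq: "sets \<mu> = sets coords"
begin

lemma sets_eq_coords [measurable_cong]: "sets \<mu> = sets coords"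
  by (rule sets_eq)

lemma integrable_diff_unit:
  assumes "F \<in> borel_measurable coords" "G \<in> borel_measurable coords"
    "\<And>x. 0 \<le> F x \<and> F x \<le> 1" "\<And>x. 0 \<le> G x \<and> G x \<le> (1::real)"
  shows "integrable \<mu> (\<lambda>x. \<bar>G x - F x\<bar>)"
proof -
  note [measurable] = assms(1,2)
  have "\<bar>G x - F x\<bar> \<le> 1" for x using assms(3,4)[of x] by auto
  thus ?thesis by (intro integrable_const_bound[where B = 1]) auto
qed

lemma C11_approximable_C11:
  "C11 J G a B \<Longrightarrow> (\<And>x. 0 \<le> G x \<and> G x \<le> 1) \<Longrightarrow> C11_approximable \<mu> J G"
  unfolding C11_approximable_def by (auto intro!: exI[of _ G] dest: C11D(1))

text \<open>For functions with values in [0, 1], pointwise convergence implies convergence in L^1 of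
  a probability measure. Half of \<open>e\<close> is spent on the limit and half on approximating
  one member of the sequence.\<close>

lemma C11_approximable_lim:
  assumes F: "\<And>n::nat. C11_approximable \<mu> J (F n)" and lim: "\<And>x. (\<lambda>n. F n x) \<longlonglongrightarrow> H x"
  shows "C11_approximable \<mu> J H"
  unfolding C11_approximable_def
proof (intro conjI allI impI)
  have F01: "0 \<le> F n x \<and> F n x \<le> 1" and [measurable]: "F n \<in> borel_measurable coords" for n x
    using F by (auto simp: C11_approximable_def)
  show Hm[measurable]: "H \<in> borel_measurable coords"
    by (rule borel_measurable_LIMSEQ_real[OF lim]) simp
  show H0: "0 \<le> H x" for x by (rule LIMSEQ_le_const[OF lim]) (use F01 in auto)
  show H1: "H x \<le> 1" for x by (rule LIMSEQ_le_const2[OF lim]) (use F01 in auto)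
  fix e :: real assume e: "0 < e"
  have "(\<lambda>n. \<integral>x. \<bar>F n x - H x\<bar> \<partial>\<mu>) \<longlonglongrightarrow> (\<integral>x. 0 \<partial>\<mu>)"
  proof (rule integral_dominated_convergence[where w = "\<lambda>_. 1"])
    show "AE x in \<mu>. norm \<bar>F n x - H x\<bar> \<le> 1" for n
    proof (rule AE_I2)
      fix x show "norm \<bar>F n x - H x\<bar> \<le> 1" using F01[of n x] H0[of x] H1[of x] by auto
    qed
    show "AE x in \<mu>. (\<lambda>n. \<bar>F n x - H x\<bar>) \<longlonglongrightarrow> 0"
      using tendsto_rabs_zero[OF LIM_zero[OF lim]] by auto
  qed auto
  hence "eventually (\<lambda>n. (\<integral>x. \<bar>F n x - H x\<bar> \<partial>\<mu>) < e / 2) sequentially"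
    using e by (intro order_tendstoD(2)) auto
  then obtain n where n: "(\<integral>x. \<bar>F n x - H x\<bar> \<partial>\<mu>) < e / 2"
    by (auto simp: eventually_sequentially)
  obtain G a B where G: "C11 J G a B" "\<And>x. 0 \<le> G x \<and> G x \<le> 1" "(\<integral>x. \<bar>G x - F n x\<bar> \<partial>\<mu>) < e / 2"
    using F[of n] half_gt_zero[OF e] by (rule C11_approximableE) blast
  note C11D(1)[OF G(1), measurable]
  have "(\<integral>x. \<bar>G x - H x\<bar> \<partial>\<mu>) \<le> (\<integral>x. \<bar>G x - F n x\<bar> + \<bar>F n x - H x\<bar> \<partial>\<mu>)"
    using G(2) F01 H0 H1 by (intro integral_mono Bochner_Integration.integrable_add integrable_diff_unit) auto
  also have "\<dots> = (\<integral>x. \<bar>G x - F n x\<bar> \<partial>\<mu>) + (\<integral>x. \<bar>F n x - H x\<bar> \<partial>\<mu>)"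
    using G(2) F01 H0 H1 by (intro Bochner_Integration.integral_add integrable_diff_unit) auto
  also have "\<dots> < e" using n G(3) by linarith
  finally show "\<exists>G a B. C11 J G a B \<and> (\<forall>x. 0 \<le> G x \<and> G x \<le> 1) \<and> (\<integral>x. \<bar>G x - H x\<bar> \<partial>\<mu>) < e"
    using G by blast
qed

lemma C11_approximable_compl:
  assumes F: "C11_approximable \<mu> J F"
  shows "C11_approximable \<mu> J (\<lambda>x. 1 - F x)"
  unfolding C11_approximable_def
proof (intro conjI allI impI)
  have [measurable]: "F \<in> borel_measurable coords" and F01: "\<And>x. 0 \<le> F x \<and> F x \<le> 1"
    using F by (auto simp: C11_approximable_def)
  show "(\<lambda>x. 1 - F x) \<in> borel_measurable coords" by measurable
  show "0 \<le> 1 - F x" "1 - F x \<le> 1" for x using F01[of x] by auto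
  fix e :: real assume e: "0 < e"
  obtain G a B where G: "C11 J G a B" "\<And>x. 0 \<le> G x \<and> G x \<le> 1" "(\<integral>x. \<bar>G x - F x\<bar> \<partial>\<mu>) < e"
    using F e by (rule C11_approximableE) blast
  have "C11 J (\<lambda>x. 1 + (- 1) * G x) (\<lambda>x c. 0 + ((- 1) * a x c + G x * 0)) (\<bar>1\<bar> + 3 * (\<bar>- 1\<bar> * B))"
    by (intro C11_add C11_mult C11_const G(1))
  moreover have "(\<integral>x. \<bar>(1 + (- 1) * G x) - (1 - F x)\<bar> \<partial>\<mu>) = (\<integral>x. \<bar>G x - F x\<bar> \<partial>\<mu>)"
    by (intro Bochner_Integration.integral_cong) auto
  ultimately show "\<exists>G a B. C11 J G a B \<and> (\<forall>x. 0 \<le> G x \<and> G x \<le> 1) \<and> (\<integral>x. \<bar>G x - (1 - F x)\<bar> \<partial>\<mu>) < e"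
    using G by (intro exI[of _ "\<lambda>x. 1 + (- 1) * G x"] exI conjI) auto
qed

text \<open>Common pattern behind products and convex combinations: the Lipschitz bound
  \<open>lip\<close> on the unit square adds up the two L^1 errors, and \<open>comb\<close> keeps
  the combined approximant smooth.\<close>

lemma C11_approximable_pair:
  assumes F: "C11_approximable \<mu> J F" and F': "C11_approximable \<mu> J F'"
    and comb: "\<And>G a B G' a' B'. C11 J G a B \<Longrightarrow> C11 J G' a' B' \<Longrightarrow> \<exists>b D. C11 J (\<lambda>x. h (G x) (G' x)) b D"
    and h01: "\<And>u w. 0 \<le> u \<Longrightarrow> u \<le> 1 \<Longrightarrow> 0 \<le> w \<Longrightarrow> w \<le> 1 \<Longrightarrow> 0 \<le> h u w \<and> h u w \<le> (1::real)"
    and lip: "\<And>u w u' w'. {u, w, u', w'} \<subseteq> {0..1} \<Longrightarrow> \<bar>h u w - h u' w'\<bar> \<le> \<bar>u - u'\<bar> + \<bar>w - w'\<bar>"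
    and hm: "case_prod h \<in> borel_measurable borel"
  shows "C11_approximable \<mu> J (\<lambda>x. h (F x) (F' x))"
  unfolding C11_approximable_def
proof (intro conjI allI impI)
  have [measurable]: "F \<in> borel_measurable coords" "F' \<in> borel_measurable coords"
    and F01: "\<And>x. 0 \<le> F x \<and> F x \<le> 1" "\<And>x. 0 \<le> F' x \<and> F' x \<le> 1"
    using F F' by (auto simp: C11_approximable_def)
  have hm'[measurable]: "(\<lambda>x. h (P x) (Q x)) \<in> borel_measurable M" if [measurable]: "P \<in> borel_measurable M" "Q \<in> borel_measurable M"
    for P Q and M :: "('i \<Rightarrow> real) measure"
    using measurable_compose[OF borel_measurable_Pair[OF that] hm] by simp
  show "(\<lambda>x. h (F x) (F' x)) \<in> borel_measurable coords" by measurable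
  show "0 \<le> h (F x) (F' x)" "h (F x) (F' x) \<le> 1" for x using h01 F01 by auto
  fix e :: real assume "0 < e"
  hence e: "0 < e / 2" by simp
  obtain G a B where G: "C11 J G a B" "\<And>x. 0 \<le> G x \<and> G x \<le> 1" "(\<integral>x. \<bar>G x - F x\<bar> \<partial>\<mu>) < e / 2"
    using F e by (rule C11_approximableE) blast
  obtain G' a' B' where G': "C11 J G' a' B'" "\<And>x. 0 \<le> G' x \<and> G' x \<le> 1" "(\<integral>x. \<bar>G' x - F' x\<bar> \<partial>\<mu>) < e / 2"
    using F' e by (rule C11_approximableE) blast
  note [measurable] = C11D(1)[OF G(1)] C11D(1)[OF G'(1)]
  have i: "integrable \<mu> (\<lambda>x. \<bar>G x - F x\<bar>)" "integrable \<mu> (\<lambda>x. \<bar>G' x - F' x\<bar>)"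
    "integrable \<mu> (\<lambda>x. \<bar>h (G x) (G' x) - h (F x) (F' x)\<bar>)"
    using F01 G(2) G'(2) h01 by (auto intro!: integrable_diff_unit)
  have "(\<integral>x. \<bar>h (G x) (G' x) - h (F x) (F' x)\<bar> \<partial>\<mu>) \<le> (\<integral>x. \<bar>G x - F x\<bar> + \<bar>G' x - F' x\<bar> \<partial>\<mu>)"
    using F01 G(2) G'(2) by (intro integral_mono i Bochner_Integration.integrable_add lip) auto
  also have "\<dots> = (\<integral>x. \<bar>G x - F x\<bar> \<partial>\<mu>) + (\<integral>x. \<bar>G' x - F' x\<bar> \<partial>\<mu>)"
    by (intro Bochner_Integration.integral_add i)
  also have "\<dots> < e" using G(3) G'(3) by linarith
  finally show "\<exists>G a B. C11 J G a B \<and> (\<forall>x. 0 \<le> G x \<and> G x \<le> 1) \<and> (\<integral>x. \<bar>G x - h (F x) (F' x)\<bar> \<partial>\<mu>) < e"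
    using comb[OF G(1) G'(1)] h01 G(2) G'(2) by blast
qed

lemma C11_approximable_mult:
  assumes "C11_approximable \<mu> J F" "C11_approximable \<mu> J F'"
  shows "C11_approximable \<mu> J (\<lambda>x. F x * F' x)"
proof (rule C11_approximable_pair[OF assms])
  fix u w u' w' :: real assume h: "{u, w, u', w'} \<subseteq> {0..1}"
  have "\<bar>u * w - u' * w'\<bar> = \<bar>(u - u') * w + u' * (w - w')\<bar>" by (simp add: algebra_simps)
  also have "\<dots> \<le> \<bar>u - u'\<bar> * \<bar>w\<bar> + \<bar>u'\<bar> * \<bar>w - w'\<bar>" by (metis abs_mult abs_triangle_ineq)
  also have "\<dots> \<le> \<bar>u - u'\<bar> * 1 + 1 * \<bar>w - w'\<bar>" using h by (intro add_mono mult_mono) auto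
  finally show "\<bar>u * w - u' * w'\<bar> \<le> \<bar>u - u'\<bar> + \<bar>w - w'\<bar>" by simp
qed (auto simp: split_beta' intro: C11_mult mult_le_one intro!: borel_measurable_continuous_onI continuous_intros)

lemma C11_approximable_convex:
  assumes "C11_approximable \<mu> J F" "C11_approximable \<mu> J F'" and t: "0 \<le> t" "t \<le> 1"
  shows "C11_approximable \<mu> J (\<lambda>x. t * F x + (1 - t) * F' x)"
proof (rule C11_approximable_pair[OF assms(1,2), where h = "\<lambda>u w. t * u + (1 - t) * w"])
  fix G a B G' a' B' assume G: "C11 J G a B" "C11 J G' a' B'"
  show "\<exists>b D. C11 J (\<lambda>x. t * G x + (1 - t) * G' x) b D"
    using C11_add[OF C11_mult[OF C11_const[of J t] G(1)] C11_mult[OF C11_const[of J "1 - t"] G(2)]] by blast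
next
  fix u w u' w' :: real assume h: "{u, w, u', w'} \<subseteq> {0..1}"
  have "\<bar>t * u + (1 - t) * w - (t * u' + (1 - t) * w')\<bar> = \<bar>t * (u - u') + (1 - t) * (w - w')\<bar>" by (simp add: algebra_simps)
  also have "\<dots> \<le> t * \<bar>u - u'\<bar> + (1 - t) * \<bar>w - w'\<bar>" using t by (metis abs_mult abs_of_nonneg abs_triangle_ineq diff_ge_0_iff_ge)
  also have "\<dots> \<le> 1 * \<bar>u - u'\<bar> + 1 * \<bar>w - w'\<bar>" using t by (intro add_mono mult_right_mono) auto
  finally show "\<bar>t * u + (1 - t) * w - (t * u' + (1 - t) * w')\<bar> \<le> \<bar>u - u'\<bar> + \<bar>w - w'\<bar>" by simp
next
  fix u w :: real assume "0 \<le> u" "u \<le> 1" "0 \<le> w" "w \<le> 1"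
  thus "0 \<le> t * u + (1 - t) * w \<and> t * u + (1 - t) * w \<le> 1"
    using t convex_bound_le[of u 1 w t "1 - t"] by auto
qed (auto simp: split_beta' intro!: borel_measurable_continuous_onI continuous_intros)

text \<open>Averages are iterated convex combinations: the average of n + 2 functions puts weight (n
  + 1) / (n + 2) on the average of the first n + 1 of them.\<close>

lemma C11_approximable_average:
  assumes "\<And>j. C11_approximable \<mu> J (F j)"
  shows "C11_approximable \<mu> J (\<lambda>x. (\<Sum>j\<le>n. F j x) / real (Suc n))"
proof (induction n)
  case 0
  thus ?case using assms[of 0] by simp
next
  case (Suc n)
  define t where "t = real (Suc n) / real (Suc (Suc n))"
  have t: "0 \<le> t" "t \<le> 1" "1 - t = 1 / real (Suc (Suc n))" by (auto simp: t_def field_simps)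
  from C11_approximable_convex[OF Suc.IH assms[of "Suc n"] t(1,2)]
  have "C11_approximable \<mu> J (\<lambda>x. t * ((\<Sum>j\<le>n. F j x) / real (Suc n)) + (1 - t) * F (Suc n) x)" .
  also have "(\<lambda>x. t * ((\<Sum>j\<le>n. F j x) / real (Suc n)) + (1 - t) * F (Suc n) x)
    = (\<lambda>x. (\<Sum>j\<le>Suc n. F j x) / real (Suc (Suc n)))"
    unfolding t(3) by (rule ext) (simp add: t_def add_divide_distrib del: of_nat_Suc)
  finally show ?case .
qed

section \<open>The sigma-algebra of sets with approximable indicator\<close>

definition approximable_sets :: "'i set \<Rightarrow> ('i \<Rightarrow> real) set set" where
  "approximable_sets J = {A. C11_approximable \<mu> J (indicator A)}"

lemma approximable_sets_Un:
  assumes "A \<in> approximable_sets J" "B \<in> approximable_sets J"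
  shows "A \<union> B \<in> approximable_sets J"
proof -
  have "C11_approximable \<mu> J (\<lambda>x. 1 - (1 - indicator A x) * (1 - indicator B x))"
    using assms by (auto simp: approximable_sets_def intro!: C11_approximable_compl C11_approximable_mult)
  also have "(\<lambda>x. 1 - (1 - indicator A x) * (1 - indicator B x)) = (indicator (A \<union> B) :: _ \<Rightarrow> real)"
    by (auto simp: fun_eq_iff indicator_def)
  finally show ?thesis by (simp add: approximable_sets_def)
qed

text \<open>Complements come from 1 - F, finite unions from products of complements, countable
  unions from pointwise limits of finite ones. It therefore suffices to approximate a generator,
  here the half-spaces.\<close>

lemma sigma_algebra_approximable: "sigma_algebra UNIV (approximable_sets J)"
proof (rule sigma_algebra_iff2[THEN iffD2], intro conjI ballI allI impI)
  show empty: "{} \<in> approximable_sets J"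
    using C11_approximable_C11[OF C11_const[of J 0]] by (simp add: approximable_sets_def indicator_def[abs_def])
  show "UNIV - A \<in> approximable_sets J" if "A \<in> approximable_sets J" for A
  proof -
    have "C11_approximable \<mu> J (\<lambda>x. 1 - indicator A x)"
      using that by (auto simp: approximable_sets_def intro: C11_approximable_compl)
    also have "(\<lambda>x. 1 - indicator A x) = (indicator (UNIV - A) :: _ \<Rightarrow> real)"
      by (auto simp: fun_eq_iff indicator_def)
    finally show ?thesis by (simp add: approximable_sets_def)
  qed
  fix A :: "nat \<Rightarrow> ('i \<Rightarrow> real) set" assume A: "range A \<subseteq> approximable_sets J"
  have fin: "(\<Union>i<n. A i) \<in> approximable_sets J" for n
    by (induction n) (use A empty approximable_sets_Un in \<open>auto simp: lessThan_Suc\<close>)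
  have "C11_approximable \<mu> J (indicator (\<Union>i. A i))"
  proof (rule C11_approximable_lim)
    show "C11_approximable \<mu> J (indicator (\<Union>i<n. A i))" for n
      using fin by (simp add: approximable_sets_def)
    show "(\<lambda>n. indicator (\<Union>i<n. A i) x :: real) \<longlonglongrightarrow> indicator (\<Union>i. A i) x" for x
      by (rule LIMSEQ_indicator_UN)
  qed
  thus "(\<Union>i. A i) \<in> approximable_sets J" by (simp add: approximable_sets_def)
qed simp

lemma approximable_half_space:
  assumes J: "finite J" and c: "c \<in> J"
  shows "{x. x c \<le> b} \<in> approximable_sets J"
proof -
  \<comment> \<open>Away from the boundary the slope n^2 beats the shift n; on the boundary x c = b
    the shift alone drives the argument to infinity. Hence the limit is the indicator of the closed
    half-space.\<close>
  define G where "G n x = 1 / 2 + (1 / pi) * arctan (- (real n)\<^sup>2 * x c + ((real n)\<^sup>2 * b + real n))" for n :: nat and x :: "'i \<Rightarrow> real"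
  have "C11_approximable \<mu> J (indicator {x. x c \<le> b})"
  proof (rule C11_approximable_lim)
    fix n
    show "C11_approximable \<mu> J (G n)" unfolding G_def[abs_def]
    proof (rule C11_approximable_C11)
      show "C11 J (\<lambda>x. 1 / 2 + (1 / pi) * arctan (- (real n)\<^sup>2 * x c + ((real n)\<^sup>2 * b + real n)))
        (\<lambda>x c'. 0 + ((1 / pi) * (if c' = c then - (real n)\<^sup>2 / (1 + (- (real n)\<^sup>2 * x c + ((real n)\<^sup>2 * b + real n))\<^sup>2) else 0)
            + arctan (- (real n)\<^sup>2 * x c + ((real n)\<^sup>2 * b + real n)) * 0))
        (\<bar>1 / 2\<bar> + 3 * (\<bar>1 / pi\<bar> * (2 + \<bar>- (real n)\<^sup>2\<bar> + (- (real n)\<^sup>2)\<^sup>2)))"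
        by (intro C11_add C11_mult C11_const C11_arctan J c)
      show "0 \<le> 1 / 2 + (1 / pi) * arctan y \<and> 1 / 2 + (1 / pi) * arctan y \<le> 1" for y
        using arctan_lbound[of y] arctan_ubound[of y] pi_gt_zero by (simp add: field_simps)
    qed
  next
    fix x :: "'i \<Rightarrow> real"
    define d where "d = b - x c"
    have G: "G n x = 1 / 2 + (1 / pi) * arctan ((real n)\<^sup>2 * d + real n)" for n
      by (simp add: G_def d_def algebra_simps)
    show "(\<lambda>n. G n x) \<longlonglongrightarrow> indicator {x. x c \<le> b} x"
    proof (cases "0 \<le> d")
      case True
      hence "filterlim (\<lambda>n. (real n)\<^sup>2 * d + real n) at_top sequentially"
        by (intro filterlim_at_top_mono[OF filterlim_real_sequentially]) auto
      from tendsto_add[OF tendsto_const[of "1/2"] tendsto_mult[OF tendsto_const[of "1/pi"]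
          filterlim_compose[OF tendsto_arctan_at_top this]]]
      show ?thesis using True by (simp add: G d_def)
    next
      case False
      have "filterlim (\<lambda>n. (real n)\<^sup>2 * d + real n) at_bot sequentially"
      proof -
        have "d < 0" using False by simp
        thus ?thesis by real_asymp
      qed
      from tendsto_add[OF tendsto_const[of "1/2"] tendsto_mult[OF tendsto_const[of "1/pi"]
          filterlim_compose[OF tendsto_arctan_at_bot this]]]
      show ?thesis using False by (simp add: G d_def)
    qed
  qed
  thus ?thesis by (simp add: approximable_sets_def)
qed

text \<open>Half-lines generate the Borel sets of the line, so approximable half-spaces make each
  coordinate in \<open>J\<close> measurable. Preimages of measurable sets of the finite product are
  thereby approximable.\<close>

lemma restrict_measurable_approximable:
  assumes J: "finite J"
  shows "(\<lambda>x. restrict x J) \<in> sigma UNIV (approximable_sets J) \<rightarrow>\<^sub>M PiM J (\<lambda>_. borel)"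
proof (rule measurable_PiM_single')
  fix c assume c: "c \<in> J"
  have "(\<lambda>x. x c) \<in> borel_measurable (sigma UNIV (approximable_sets J))"
  proof (rule borel_measurable_iff_le[THEN iffD2], rule allI)
    fix b show "{w \<in> space (sigma UNIV (approximable_sets J)). w c \<le> b} \<in> sets (sigma UNIV (approximable_sets J))"
      using approximable_half_space[OF J c, of b] sigma_algebra.sigma_sets_eq[OF sigma_algebra_approximable]
      by (simp add: sets_measure_of_conv space_measure_of_conv)
  qed
  thus "(\<lambda>x. restrict x J c) \<in> borel_measurable (sigma UNIV (approximable_sets J))" using c by simp
qed auto

text \<open>The sum counts the thresholds (j + 1) / (n + 1) that do not exceed \<open>y\<close>, and
  there are floor ((n + 1) y) of them: a layer-cake approximation with uniform error.\<close>

lemma floor_average: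
  assumes "0 \<le> y" "y \<le> (1::real)"
  shows "\<bar>(\<Sum>j\<le>n. indicator {t. real (Suc j) / real (Suc n) \<le> t} y) / real (Suc n) - y\<bar> \<le> 1 / real (Suc n)"
proof -
  define k where "k = nat \<lfloor>real (Suc n) * y\<rfloor>"
  have k: "real k \<le> real (Suc n) * y" "real (Suc n) * y < real k + 1"
    using assms by (auto simp: k_def intro: mult_nonneg_nonneg)
  have "real (Suc n) * y \<le> real (Suc n) * 1" using assms by (intro mult_left_mono) auto
  hence "real k \<le> real (Suc n)" using k(1) by (simp only: mult_1_right)
  hence kn: "k \<le> Suc n" by (simp only: of_nat_le_iff)
  have iff: "real (Suc j) / real (Suc n) \<le> y \<longleftrightarrow> j < k" for j
  proof -
    have "real (Suc j) / real (Suc n) \<le> y \<longleftrightarrow> real (Suc j) \<le> real (Suc n) * y"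
      by (simp add: pos_divide_le_eq mult.commute del: of_nat_Suc)
    also have "\<dots> \<longleftrightarrow> Suc j \<le> k"
      using k by linarith
    finally show ?thesis by auto
  qed
  have "(\<Sum>j\<le>n. indicator {t. real (Suc j) / real (Suc n) \<le> t} y :: real) = (\<Sum>j\<le>n. of_bool (j < k))"
    by (intro sum.cong) (auto simp: indicator_def iff simp del: of_nat_Suc)
  also have "\<dots> = real (card {j. j \<le> n \<and> j < k})" by (simp add: sum_of_bool_eq Int_def)
  also have "{j. j \<le> n \<and> j < k} = {..<k}" using kn by auto
  finally have e: "(\<Sum>j\<le>n. indicator {t. real (Suc j) / real (Suc n) \<le> t} y :: real) = real k" by simp
  have "real k / real (Suc n) - y = (real k - real (Suc n) * y) / real (Suc n)"
    by (simp add: diff_divide_distrib del: of_nat_Suc)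
  moreover have "\<bar>\<dots>\<bar> \<le> 1 / real (Suc n)"
    using k unfolding abs_divide by (simp add: divide_right_mono del: of_nat_Suc)
  ultimately show ?thesis unfolding e by simp
qed

text \<open>Up to 1 / (n + 1), \<open>F\<close> is an average of indicators of its superlevel sets,
  and these sets are approximable. The composition with \<open>restrict\<close> fits the notion of
  smoothness: the increment bound in \<open>C11\<close> lets a function depend on the coordinates in
  \<open>J\<close> only.\<close>

lemma C11_dense:
  assumes J: "finite J" and F: "F \<in> borel_measurable (PiM J (\<lambda>_. borel))"
    and F01: "\<And>x. x \<in> space (PiM J (\<lambda>_. borel :: real measure)) \<Longrightarrow> 0 \<le> F x \<and> F x \<le> (1::real)"
  shows "C11_approximable \<mu> J (\<lambda>x. F (restrict x J))"
proof (rule C11_approximable_lim)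
  have F01': "0 \<le> F (restrict x J)" "F (restrict x J) \<le> 1" for x
    using F01[of "restrict x J"] by (auto simp: space_PiM)
  fix n
  show "C11_approximable \<mu> J (\<lambda>x. (\<Sum>j\<le>n. indicator {x. real (Suc j) / real (Suc n) \<le> F (restrict x J)} x) / real (Suc n))"
  proof (rule C11_approximable_average)
    fix j
    have "(\<lambda>x. F (restrict x J)) \<in> borel_measurable (sigma UNIV (approximable_sets J))"
      by (rule measurable_compose[OF restrict_measurable_approximable[OF J] F])
    hence "{x \<in> space (sigma UNIV (approximable_sets J)). real (Suc j) / real (Suc n) \<le> F (restrict x J)}
        \<in> sets (sigma UNIV (approximable_sets J))"
      by (auto simp: borel_measurable_iff_ge simp del: of_nat_Suc)
    hence "{x. real (Suc j) / real (Suc n) \<le> F (restrict x J)} \<in> approximable_sets J"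
      using sigma_algebra.sigma_sets_eq[OF sigma_algebra_approximable]
      by (simp add: sets_measure_of_conv space_measure_of_conv del: of_nat_Suc)
    thus "C11_approximable \<mu> J (indicator {x. real (Suc j) / real (Suc n) \<le> F (restrict x J)})"
      by (simp add: approximable_sets_def)
  qed
  fix x
  have "(\<lambda>n. (\<Sum>j\<le>n. indicator {x. real (Suc j) / real (Suc n) \<le> F (restrict x J)} x) / real (Suc n) - F (restrict x J)) \<longlonglongrightarrow> 0"
    (is "?f \<longlonglongrightarrow> 0")
  proof (rule Lim_null_comparison)
    show "\<forall>\<^sub>F n in sequentially. norm (?f n) \<le> 1 / real (Suc n)"
      using floor_average[OF F01'] by (auto simp: indicator_def simp del: of_nat_Suc)
    show "(\<lambda>n. 1 / real (Suc n)) \<longlonglongrightarrow> 0" by (rule LIMSEQ_Suc[OF lim_1_over_n])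
  qed
  thus "(\<lambda>n. (\<Sum>j\<le>n. indicator {x. real (Suc j) / real (Suc n) \<le> F (restrict x J)} x) / real (Suc n)) \<longlonglongrightarrow> F (restrict x J)"
    by (rule LIM_zero_cancel)
qed

end

section \<open>The heat semigroup of a stable law\<close>

text \<open>Apart from covariances, this is what the argument takes from the Gaussian law:
  \<open>stable\<close> yields the semigroup law, zero means remove the first-order terms, and third
  moments control the remainder.\<close>

locale stable_law = coords_prob_space \<mu> for \<mu> :: "('i \<Rightarrow> real) measure" +
  fixes I :: "'i set"
  assumes finite_I: "finite I"
    and stable: "\<And>s t. 0 \<le> s \<Longrightarrow> 0 \<le> t \<Longrightarrow>
      distr (\<mu> \<Otimes>\<^sub>M \<mu>) coords (\<lambda>(x, y) c. sqrt s * x c + sqrt t * y c)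
      = distr \<mu> coords (\<lambda>x c. sqrt (s + t) * x c)"
    and mean: "\<And>c. c \<in> I \<Longrightarrow> (\<integral>x. x c \<partial>\<mu>) = 0"
    and moment3: "\<And>c. c \<in> I \<Longrightarrow> integrable \<mu> (\<lambda>x. \<bar>x c\<bar> ^ 3)"
begin

definition U :: "real \<Rightarrow> (('i \<Rightarrow> real) \<Rightarrow> real) \<Rightarrow> ('i \<Rightarrow> real) \<Rightarrow> real" where
  "U s F x = (\<integral>y. F (\<lambda>c. x c + sqrt s * y c) \<partial>\<mu>)"

lemma shift_measurable [measurable]:
  "(\<lambda>y c. x c + t * y c) \<in> coords \<rightarrow>\<^sub>M coords"
  "(\<lambda>(x, y) c. x c + t * y c) \<in> coords \<Otimes>\<^sub>M coords \<rightarrow>\<^sub>M coords"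
  by (rule measurable_PiM_single'; auto simp: split_beta')+

lemma comp_shift_measurable:
  assumes [measurable]: "F \<in> borel_measurable coords"
  shows "(\<lambda>y. F (\<lambda>c. x c + t * y c) :: real) \<in> borel_measurable \<mu>"
proof -
  have "(\<lambda>y c. x c + t * y c) \<in> \<mu> \<rightarrow>\<^sub>M coords" by measurable
  from measurable_compose[OF this assms] show ?thesis by simp
qed

lemma U_measurable [measurable]:
  assumes [measurable]: "F \<in> borel_measurable coords"
  shows "U s F \<in> borel_measurable coords"
proof -
  have "(\<lambda>(x, y) c. x c + sqrt s * y c) \<in> coords \<Otimes>\<^sub>M \<mu> \<rightarrow>\<^sub>M coords" by measurable
  from measurable_compose[OF this assms]
  have "(\<lambda>(x, y). F (\<lambda>c. x c + sqrt s * y c)) \<in> borel_measurable (coords \<Otimes>\<^sub>M \<mu>)"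
    by (simp add: split_beta')
  thus ?thesis unfolding U_def[abs_def] by (rule borel_measurable_lebesgue_integral)
qed

lemma integrable_shift:
  assumes "F \<in> borel_measurable coords" "\<And>x. \<bar>F x\<bar> \<le> (B::real)"
  shows "integrable \<mu> (\<lambda>y. F (\<lambda>c. x c + t * y c))"
  using assms by (intro integrable_const_bound[where B = B] comp_shift_measurable) auto

lemma integral_abs_le:
  assumes "g \<in> borel_measurable \<mu>" "\<And>x. \<bar>g x\<bar> \<le> (K::real)"
  shows "\<bar>\<integral>x. g x \<partial>\<mu>\<bar> \<le> K"
proof -
  have i: "integrable \<mu> g" using assms by (intro integrable_const_bound[where B = K]) auto
  have "\<bar>\<integral>x. g x \<partial>\<mu>\<bar> \<le> (\<integral>x. \<bar>g x\<bar> \<partial>\<mu>)" by (rule integral_abs_bound)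
  also have "\<dots> \<le> (\<integral>x. K \<partial>\<mu>)" by (intro integral_mono) (use i assms in auto)
  finally show ?thesis by (simp add: prob_space)
qed

lemma U_U:
  assumes F[measurable]: "F \<in> borel_measurable coords" and B: "\<And>x. \<bar>F x\<bar> \<le> B" and st: "0 \<le> s" "0 \<le> t"
  shows "U s (U t F) x = U (s + t) F x"
proof -
  interpret P: pair_prob_space \<mu> \<mu> by standard
  have "(\<lambda>(y, z) c. x c + (sqrt s * y c + sqrt t * z c)) \<in> \<mu> \<Otimes>\<^sub>M \<mu> \<rightarrow>\<^sub>M coords"
    by (rule measurable_PiM_single') (auto simp: split_beta')
  from measurable_compose[OF this F]
  have m: "(\<lambda>(y, z). F (\<lambda>c. x c + (sqrt s * y c + sqrt t * z c))) \<in> borel_measurable (\<mu> \<Otimes>\<^sub>M \<mu>)"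
    by (simp add: split_beta')
  have G: "(\<lambda>y. F (\<lambda>c. x c + y c)) \<in> borel_measurable coords"
    using measurable_compose[OF shift_measurable(1)[of x 1] F] by simp
  have m1: "(\<lambda>(x, y) c. sqrt s * x c + sqrt t * y c) \<in> \<mu> \<Otimes>\<^sub>M \<mu> \<rightarrow>\<^sub>M coords" by measurable
  have m2: "(\<lambda>x c. sqrt (s + t) * x c) \<in> \<mu> \<rightarrow>\<^sub>M coords" by measurable
  have "U s (U t F) x = (\<integral>y. \<integral>z. F (\<lambda>c. x c + (sqrt s * y c + sqrt t * z c)) \<partial>\<mu> \<partial>\<mu>)"
    by (simp add: U_def add.assoc)
  also have "\<dots> = (\<integral>(y, z). F (\<lambda>c. x c + (sqrt s * y c + sqrt t * z c)) \<partial>(\<mu> \<Otimes>\<^sub>M \<mu>))"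
    using m B by (intro P.integral_fst) (auto intro!: P.P.integrable_const_bound[where B = B])
  also have "\<dots> = (\<integral>y. F (\<lambda>c. x c + y c) \<partial>distr (\<mu> \<Otimes>\<^sub>M \<mu>) coords (\<lambda>(x, y) c. sqrt s * x c + sqrt t * y c))"
    by (subst integral_distr[OF m1 G]) (simp add: split_beta')
  also have "\<dots> = U (s + t) F x"
    unfolding stable[OF st] U_def by (subst integral_distr[OF m2 G]) simp
  finally show ?thesis .
qed

lemma U_0: "U 0 F x = F x"
  by (simp add: U_def prob_space)

lemma U_1: "U 1 F (\<lambda>_. 0) = (\<integral>x. F x \<partial>\<mu>)"
  by (simp add: U_def)

lemma U_ge:
  assumes "F \<in> borel_measurable coords" "\<And>x. \<bar>F x\<bar> \<le> B" "\<And>x. K \<le> F x"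
  shows "K \<le> U s F x"
proof -
  have "(\<integral>y. K \<partial>\<mu>) \<le> U s F x" unfolding U_def
    using assms by (intro integral_mono integrable_shift) auto
  thus ?thesis by (simp add: prob_space)
qed

text \<open>Testing the linear form on a unit vector; the bound makes the partial derivatives
  integrable over translations.\<close>

lemma C11_gradient_bound:
  assumes F: "C11 J F a B" and J: "finite J" and c: "c \<in> J"
  shows "\<bar>a x c\<bar> \<le> B"
proof -
  have "(\<Sum>c'\<in>J. a x c' * (if c' = c then 1 else 0)) = (\<Sum>c'\<in>J. if c' = c then a x c else 0)"
    by (intro sum.cong) auto
  hence "(\<Sum>c'\<in>J. a x c' * (if c' = c then 1 else 0)) = a x c" using J c by simp
  moreover have "(\<Sum>c'\<in>J. \<bar>if c' = c then 1 else 0 :: real\<bar>) = 1"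
    using J c by (subst sum.cong[OF refl, of _ _ "\<lambda>c'. if c' = c then 1 else 0"]) auto
  ultimately show ?thesis
    using C11D(4)[OF F, of x "\<lambda>c'. if c' = c then 1 else 0"] by simp
qed

lemma C11_U:
  assumes F: "C11 J F a B" and J: "finite J"
  shows "C11 J (U s F) (\<lambda>x c. U s (\<lambda>x. a x c) x) B"
proof -
  note f = C11D[OF F]
  have iF: "integrable \<mu> (\<lambda>y. F (\<lambda>c. x c + t * y c))" for x t by (rule integrable_shift[OF f(1,3)])
  have iF': "integrable \<mu> (\<lambda>y. F (\<lambda>c. x c + v c + t * y c))" for x v t
    using iF[of "\<lambda>c. x c + v c"] .
  have ia: "integrable \<mu> (\<lambda>y. a (\<lambda>c. x c + t * y c) d)" if "d \<in> J" for x t d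
    by (rule integrable_shift[OF f(2)[OF that] C11_gradient_bound[OF F J that]])
  have ial: "integrable \<mu> (\<lambda>y. \<Sum>d\<in>J. a (\<lambda>c. x c + t * y c) d * v d)" for x t v
    using ia by (intro Bochner_Integration.integrable_sum) auto
  have lin: "(\<Sum>c\<in>J. U s (\<lambda>x. a x c) x * v c) = (\<integral>y. (\<Sum>d\<in>J. a (\<lambda>c. x c + sqrt s * y c) d * v d) \<partial>\<mu>)" for x v
    unfolding U_def using ia by (subst Bochner_Integration.integral_sum) auto
  have e: "(\<lambda>c. x c + v c + sqrt s * y c) = (\<lambda>c. (x c + sqrt s * y c) + v c)" for x v y :: "'i \<Rightarrow> real"
    by (auto simp: fun_eq_iff)
  have iF2: "integrable \<mu> (\<lambda>y. F (\<lambda>c. (x c + sqrt s * y c) + v c))" for x v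
    using iF'[of x v "sqrt s"] unfolding e .
  have dif: "U s F (\<lambda>c. x c + v c) - U s F x = (\<integral>y. F (\<lambda>c. (x c + sqrt s * y c) + v c) - F (\<lambda>c. x c + sqrt s * y c) \<partial>\<mu>)" for x v
    unfolding U_def e by (rule Bochner_Integration.integral_diff[OF iF2 iF, symmetric])
  note int = borel_measurable_integrable
  show ?thesis unfolding C11_def
  proof (intro conjI allI ballI)
    show "U s F \<in> borel_measurable coords" by (rule U_measurable[OF f(1)])
    show "U s (\<lambda>x. a x c) \<in> borel_measurable coords" if "c \<in> J" for c by (rule U_measurable[OF f(2)[OF that]])
    fix x v
    show "\<bar>U s F x\<bar> \<le> B" unfolding U_def by (rule integral_abs_le[OF int[OF iF] f(3)])
    show "\<bar>\<Sum>c\<in>J. U s (\<lambda>x. a x c) x * v c\<bar> \<le> B * (\<Sum>c\<in>J. \<bar>v c\<bar>)"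
      unfolding lin by (rule integral_abs_le[OF int[OF ial] f(4)])
    have d: "integrable \<mu> (\<lambda>y. F (\<lambda>c. (x c + sqrt s * y c) + v c) - F (\<lambda>c. x c + sqrt s * y c))"
      by (rule Bochner_Integration.integrable_diff[OF iF2 iF])
    show "\<bar>U s F (\<lambda>c. x c + v c) - U s F x\<bar> \<le> B * (\<Sum>c\<in>J. \<bar>v c\<bar>)"
      unfolding dif by (rule integral_abs_le[OF int[OF d] f(5)])
    have "U s F (\<lambda>c. x c + v c) - U s F x - (\<Sum>c\<in>J. U s (\<lambda>x. a x c) x * v c)
      = (\<integral>y. F (\<lambda>c. (x c + sqrt s * y c) + v c) - F (\<lambda>c. x c + sqrt s * y c) - (\<Sum>d\<in>J. a (\<lambda>c. x c + sqrt s * y c) d * v d) \<partial>\<mu>)"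
      unfolding dif lin by (rule Bochner_Integration.integral_diff[OF d ial, symmetric])
    also have "\<bar>\<dots>\<bar> \<le> B * (\<Sum>c\<in>J. \<bar>v c\<bar>)\<^sup>2"
      by (rule integral_abs_le[OF int[OF Bochner_Integration.integrable_diff[OF d ial]] f(6)])
    finally show "\<bar>U s F (\<lambda>c. x c + v c) - U s F x - (\<Sum>c\<in>J. U s (\<lambda>x. a x c) x * v c)\<bar> \<le> B * (\<Sum>c\<in>J. \<bar>v c\<bar>)\<^sup>2" .
  qed
qed

section \<open>The one-step estimate\<close>

text \<open>A single weight that dominates all coordinates in \<open>I\<close>. The summand 1 gives
  Z <= Z^2 <= Z^3, so every error term can be charged to the integrable function Z^3.\<close>

definition Z :: "('i \<Rightarrow> real) \<Rightarrow> real" where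
  "Z y = 1 + (\<Sum>c\<in>I. \<bar>y c\<bar>)"

lemma Z_ge_1: "1 \<le> Z y"
  by (auto simp: Z_def intro: sum_nonneg)

lemma integrable_Z3: "integrable \<mu> (\<lambda>y. Z y ^ 3)"
proof -
  have two: "integrable \<mu> (\<lambda>y. (f y + g y) ^ 3)"
    if i: "integrable \<mu> (\<lambda>y. f y ^ 3)" "integrable \<mu> (\<lambda>y. g y ^ 3)"
      and [measurable]: "f \<in> borel_measurable \<mu>" "g \<in> borel_measurable \<mu>"
      and n: "\<And>y. 0 \<le> f y" "\<And>y. 0 \<le> g y" for f g :: "('i \<Rightarrow> real) \<Rightarrow> real"
  proof (rule Bochner_Integration.integrable_bound)
    show "integrable \<mu> (\<lambda>y. 8 * (f y ^ 3 + g y ^ 3))" using i by simp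
    have "(a + b) ^ 3 \<le> 8 * (a ^ 3 + b ^ 3)" if "0 \<le> a" "0 \<le> b" for a b :: real
    proof -
      have "(a + b) ^ 3 \<le> (2 * max a b) ^ 3" using that by (intro power_mono) auto
      also have "\<dots> = 8 * max a b ^ 3" by (simp add: power_mult_distrib)
      also have "max a b ^ 3 \<le> a ^ 3 + b ^ 3" using that by (auto simp: max_def)
      finally show ?thesis by simp
    qed
    thus "AE y in \<mu>. norm ((f y + g y) ^ 3) \<le> norm (8 * (f y ^ 3 + g y ^ 3))"
      using n by (intro AE_I2) (simp add: abs_of_nonneg)
  qed measurable
  have "integrable \<mu> (\<lambda>y. (\<Sum>c\<in>A. \<bar>y c\<bar>) ^ 3)" if "A \<subseteq> I" for A
    using finite_subset[OF that finite_I] that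
  proof (induction A rule: finite_induct)
    case (insert c A)
    have "integrable \<mu> (\<lambda>y. (\<bar>y c\<bar> + (\<Sum>c\<in>A. \<bar>y c\<bar>)) ^ 3)"
      using insert by (intro two moment3) (auto intro: sum_nonneg)
    thus ?case using insert.hyps by simp
  qed auto
  from this[OF subset_refl] show ?thesis
    unfolding Z_def by (intro two) (auto intro: sum_nonneg)
qed

lemma integrable_Z_bound:
  assumes [measurable]: "f \<in> borel_measurable \<mu>" and b: "\<And>y. \<bar>f y\<bar> \<le> K * Z y ^ 3"
  shows "integrable \<mu> f"
proof (rule Bochner_Integration.integrable_bound)
  show "integrable \<mu> (\<lambda>y. K * Z y ^ 3)" using integrable_Z3 by simp
  show "AE y in \<mu>. norm (f y) \<le> norm (K * Z y ^ 3)"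
    by (intro AE_I2) (use b in \<open>auto intro: order_trans[OF _ abs_ge_self]\<close>)
qed measurable

lemma Z_power_le: "Z y \<le> Z y ^ 3" "(Z y)\<^sup>2 \<le> Z y ^ 3"
  using Z_ge_1[of y] power_increasing[of 1 3 "Z y"] power_increasing[of 2 3 "Z y"] by auto

lemma integrable_coord: "c \<in> I \<Longrightarrow> integrable \<mu> (\<lambda>y. y c)"
proof (rule integrable_Z_bound[where K = 1])
  fix y :: "'i \<Rightarrow> real" assume "c \<in> I"
  hence "\<bar>y c\<bar> \<le> (\<Sum>c\<in>I. \<bar>y c\<bar>)"
    using finite_I by (intro member_le_sum[of c I "\<lambda>c. \<bar>y c\<bar>"]) auto
  thus "\<bar>y c\<bar> \<le> 1 * Z y ^ 3" using Z_power_le(1)[of y] by (simp add: Z_def)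
qed measurable

text \<open>Dividing \<open>F i\<close> by its mean gives \<open>1 + \<xi> i\<close> with \<open>\<xi> i\<close> of mean zero, so the expectation of
  \<open>\<Prod>i. (1 + \<xi> i) powr (1 / p i)\<close> is \<open>1\<close> plus a quadratic term of order \<open>h\<^sup>2\<close>, which is half of
  \<open>b\<^sup>T (T - P) b\<close> with \<open>b i = a i / (p i * mean)\<close>, up to \<open>O(h ^ 3)\<close>. The sign \<open>\<sigma> = \<plusminus>1\<close> covers both
  directions of the inequality at once.\<close>

lemma one_step:
  fixes A :: "'k set" and J :: "'k \<Rightarrow> 'i set" and p :: "'k \<Rightarrow> real"
  assumes A: "finite A" and J: "\<And>i. i \<in> A \<Longrightarrow> J i \<subseteq> I" and p: "\<And>i. i \<in> A \<Longrightarrow> p i \<noteq> 0"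
    and lo: "0 < lo" "lo \<le> B"
    and \<sigma>: "\<bar>\<sigma>\<bar> = 1"
    and cov: "\<And>b. \<sigma> * ((\<integral>y. (\<Sum>i\<in>A. \<Sum>c\<in>J i. b i c * y c)\<^sup>2 \<partial>\<mu>)
                 - (\<Sum>i\<in>A. p i * (\<integral>y. (\<Sum>c\<in>J i. b i c * y c)\<^sup>2 \<partial>\<mu>))) \<le> 0"
  shows "\<exists>C\<ge>0. \<forall>F a x h. (\<forall>i\<in>A. C11 (J i) (F i) (a i) B \<and> (\<forall>x. lo \<le> F i x)) \<longrightarrow> 0 \<le> h \<longrightarrow> h \<le> 1 \<longrightarrow>
    \<sigma> * ((\<integral>y. (\<Prod>i\<in>A. F i (\<lambda>c. x c + h * y c) powr (1 / p i)) \<partial>\<mu>)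
       - (\<Prod>i\<in>A. (\<integral>y. F i (\<lambda>c. x c + h * y c) \<partial>\<mu>) powr (1 / p i))) \<le> C * h ^ 3"
proof -
  define q where "q i = 1 / p i" for i
  define M3 where "M3 = (\<integral>y. Z y ^ 3 \<partial>\<mu>)"
  have M3: "0 \<le> M3" unfolding M3_def by (intro integral_nonneg_AE AE_I2 zero_le_power order_trans[OF zero_le_one Z_ge_1])
  \<comment> \<open>Dividing by a mean of at least \<open>lo\<close> turns bounds of order B into B
    / lo; the extra M3 pays for replacing the value F_i x by the mean m_i.\<close>
  define K where "K = (B / lo) * (1 + M3)"
  have K: "0 \<le> K" unfolding K_def using lo M3 by simp
  have B0: "0 < B" using lo by simp
  have "0 < lo / B" "lo / B \<le> 1" using lo by auto
  from prod_powr_expansion[OF A this K, where q = q and R = "B / lo"] obtain C0 where C0: "0 \<le> C0"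
    and expansion: "\<And>\<xi> l u. 0 \<le> u \<Longrightarrow>
      (\<And>i. i \<in> A \<Longrightarrow> lo / B \<le> 1 + \<xi> i \<and> 1 + \<xi> i \<le> B / lo \<and> \<bar>\<xi> i\<bar> \<le> K * u \<and> \<bar>l i\<bar> \<le> K * u \<and> \<bar>\<xi> i - l i\<bar> \<le> K * u\<^sup>2) \<Longrightarrow>
      \<bar>(\<Prod>i\<in>A. (1 + \<xi> i) powr q i) -
      (1 + (\<Sum>i\<in>A. q i * \<xi> i) + ((\<Sum>i\<in>A. q i * l i)\<^sup>2 - (\<Sum>i\<in>A. q i * (l i)\<^sup>2)) / 2)\<bar> \<le> C0 * u ^ 3"
    by blast
  \<comment> \<open>Bounds the factor \<Prod> m_i powr q_i for either sign of q_i, so that the final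
    constant depends on the functions only through \<open>lo\<close> and \<open>B\<close>.\<close>
  define D where "D = (\<Prod>i\<in>A. lo powr q i + B powr q i)"
  have D: "0 \<le> D" unfolding D_def by (intro prod_nonneg) (auto intro: add_nonneg_nonneg)
  show ?thesis
  proof (intro exI[of _ "D * (C0 * M3)"] conjI allI impI)
    show "0 \<le> D * (C0 * M3)" using D C0 M3 by simp
    fix F a x and h :: real
    assume F: "\<forall>i\<in>A. C11 (J i) (F i) (a i) B \<and> (\<forall>x. lo \<le> F i x)" and h: "0 \<le> h" "h \<le> 1"
    have cF: "C11 (J i) (F i) (a i) B" if "i \<in> A" for i using F that by auto
    have Jf: "finite (J i)" if "i \<in> A" for i using J[OF that] finite_I by (rule finite_subset)
    define W where "W i y = F i (\<lambda>c. x c + h * y c)" for i y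
    define m where "m i = (\<integral>y. W i y \<partial>\<mu>)" for i
    define \<xi> where "\<xi> i y = W i y / m i - 1" for i y
    define l where "l i y = (\<Sum>c\<in>J i. a i x c * (h * y c)) / m i" for i y
    \<comment> \<open>The reciprocal exponent is absorbed into the gradient: q_i l_i is the linear
      form with coefficients b_i, and q_i l_i^2 is p_i times its square, the shape in which
      \<open>cov\<close> is stated.\<close>
    define b where "b i c = q i * (a i x c * h) / m i" for i c
    have Wm[measurable]: "W i \<in> borel_measurable \<mu>" if "i \<in> A" for i
      unfolding W_def[abs_def] by (rule comp_shift_measurable[OF C11D(1)[OF cF[OF that]]])
    have W: "lo \<le> W i y" "W i y \<le> B" if "i \<in> A" for i y
      using F that C11D(3)[OF cF[OF that], of "\<lambda>c. x c + h * y c"] by (auto simp: W_def abs_le_iff)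
    have Wint: "integrable \<mu> (W i)" if "i \<in> A" for i
      unfolding W_def by (rule integrable_shift[OF C11D(1,3)[OF cF[OF that]]])
    have m: "lo \<le> m i" "m i \<le> B" if "i \<in> A" for i
    proof -
      have "(\<integral>y. lo \<partial>\<mu>) \<le> m i" "m i \<le> (\<integral>y. B \<partial>\<mu>)" unfolding m_def
        using W[OF that] Wint[OF that] by (intro integral_mono; simp)+
      thus "lo \<le> m i" "m i \<le> B" by (simp_all add: prob_space)
    qed
    have mp: "0 < m i" if "i \<in> A" for i using m[OF that] lo by simp
    have lm[measurable]: "l i \<in> borel_measurable \<mu>" for i unfolding l_def[abs_def] by measurable
    have nZ: "(\<Sum>c\<in>J i. \<bar>h * y c\<bar>) \<le> h * Z y" if "i \<in> A" for i y
    proof -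
      have "(\<Sum>c\<in>J i. \<bar>h * y c\<bar>) = h * (\<Sum>c\<in>J i. \<bar>y c\<bar>)" using h by (simp add: abs_mult sum_distrib_left)
      also have "\<dots> \<le> h * (\<Sum>c\<in>I. \<bar>y c\<bar>)" using h J[OF that] finite_I by (intro mult_left_mono sum_mono2) auto
      also have "\<dots> \<le> h * Z y" using h by (intro mult_left_mono) (auto simp: Z_def)
      finally show ?thesis .
    qed
    have hZ: "0 \<le> h * Z y" for y using h Z_ge_1[of y] by (intro mult_nonneg_nonneg) auto
    have BZ: "B * (\<Sum>c\<in>J i. \<bar>h * y c\<bar>) \<le> B * (h * Z y)" if "i \<in> A" for i y
      using nZ[OF that] B0 by (intro mult_left_mono) auto
    have L1: "\<bar>W i y - F i x\<bar> \<le> B * (h * Z y)" if "i \<in> A" for i y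
      unfolding W_def using C11D(5)[OF cF[OF that], of x "\<lambda>c. h * y c"] BZ[OF that, of y] by (rule order_trans)
    have n2: "B * (\<Sum>c\<in>J i. \<bar>h * y c\<bar>)\<^sup>2 \<le> B * (h * Z y)\<^sup>2" if "i \<in> A" for i y
      using nZ[OF that, of y] B0 by (intro mult_left_mono power_mono) (auto intro: sum_nonneg)
    have L2: "\<bar>W i y - F i x - (\<Sum>c\<in>J i. a i x c * (h * y c))\<bar> \<le> B * (h * Z y)\<^sup>2" if "i \<in> A" for i y
      unfolding W_def using C11D(6)[OF cF[OF that], of x "\<lambda>c. h * y c"] n2[OF that, of y] by (rule order_trans)
    have L3: "\<bar>\<Sum>c\<in>J i. a i x c * (h * y c)\<bar> \<le> B * (h * Z y)" if "i \<in> A" for i y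
      using C11D(4)[OF cF[OF that], of x "\<lambda>c. h * y c"] BZ[OF that, of y] by (rule order_trans)
    have lin: "integrable \<mu> (\<lambda>y. \<Sum>c\<in>J i. a i x c * (h * y c))" "(\<integral>y. (\<Sum>c\<in>J i. a i x c * (h * y c)) \<partial>\<mu>) = 0" if "i \<in> A" for i
    proof -
      have c: "integrable \<mu> (\<lambda>y. y c)" "(\<integral>y. y c \<partial>\<mu>) = 0" if "c \<in> J i" for c
        using integrable_coord mean J[OF \<open>i \<in> A\<close>] that by blast+
      show "integrable \<mu> (\<lambda>y. \<Sum>c\<in>J i. a i x c * (h * y c))"
        by (intro Bochner_Integration.integrable_sum integrable_mult_right c)
      show "(\<integral>y. (\<Sum>c\<in>J i. a i x c * (h * y c)) \<partial>\<mu>) = 0"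
        by (subst Bochner_Integration.integral_sum) (auto intro!: integrable_mult_right c sum.neutral simp: c)
    qed
    \<comment> \<open>The linear part integrates to zero, so the mean differs from the value at
      \<open>x\<close> only by O(h^2).\<close>
    have mF: "\<bar>m i - F i x\<bar> \<le> B * h\<^sup>2 * M3" if i: "i \<in> A" for i
    proof -
      have int: "integrable \<mu> (\<lambda>y. W i y - F i x - (\<Sum>c\<in>J i. a i x c * (h * y c)))"
        using Wint[OF i] lin(1)[OF i] by simp
      have "m i - F i x = (\<integral>y. W i y - F i x - (\<Sum>c\<in>J i. a i x c * (h * y c)) \<partial>\<mu>)"
        using Wint[OF i] lin[OF i] by (simp add: m_def prob_space)
      also have "\<bar>\<dots>\<bar> \<le> (\<integral>y. \<bar>W i y - F i x - (\<Sum>c\<in>J i. a i x c * (h * y c))\<bar> \<partial>\<mu>)" by (rule integral_abs_bound)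
      also have "\<dots> \<le> (\<integral>y. B * h\<^sup>2 * Z y ^ 3 \<partial>\<mu>)"
      proof (intro integral_mono integrable_mult_right integrable_Z3 integrable_abs int)
        fix y
        have "B * (h * Z y)\<^sup>2 \<le> B * h\<^sup>2 * Z y ^ 3"
          using Z_power_le(2)[of y] B0 by (simp add: power_mult_distrib mult_left_mono)
        thus "\<bar>W i y - F i x - (\<Sum>c\<in>J i. a i x c * (h * y c))\<bar> \<le> B * h\<^sup>2 * Z y ^ 3"
          using L2[OF i, of y] by linarith
      qed
      finally show ?thesis by (simp add: M3_def)
    qed
    \<comment> \<open>Since h <= 1 and Z >= 1, the error h^2 of the means lies below both h Z and (h
      Z)^2 and so fits the scale u = h Z of the expansion.\<close>
    have hh: "B * h\<^sup>2 * M3 \<le> B * M3 * (h * Z y)" "B * h\<^sup>2 * M3 \<le> B * M3 * (h * Z y)\<^sup>2" for y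
    proof -
      have BM: "0 \<le> B * M3" using B0 M3 by simp
      have "h\<^sup>2 \<le> h" using h by (simp add: power2_eq_square mult_left_le)
      also have "h * 1 \<le> h * Z y" using h Z_ge_1[of y] by (intro mult_left_mono) auto
      finally have "h\<^sup>2 \<le> h * Z y" by simp
      thus "B * h\<^sup>2 * M3 \<le> B * M3 * (h * Z y)" using BM by (metis mult.assoc mult.commute mult_left_mono)
      have "h * 1 \<le> h * Z y" using h Z_ge_1[of y] by (intro mult_left_mono) auto
      hence "h\<^sup>2 \<le> (h * Z y)\<^sup>2" using h by (intro power_mono) auto
      thus "B * h\<^sup>2 * M3 \<le> B * M3 * (h * Z y)\<^sup>2" using BM by (metis mult.assoc mult.commute mult_left_mono)
    qed
    have div: "\<bar>t / m i\<bar> \<le> K * u" if "i \<in> A" "\<bar>t\<bar> \<le> B * (1 + M3) * u" "0 \<le> u" for i t u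
    proof -
      have "\<bar>t / m i\<bar> = \<bar>t\<bar> / m i" using mp[OF that(1)] by (simp add: abs_divide)
      also have "\<dots> \<le> (B * (1 + M3) * u) / lo"
        using that m[OF that(1)] lo B0 M3 by (intro frac_le) auto
      finally show ?thesis by (simp add: K_def)
    qed
    have x1: "\<bar>\<xi> i y\<bar> \<le> K * (h * Z y)" if i: "i \<in> A" for i y
    proof -
      have "\<bar>W i y - m i\<bar> \<le> B * (1 + M3) * (h * Z y)"
        using L1[OF i, of y] mF[OF i] hh(1)[of y] by (simp add: algebra_simps)
      from div[OF i this hZ] show ?thesis using mp[OF i] by (simp add: \<xi>_def diff_divide_distrib)
    qed
    have x2: "\<bar>\<xi> i y - l i y\<bar> \<le> K * (h * Z y)\<^sup>2" if i: "i \<in> A" for i y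
    proof -
      have "\<bar>W i y - m i - (\<Sum>c\<in>J i. a i x c * (h * y c))\<bar> \<le> B * (1 + M3) * (h * Z y)\<^sup>2"
        using L2[OF i, of y] mF[OF i] hh(2)[of y] by (simp add: algebra_simps)
      from div[OF i this] show ?thesis using mp[OF i] by (simp add: \<xi>_def l_def diff_divide_distrib)
    qed
    have x3: "\<bar>l i y\<bar> \<le> K * (h * Z y)" if i: "i \<in> A" for i y
    proof -
      have "0 \<le> B * M3 * (h * Z y)" using B0 M3 hZ by simp
      hence "\<bar>\<Sum>c\<in>J i. a i x c * (h * y c)\<bar> \<le> B * (1 + M3) * (h * Z y)"
        using L3[OF i, of y] by (simp add: algebra_simps)
      from div[OF i this hZ] show ?thesis by (simp add: l_def)
    qed
    have x4: "lo / B \<le> 1 + \<xi> i y" "1 + \<xi> i y \<le> B / lo" if i: "i \<in> A" for i y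
      using W[OF i, of y] m[OF i] lo B0 by (auto simp: \<xi>_def intro!: frac_le)
    define G where "G y = (\<Prod>i\<in>A. (1 + \<xi> i y) powr q i)" for y
    define E where "E y = 1 + (\<Sum>i\<in>A. q i * \<xi> i y) + ((\<Sum>i\<in>A. q i * l i y)\<^sup>2 - (\<Sum>i\<in>A. q i * (l i y)\<^sup>2)) / 2" for y
    have GE: "\<bar>G y - E y\<bar> \<le> C0 * h ^ 3 * Z y ^ 3" for y
      using expansion[of "h * Z y" "\<lambda>i. \<xi> i y" "\<lambda>i. l i y", OF hZ] x1 x2 x3 x4
      by (simp add: G_def E_def power_mult_distrib mult.assoc)
    have xint: "integrable \<mu> (\<xi> i)" "(\<integral>y. \<xi> i y \<partial>\<mu>) = 0" if "i \<in> A" for i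
      using Wint[OF that] mp[OF that] unfolding \<xi>_def by (simp_all add: m_def[symmetric] prob_space)
    have l2: "integrable \<mu> (\<lambda>y. (l i y)\<^sup>2)" if i: "i \<in> A" for i
    proof (rule integrable_Z_bound[where K = "(K * h)\<^sup>2"])
      fix y
      have "(l i y)\<^sup>2 \<le> (K * (h * Z y))\<^sup>2"
        using x3[OF i, of y] by (subst abs_le_square_iff[symmetric]) auto
      also have "\<dots> \<le> (K * h)\<^sup>2 * Z y ^ 3"
        using Z_power_le(2)[of y] by (simp add: power_mult_distrib mult.assoc[symmetric] mult_left_mono)
      finally show "\<bar>(l i y)\<^sup>2\<bar> \<le> (K * h)\<^sup>2 * Z y ^ 3" by simp
    qed measurable
    define Q where "Q = (\<Sum>i\<in>A. \<bar>q i\<bar>)"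
    have s2: "integrable \<mu> (\<lambda>y. (\<Sum>i\<in>A. q i * l i y)\<^sup>2)"
    proof (rule integrable_Z_bound[where K = "(Q * (K * h))\<^sup>2"])
      fix y
      have "\<bar>\<Sum>i\<in>A. q i * l i y\<bar> \<le> Q * (K * (h * Z y))"
        unfolding Q_def by (intro sum_abs_bound x3)
      hence "(\<Sum>i\<in>A. q i * l i y)\<^sup>2 \<le> (Q * (K * (h * Z y)))\<^sup>2"
        by (subst abs_le_square_iff[symmetric]) auto
      also have "\<dots> \<le> (Q * (K * h))\<^sup>2 * Z y ^ 3"
        using Z_power_le(2)[of y] by (simp add: power_mult_distrib mult.assoc[symmetric] mult_left_mono)
      finally show "\<bar>(\<Sum>i\<in>A. q i * l i y)\<^sup>2\<bar> \<le> (Q * (K * h))\<^sup>2 * Z y ^ 3" by simp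
    qed measurable
    have Eint: "integrable \<mu> E" unfolding E_def[abs_def]
      by (intro Bochner_Integration.integrable_add Bochner_Integration.integrable_diff integrable_divide_zero
          Bochner_Integration.integrable_sum integrable_mult_right xint(1) l2 s2 integrable_const)
    have EE: "(\<integral>y. E y \<partial>\<mu>) = 1 + ((\<integral>y. (\<Sum>i\<in>A. q i * l i y)\<^sup>2 \<partial>\<mu>) - (\<Sum>i\<in>A. q i * (\<integral>y. (l i y)\<^sup>2 \<partial>\<mu>))) / 2"
    proof -
      have i1: "integrable \<mu> (\<lambda>y. \<Sum>i\<in>A. q i * \<xi> i y)" "(\<integral>y. (\<Sum>i\<in>A. q i * \<xi> i y) \<partial>\<mu>) = 0"
        using xint by (simp_all add: Bochner_Integration.integral_sum)
      have i2: "integrable \<mu> (\<lambda>y. \<Sum>i\<in>A. q i * (l i y)\<^sup>2)"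
        "(\<integral>y. (\<Sum>i\<in>A. q i * (l i y)\<^sup>2) \<partial>\<mu>) = (\<Sum>i\<in>A. q i * (\<integral>y. (l i y)\<^sup>2 \<partial>\<mu>))"
        using l2 by (simp_all add: Bochner_Integration.integral_sum)
      show ?thesis unfolding E_def using i1 i2 s2 by (simp add: prob_space)
    qed
    have bl: "q i * l i y = (\<Sum>c\<in>J i. b i c * y c)" for i y
      by (simp add: l_def b_def sum_distrib_left sum_divide_distrib mult_ac)
    have ql2: "q i * (\<integral>y. (l i y)\<^sup>2 \<partial>\<mu>) = p i * (\<integral>y. (\<Sum>c\<in>J i. b i c * y c)\<^sup>2 \<partial>\<mu>)" if "i \<in> A" for i
      unfolding bl[symmetric] power_mult_distrib
      using p[OF that] by (simp add: q_def power2_eq_square)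
    have Ele: "\<sigma> * ((\<integral>y. E y \<partial>\<mu>) - 1) \<le> 0"
    proof -
      have "(\<integral>y. E y \<partial>\<mu>) - 1 = ((\<integral>y. (\<Sum>i\<in>A. \<Sum>c\<in>J i. b i c * y c)\<^sup>2 \<partial>\<mu>)
                 - (\<Sum>i\<in>A. p i * (\<integral>y. (\<Sum>c\<in>J i. b i c * y c)\<^sup>2 \<partial>\<mu>))) / 2"
        unfolding EE using ql2 by (simp add: bl)
      thus ?thesis using cov[of b] by (simp only: times_divide_eq_right)
    qed
    have x0: "0 < 1 + \<xi> i y" if "i \<in> A" for i y
      using W[OF that, of y] mp[OF that] lo by (simp add: \<xi>_def)
    \<comment> \<open>Pulling out the means leaves a product \<open>G\<close> whose expansion starts
      at 1, so the difference of the two sides becomes \<Prod> m_i powr q_i times (E G - 1).\<close>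
    have Wprod: "(\<Prod>i\<in>A. W i y powr q i) = (\<Prod>i\<in>A. m i powr q i) * G y" for y
    proof -
      have "W i y powr q i = m i powr q i * (1 + \<xi> i y) powr q i" if "i \<in> A" for i
      proof -
        have "W i y = m i * (1 + \<xi> i y)" using mp[OF that] by (simp add: \<xi>_def)
        thus ?thesis using mp[OF that] x0[OF that, of y] by (simp add: powr_mult)
      qed
      thus ?thesis by (simp add: G_def prod.distrib[symmetric])
    qed
    have Gm[measurable]: "G \<in> borel_measurable \<mu>"
      unfolding G_def[abs_def] \<xi>_def by measurable
    have Gint: "integrable \<mu> G"
    proof -
      have "integrable \<mu> (\<lambda>y. G y - E y)"
        using GE Eint by (intro integrable_Z_bound[where K = "C0 * h ^ 3"]) auto
      from Bochner_Integration.integrable_add[OF this Eint] show ?thesis by simp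
    qed
    have "\<bar>(\<integral>y. G y \<partial>\<mu>) - (\<integral>y. E y \<partial>\<mu>)\<bar> \<le> C0 * h ^ 3 * M3"
    proof -
      have "\<bar>(\<integral>y. G y \<partial>\<mu>) - (\<integral>y. E y \<partial>\<mu>)\<bar> = \<bar>\<integral>y. G y - E y \<partial>\<mu>\<bar>"
        using Gint Eint by simp
      also have "\<dots> \<le> (\<integral>y. \<bar>G y - E y\<bar> \<partial>\<mu>)" by (rule integral_abs_bound)
      also have "\<dots> \<le> (\<integral>y. C0 * h ^ 3 * Z y ^ 3 \<partial>\<mu>)"
        using Gint Eint by (intro integral_mono integrable_mult_right integrable_Z3 GE) auto
      finally show ?thesis by (simp add: M3_def)
    qed
    hence "\<bar>\<sigma> * ((\<integral>y. G y \<partial>\<mu>) - (\<integral>y. E y \<partial>\<mu>))\<bar> \<le> C0 * h ^ 3 * M3"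
      using \<sigma> by (simp add: abs_mult)
    hence "\<sigma> * ((\<integral>y. G y \<partial>\<mu>) - 1) \<le> C0 * h ^ 3 * M3"
      using Ele by (simp add: algebra_simps)
    hence "(\<Prod>i\<in>A. m i powr q i) * (\<sigma> * ((\<integral>y. G y \<partial>\<mu>) - 1)) \<le> (\<Prod>i\<in>A. m i powr q i) * (C0 * h ^ 3 * M3)"
      by (intro mult_left_mono prod_nonneg) auto
    also have "\<dots> \<le> D * (C0 * h ^ 3 * M3)"
      unfolding D_def using C0 h M3 m by (intro mult_right_mono prod_mono) (auto intro!: powr_le_sum[OF lo(1)])
    also have "(\<Prod>i\<in>A. m i powr q i) * (\<sigma> * ((\<integral>y. G y \<partial>\<mu>) - 1)) =
      \<sigma> * ((\<integral>y. (\<Prod>i\<in>A. W i y powr q i) \<partial>\<mu>) - (\<Prod>i\<in>A. m i powr q i))"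
      unfolding Wprod using Gint by (simp add: algebra_simps)
    finally show "\<sigma> * ((\<integral>y. (\<Prod>i\<in>A. F i (\<lambda>c. x c + h * y c) powr (1 / p i)) \<partial>\<mu>)
       - (\<Prod>i\<in>A. (\<integral>y. F i (\<lambda>c. x c + h * y c) \<partial>\<mu>) powr (1 / p i))) \<le> D * (C0 * M3) * h ^ 3"
      by (simp add: W_def m_def q_def mult_ac)
  qed
qed

end

section \<open>Iteration of the step and extension to bounded measurable functions\<close>

lemma C11_affine: "C11 J G a B \<Longrightarrow> \<exists>a' B'. C11 J (\<lambda>x. k + d * G x) a' B'"
  using C11_add[OF C11_const[of J k] C11_mult[OF C11_const[of J d]]] by blast

text \<open>The one-step estimate takes a single \<open>B\<close> for all factors, and
  \<open>B0\<close> allows it to be chosen above the lower bound of the functions. The sum of the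
  nonnegative individual constants, plus |B0|, works.\<close>

lemma C11_common_bound:
  assumes A: "finite A" and F: "\<And>i. i \<in> A \<Longrightarrow> \<exists>a B. C11 (J i) (F i) a B"
  shows "\<exists>a B. B0 \<le> B \<and> (\<forall>i\<in>A. C11 (J i) (F i) (a i) B)"
proof -
  have "\<forall>i\<in>A. \<exists>a. \<exists>B. C11 (J i) (F i) a B" using F by blast
  then obtain a where "\<forall>i\<in>A. \<exists>B. C11 (J i) (F i) (a i) B" by (rule bchoice[THEN exE])
  then obtain B where "\<forall>i\<in>A. C11 (J i) (F i) (a i) (B i)" by (rule bchoice[THEN exE])
  hence aB: "\<And>i. i \<in> A \<Longrightarrow> C11 (J i) (F i) (a i) (B i)" by blast
  have "B i \<le> (\<Sum>i\<in>A. B i) + \<bar>B0\<bar>" if "i \<in> A" for i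
  proof -
    have "B i \<le> (\<Sum>i\<in>A. B i)" using A that C11D(7)[OF aB] by (intro member_le_sum) auto
    thus ?thesis by simp
  qed
  moreover have "B0 \<le> (\<Sum>i\<in>A. B i) + \<bar>B0\<bar>"
    using sum_nonneg[of A B] C11D(7)[OF aB] by force
  ultimately show ?thesis using C11_mono[OF aB] by blast
qed

context stable_law
begin

text \<open>Steps of time 1 / K have spatial size h = K^(-1/2), so K errors C h^3 add up to C / sqrt
  K, which vanishes in the limit. One \<open>C\<close> serves all steps, because \<open>U\<close>
  preserves the bound \<open>lo\<close> and the constant \<open>B\<close>.\<close>

lemma C11_inequality:
  fixes A :: "'k set" and J :: "'k \<Rightarrow> 'i set" and p :: "'k \<Rightarrow> real"
  assumes A: "finite A" and J: "\<And>i. i \<in> A \<Longrightarrow> J i \<subseteq> I" and p: "\<And>i. i \<in> A \<Longrightarrow> p i \<noteq> 0"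
    and lo: "0 < lo" and \<sigma>: "\<bar>\<sigma>\<bar> = 1"
    and cov: "\<And>b. \<sigma> * ((\<integral>y. (\<Sum>i\<in>A. \<Sum>c\<in>J i. b i c * y c)\<^sup>2 \<partial>\<mu>)
                 - (\<Sum>i\<in>A. p i * (\<integral>y. (\<Sum>c\<in>J i. b i c * y c)\<^sup>2 \<partial>\<mu>))) \<le> 0"
    and F: "\<And>i. i \<in> A \<Longrightarrow> \<exists>a B. C11 (J i) (F i) a B" "\<And>i x. i \<in> A \<Longrightarrow> lo \<le> F i x"
  shows "\<sigma> * ((\<integral>y. (\<Prod>i\<in>A. F i y powr (1 / p i)) \<partial>\<mu>) - (\<Prod>i\<in>A. (\<integral>y. F i y \<partial>\<mu>) powr (1 / p i))) \<le> 0"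
proof -
  obtain a B where aB: "\<And>i. i \<in> A \<Longrightarrow> C11 (J i) (F i) (a i) B" and loB: "lo \<le> B"
    using C11_common_bound[of A J F lo] A F(1) by blast
  obtain C where C: "0 \<le> C" and step: "\<forall>F a x h. (\<forall>i\<in>A. C11 (J i) (F i) (a i) B \<and> (\<forall>x. lo \<le> F i x)) \<longrightarrow> 0 \<le> h \<longrightarrow> h \<le> 1 \<longrightarrow>
    \<sigma> * ((\<integral>y. (\<Prod>i\<in>A. F i (\<lambda>c. x c + h * y c) powr (1 / p i)) \<partial>\<mu>)
       - (\<Prod>i\<in>A. (\<integral>y. F i (\<lambda>c. x c + h * y c) \<partial>\<mu>) powr (1 / p i))) \<le> C * h ^ 3"
    using one_step[OF A J p lo loB \<sigma> cov] by blast
  define L where "L = \<sigma> * ((\<integral>y. (\<Prod>i\<in>A. F i y powr (1 / p i)) \<partial>\<mu>) - (\<Prod>i\<in>A. (\<integral>y. F i y \<partial>\<mu>) powr (1 / p i)))"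
  have Jf: "finite (J i)" if "i \<in> A" for i using J[OF that] finite_I by (rule finite_subset)
  have Fm[measurable]: "F i \<in> borel_measurable coords" if "i \<in> A" for i using C11D(1)[OF aB[OF that]] .
  have FB: "\<bar>F i x\<bar> \<le> B" if "i \<in> A" for i x using C11D(3)[OF aB[OF that]] .
  have cU: "C11 (J i) (U s (F i)) (\<lambda>x c. U s (\<lambda>x. a i x c) x) B" if "i \<in> A" for i s
    by (rule C11_U[OF aB[OF that] Jf[OF that]])
  have Ulo: "lo \<le> U s (F i) x" if "i \<in> A" for i s x
    by (rule U_ge[OF Fm[OF that] FB[OF that] F(2)[OF that]])
  have UB: "U s (F i) x \<le> B" if "i \<in> A" for i s x using C11D(3)[OF cU[OF that]] by (auto simp: abs_le_iff)
  \<comment> \<open>At time 0 this is the integrand of the left side; at time 1, evaluated at the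
    origin, it is the right side.\<close>
  define \<Phi> where "\<Phi> s x = (\<Prod>i\<in>A. U s (F i) x powr (1 / p i))" for s x
  have \<Phi>m[measurable]: "\<Phi> s \<in> borel_measurable coords" for s
  proof -
    have "U s (F i) \<in> borel_measurable coords" if "i \<in> A" for i by (rule U_measurable[OF Fm[OF that]])
    thus ?thesis unfolding \<Phi>_def[abs_def] by measurable
  qed
  define D where "D = (\<Prod>i\<in>A. lo powr (1 / p i) + B powr (1 / p i))"
  have \<Phi>D: "\<bar>\<Phi> s x\<bar> \<le> D" for s x
  proof -
    have "0 \<le> \<Phi> s x" unfolding \<Phi>_def by (intro prod_nonneg) auto
    moreover have "\<Phi> s x \<le> D" unfolding \<Phi>_def D_def
      by (intro prod_mono) (auto intro!: powr_le_sum[OF lo] Ulo UB)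
    ultimately show ?thesis by simp
  qed
  have U\<Phi>D: "\<bar>U t (\<Phi> s) x\<bar> \<le> D" for s t x
    unfolding U_def by (rule integral_abs_le[OF comp_shift_measurable[OF \<Phi>m] \<Phi>D])
  have main: "L \<le> C / sqrt (real K)" if K: "0 < K" for K :: nat
  proof -
    define h where "h = sqrt (1 / real K)"
    have h: "0 \<le> h" "h \<le> 1" using K by (auto simp: h_def real_sqrt_divide)
    have k0: "0 \<le> real j / real K" for j by simp
    \<comment> \<open>The claim is made at every point \<open>x\<close>, because the next step
      averages it over all translates x + h y before adding one more one-step error.\<close>
    have ind: "\<sigma> * (U (real j / real K) (\<Phi> 0) x - \<Phi> (real j / real K) x) \<le> real j * (C * h ^ 3)" for j x
    proof (induction j arbitrary: x)
      case 0
      show ?case by (simp add: U_0)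
    next
      case (Suc j)
      define s where "s = real j / real K"
      have s: "0 \<le> s" by (simp add: s_def)
      \<comment> \<open>The new increment stands on the left, so that the semigroup law exposes one
        step of length 1 / K as the outer average.\<close>
      have Ss: "real (Suc j) / real K = 1 / real K + s" by (simp add: s_def add_divide_distrib)
      have i1: "integrable \<mu> (\<lambda>y. U s (\<Phi> 0) (\<lambda>c. x c + h * y c))"
        by (rule integrable_shift[OF U_measurable[OF \<Phi>m] U\<Phi>D])
      have i2: "integrable \<mu> (\<lambda>y. \<Phi> s (\<lambda>c. x c + h * y c))"
        by (rule integrable_shift[OF \<Phi>m \<Phi>D])
      have e1: "U (1 / real K + s) (\<Phi> 0) x = (\<integral>y. U s (\<Phi> 0) (\<lambda>c. x c + h * y c) \<partial>\<mu>)"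
        by (subst U_U[OF \<Phi>m \<Phi>D, symmetric]) (use s in \<open>auto simp: U_def[of "1 / real K"] h_def\<close>)
      have e2: "(\<integral>y. U s (F i) (\<lambda>c. x c + h * y c) \<partial>\<mu>) = U (1 / real K + s) (F i) x" if "i \<in> A" for i
        by (subst U_U[OF Fm[OF that] FB[OF that], symmetric]) (use s in \<open>auto simp: U_def[of "1 / real K"] h_def\<close>)
      have "\<sigma> * ((\<integral>y. \<Phi> s (\<lambda>c. x c + h * y c) \<partial>\<mu>) - \<Phi> (1 / real K + s) x) \<le> C * h ^ 3"
        using step[rule_format, of "\<lambda>i. U s (F i)" "\<lambda>i x c. U s (\<lambda>x. a i x c) x" h x] cU Ulo h e2
        by (simp add: \<Phi>_def)
      moreover have "\<sigma> * ((\<integral>y. U s (\<Phi> 0) (\<lambda>c. x c + h * y c) \<partial>\<mu>) - (\<integral>y. \<Phi> s (\<lambda>c. x c + h * y c) \<partial>\<mu>)) \<le> real j * (C * h ^ 3)"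
      proof -
        have "\<sigma> * ((\<integral>y. U s (\<Phi> 0) (\<lambda>c. x c + h * y c) \<partial>\<mu>) - (\<integral>y. \<Phi> s (\<lambda>c. x c + h * y c) \<partial>\<mu>))
           = (\<integral>y. \<sigma> * (U s (\<Phi> 0) (\<lambda>c. x c + h * y c) - \<Phi> s (\<lambda>c. x c + h * y c)) \<partial>\<mu>)"
          using i1 i2 by simp
        also have "\<dots> \<le> (\<integral>y. real j * (C * h ^ 3) \<partial>\<mu>)"
          using i1 i2 Suc.IH by (intro integral_mono) (auto simp: s_def)
        finally show ?thesis by (simp add: prob_space)
      qed
      ultimately show ?case unfolding Ss e1 by (simp add: algebra_simps)
    qed
    have "L = \<sigma> * (U (real K / real K) (\<Phi> 0) (\<lambda>_. 0) - \<Phi> (real K / real K) (\<lambda>_. 0))"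
      using K by (simp add: U_1 L_def \<Phi>_def U_0)
    also have "\<dots> \<le> real K * (C * h ^ 3)" by (rule ind)
    also have "\<dots> = C / sqrt (real K)"
    proof -
      have "h ^ 3 = h * (1 / real K)" by (simp add: h_def power3_eq_cube)
      thus ?thesis using K by (simp add: h_def real_sqrt_divide)
    qed
    finally show ?thesis .
  qed
  have "L \<le> 0"
  proof (rule LIMSEQ_le_const[where X = "\<lambda>K. C / sqrt (real K)"])
    show "(\<lambda>K. C / sqrt (real K)) \<longlonglongrightarrow> 0"
      by (intro tendsto_divide_0[OF tendsto_const] filterlim_at_top_imp_at_infinity
           filterlim_compose[OF sqrt_at_top filterlim_real_sequentially])
    show "\<exists>N. \<forall>n\<ge>N. L \<le> C / sqrt (real n)" using main by (intro exI[of _ 1]) auto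
  qed
  thus ?thesis by (simp add: L_def)
qed

text \<open>L^1 approximation by smooth functions gives almost sure convergence along a subsequence.
  The approximants stay in [lo, lo + w], where powers of either sign are continuous and bounded, so
  dominated convergence carries both sides.\<close>

lemma bounded_inequality:
  fixes A :: "'k set" and J :: "'k \<Rightarrow> 'i set" and p :: "'k \<Rightarrow> real"
  assumes A: "finite A" and J: "\<And>i. i \<in> A \<Longrightarrow> J i \<subseteq> I" and p: "\<And>i. i \<in> A \<Longrightarrow> p i \<noteq> 0"
    and lo: "0 < lo" and \<sigma>: "\<bar>\<sigma>\<bar> = 1"
    and cov: "\<And>b. \<sigma> * ((\<integral>y. (\<Sum>i\<in>A. \<Sum>c\<in>J i. b i c * y c)\<^sup>2 \<partial>\<mu>)
                 - (\<Sum>i\<in>A. p i * (\<integral>y. (\<Sum>c\<in>J i. b i c * y c)\<^sup>2 \<partial>\<mu>))) \<le> 0"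
    and F: "\<And>i. i \<in> A \<Longrightarrow> F i \<in> borel_measurable (PiM (J i) (\<lambda>_. borel))"
      "\<And>i x. i \<in> A \<Longrightarrow> x \<in> space (PiM (J i) (\<lambda>_. borel :: real measure)) \<Longrightarrow> lo \<le> F i x \<and> F i x \<le> hi"
  shows "\<sigma> * ((\<integral>y. (\<Prod>i\<in>A. F i (restrict y (J i)) powr (1 / p i)) \<partial>\<mu>)
     - (\<Prod>i\<in>A. (\<integral>y. F i (restrict y (J i)) \<partial>\<mu>) powr (1 / p i))) \<le> 0"
proof -
  have Jf: "finite (J i)" if "i \<in> A" for i using J[OF that] finite_I by (rule finite_subset)
  \<comment> \<open>The summand 1 keeps the scaling factor positive even when
    \<open>hi = lo\<close>.\<close>
  define w where "w = \<bar>hi - lo\<bar> + 1"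
  have w: "0 < w" "hi - lo \<le> w" by (auto simp: w_def)
  define H where "H i y = F i (restrict y (J i))" for i y
  have rs: "restrict y (J i) \<in> space (PiM (J i) (\<lambda>_. borel :: real measure))" for y i by (simp add: space_PiM)
  have H: "lo \<le> H i y" "H i y \<le> hi" if "i \<in> A" for i y using F(2)[OF that rs] by (auto simp: H_def)
  have H': "H i y \<le> lo + w" if "i \<in> A" for i y using H[OF that, of y] w by linarith
  have Hm[measurable]: "H i \<in> borel_measurable coords" if "i \<in> A" for i
    unfolding H_def[abs_def]
    by (rule measurable_compose[OF _ F(1)[OF that]]) (rule measurable_restrict_subset, simp)
  have app: "C11_approximable \<mu> (J i) (\<lambda>x. (\<lambda>z. (F i z - lo) / w) (restrict x (J i)))" if "i \<in> A" for i
  proof (rule C11_dense[OF Jf[OF that]])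
    have [measurable]: "F i \<in> borel_measurable (PiM (J i) (\<lambda>_. borel))" by (rule F(1)[OF that])
    show "(\<lambda>z. (F i z - lo) / w) \<in> borel_measurable (PiM (J i) (\<lambda>_. borel))" by measurable
    show "0 \<le> (F i x - lo) / w \<and> (F i x - lo) / w \<le> 1" if "x \<in> space (PiM (J i) (\<lambda>_. borel :: real measure))" for x
      using F(2)[OF \<open>i \<in> A\<close> that] w by (auto simp: field_simps)
  qed
  define P where "P i n G \<longleftrightarrow> (\<exists>a B. C11 (J i) G a B) \<and> (\<forall>x. 0 \<le> G x \<and> G x \<le> 1)
    \<and> (\<integral>x. \<bar>G x - (H i x - lo) / w\<bar> \<partial>\<mu>) < 1 / real (Suc n)" for i and n :: nat and G
  define G where "G i n = (SOME G. P i n G)" for i n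
  have "P i n (G i n)" if i: "i \<in> A" for i n
  proof -
    have "0 < 1 / real (Suc n)" by simp
    then obtain G a B where "C11 (J i) G a B" "\<And>x. 0 \<le> G x \<and> G x \<le> 1"
      "(\<integral>x. \<bar>G x - (F i (restrict x (J i)) - lo) / w\<bar> \<partial>\<mu>) < 1 / real (Suc n)"
      by (rule C11_approximableE[OF app[OF i]]) blast
    hence "P i n G" unfolding P_def H_def by blast
    thus ?thesis unfolding G_def by (rule someI[of "P i n"])
  qed
  hence G: "\<And>i n. i \<in> A \<Longrightarrow> \<exists>a B. C11 (J i) (G i n) a B" "\<And>i n x. i \<in> A \<Longrightarrow> 0 \<le> G i n x \<and> G i n x \<le> 1"
    "\<And>i n. i \<in> A \<Longrightarrow> (\<integral>x. \<bar>G i n x - (H i x - lo) / w\<bar> \<partial>\<mu>) < 1 / real (Suc n)"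
    unfolding P_def by blast+
  have Gm[measurable]: "G i n \<in> borel_measurable coords" if "i \<in> A" for i n
    using G(1)[OF that] C11D(1) by blast
  \<comment> \<open>Summing the errors of all factors produces one null sequence in L^1, so a single
    subsequence serves every \<open>i\<close>.\<close>
  define u where "u n x = (\<Sum>i\<in>A. \<bar>G i n x - (H i x - lo) / w\<bar>)" for n x
  have ui: "integrable \<mu> (\<lambda>x. \<bar>G i n x - (H i x - lo) / w\<bar>)" if "i \<in> A" for i n
  proof (rule integrable_diff_unit)
    show "(\<lambda>x. (H i x - lo) / w) \<in> borel_measurable coords" using Hm[OF that] by measurable
    show "0 \<le> (H i x - lo) / w \<and> (H i x - lo) / w \<le> 1" for x
      using H[OF that, of x] H'[OF that, of x] w by (auto simp: field_simps)
  qed (use Gm G(2) that in auto)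
  have "(\<lambda>n. \<integral>x. norm (u n x) \<partial>\<mu>) \<longlonglongrightarrow> 0"
  proof (rule Lim_null_comparison)
    show "\<forall>\<^sub>F n in sequentially. norm (\<integral>x. norm (u n x) \<partial>\<mu>) \<le> real (card A) * (1 / real (Suc n))"
    proof (rule always_eventually, rule allI)
      fix n
      have "(\<integral>x. norm (u n x) \<partial>\<mu>) = (\<Sum>i\<in>A. \<integral>x. \<bar>G i n x - (H i x - lo) / w\<bar> \<partial>\<mu>)"
        unfolding u_def using ui by (simp add: Bochner_Integration.integral_sum sum_nonneg)
      also have "\<dots> \<le> (\<Sum>i\<in>A. 1 / real (Suc n))" using G(3) by (intro sum_mono less_imp_le)
      finally show "norm (\<integral>x. norm (u n x) \<partial>\<mu>) \<le> real (card A) * (1 / real (Suc n))" by simp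
    qed
    show "(\<lambda>n. real (card A) * (1 / real (Suc n))) \<longlonglongrightarrow> 0"
      by (rule tendsto_mult_right_zero) (rule LIMSEQ_Suc[OF lim_1_over_n])
  qed
  moreover have "integrable \<mu> (u n)" for n
    unfolding u_def[abs_def] using ui by (intro Bochner_Integration.integrable_sum) auto
  ultimately obtain r where r: "strict_mono r" and AE: "AE x in \<mu>. (\<lambda>n. u (r n) x) \<longlonglongrightarrow> 0"
    using tendsto_L1_AE_subseq[of \<mu> u] by blast
  define E where "E i n x = lo + w * G i (r n) x" for i n x
  have Em[measurable]: "E i n \<in> borel_measurable coords" if "i \<in> A" for i n
    unfolding E_def[abs_def] using Gm[OF that] by measurable
  have Elo: "lo \<le> E i n x" "E i n x \<le> lo + w" if "i \<in> A" for i n x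
    using G(2)[OF that, of "r n" x] w by (auto simp: E_def mult_left_le)
  have AE2: "AE x in \<mu>. \<forall>i\<in>A. (\<lambda>n. E i n x) \<longlonglongrightarrow> H i x"
  proof (rule AE_mp[OF AE], rule AE_I2, intro impI ballI)
    fix x i assume lim: "(\<lambda>n. u (r n) x) \<longlonglongrightarrow> 0" and i: "i \<in> A"
    have "(\<lambda>n. G i (r n) x - (H i x - lo) / w) \<longlonglongrightarrow> 0"
    proof (rule Lim_null_comparison[OF _ lim])
      show "\<forall>\<^sub>F n in sequentially. norm (G i (r n) x - (H i x - lo) / w) \<le> u (r n) x"
        unfolding u_def using i A
        by (auto intro!: always_eventually member_le_sum[of i A "\<lambda>i. \<bar>G i (r _) x - (H i x - lo) / w\<bar>"])
    qed
    hence "(\<lambda>n. G i (r n) x) \<longlonglongrightarrow> (H i x - lo) / w" by (rule LIM_zero_cancel)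
    hence "(\<lambda>n. E i n x) \<longlonglongrightarrow> lo + w * ((H i x - lo) / w)" unfolding E_def by (intro tendsto_intros)
    thus "(\<lambda>n. E i n x) \<longlonglongrightarrow> H i x" using w by simp
  qed
  have ineq: "\<sigma> * ((\<integral>y. (\<Prod>i\<in>A. E i n y powr (1 / p i)) \<partial>\<mu>) - (\<Prod>i\<in>A. (\<integral>y. E i n y \<partial>\<mu>) powr (1 / p i))) \<le> 0" for n
  proof (rule C11_inequality[OF A J p lo \<sigma> cov])
    show "\<exists>a B. C11 (J i) (E i n) a B" if "i \<in> A" for i
      using G(1)[OF that, of "r n"] C11_affine unfolding E_def[abs_def] by blast
  qed (use Elo in auto)
  have lim1: "(\<lambda>n. \<integral>y. E i n y \<partial>\<mu>) \<longlonglongrightarrow> (\<integral>y. H i y \<partial>\<mu>)" if "i \<in> A" for i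
  proof (rule integral_dominated_convergence[where w = "\<lambda>_. lo + w"])
    show "AE x in \<mu>. (\<lambda>n. E i n x) \<longlonglongrightarrow> H i x" using AE2 that by auto
    show "AE x in \<mu>. norm (E i n x) \<le> lo + w" for n
    proof (rule AE_I2)
      fix x show "norm (E i n x) \<le> lo + w" using Elo[OF that, of n x] lo by simp
    qed
  qed (use Hm[OF that] Em[OF that] in auto)
  have Hi: "integrable \<mu> (H i)" if "i \<in> A" for i
    using H[OF that] lo Hm[OF that] by (intro integrable_const_bound[where B = hi]) (auto simp: abs_of_nonneg order_trans[of 0 lo])
  have Hpos: "0 < (\<integral>y. H i y \<partial>\<mu>)" if "i \<in> A" for i
  proof -
    have "(\<integral>y. lo \<partial>\<mu>) \<le> (\<integral>y. H i y \<partial>\<mu>)" using Hi[OF that] H[OF that] by (intro integral_mono) auto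
    thus ?thesis using lo by (simp add: prob_space)
  qed
  define D where "D = (\<Prod>i\<in>A. lo powr (1 / p i) + (lo + w) powr (1 / p i))"
  have lim2: "(\<lambda>n. \<integral>y. (\<Prod>i\<in>A. E i n y powr (1 / p i)) \<partial>\<mu>) \<longlonglongrightarrow> (\<integral>y. (\<Prod>i\<in>A. H i y powr (1 / p i)) \<partial>\<mu>)"
  proof (rule integral_dominated_convergence[where w = "\<lambda>_. D"])
    show "AE x in \<mu>. (\<lambda>n. \<Prod>i\<in>A. E i n x powr (1 / p i)) \<longlonglongrightarrow> (\<Prod>i\<in>A. H i x powr (1 / p i))"
    proof (rule AE_mp[OF AE2], rule AE_I2, rule impI)
      fix x assume "\<forall>i\<in>A. (\<lambda>n. E i n x) \<longlonglongrightarrow> H i x"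
      moreover have "H i x \<noteq> 0" if "i \<in> A" for i using H(1)[OF that, of x] lo by auto
      ultimately show "(\<lambda>n. \<Prod>i\<in>A. E i n x powr (1 / p i)) \<longlonglongrightarrow> (\<Prod>i\<in>A. H i x powr (1 / p i))"
        by (intro tendsto_prod tendsto_powr tendsto_const) auto
    qed
    show "AE x in \<mu>. norm (\<Prod>i\<in>A. E i n x powr (1 / p i)) \<le> D" for n
    proof (rule AE_I2)
      fix x
      have "(\<Prod>i\<in>A. E i n x powr (1 / p i)) \<le> D" unfolding D_def
        by (intro prod_mono) (auto intro!: powr_le_sum[OF lo] Elo)
      moreover have "0 \<le> (\<Prod>i\<in>A. E i n x powr (1 / p i))" by (intro prod_nonneg) auto
      ultimately show "norm (\<Prod>i\<in>A. E i n x powr (1 / p i)) \<le> D" by simp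
    qed
  qed auto
  have lim3: "(\<lambda>n. \<Prod>i\<in>A. (\<integral>y. E i n y \<partial>\<mu>) powr (1 / p i)) \<longlonglongrightarrow> (\<Prod>i\<in>A. (\<integral>y. H i y \<partial>\<mu>) powr (1 / p i))"
    using lim1 Hpos by (intro tendsto_prod tendsto_powr tendsto_const) force+
  have "\<sigma> * ((\<integral>y. (\<Prod>i\<in>A. H i y powr (1 / p i)) \<partial>\<mu>) - (\<Prod>i\<in>A. (\<integral>y. H i y \<partial>\<mu>) powr (1 / p i))) \<le> 0"
    by (rule LIMSEQ_le_const2[OF tendsto_mult[OF tendsto_const tendsto_diff[OF lim2 lim3]]]) (use ineq in auto)
  thus ?thesis by (simp add: H_def)
qed

end

section \<open>Power means and truncation\<close>

lemma epowr_ennreal: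
  "p \<noteq> 0 \<Longrightarrow> epowr (ennreal t) p = (if t \<le> 0 then (if p > 0 then 0 else \<infinity>) else ennreal (t powr p))"
  by (auto simp: epowr_def ennreal_eq_0_iff)

lemma epowr_real:
  assumes "p \<noteq> 0" "0 < t \<or> (t = 0 \<and> 0 < p)"
  shows "epowr (ennreal t) p = ennreal (t powr p)"
  using assms by (auto simp: epowr_ennreal)

lemma epowr_measurable [measurable]: "(\<lambda>x. epowr x p) \<in> borel_measurable borel"
  unfolding epowr_def by measurable

lemma elog_measurable [measurable]: "elog \<in> borel_measurable borel"
  unfolding elog_def by measurable

lemma epowr_mono: "0 < p \<Longrightarrow> x \<le> y \<Longrightarrow> epowr x p \<le> epowr y p"
  by (cases x; cases y) (auto simp: epowr_ennreal epowr_def top_unique ennreal_le_iff2 intro!: ennreal_leI powr_mono2)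

lemma epowr_antimono: "p < 0 \<Longrightarrow> x \<le> y \<Longrightarrow> epowr y p \<le> epowr x p"
  by (cases x; cases y) (auto simp: epowr_ennreal epowr_def top_unique ennreal_le_iff2 intro!: ennreal_leI powr_mono2')

lemma epowr_tendsto:
  assumes X: "X \<longlonglongrightarrow> x" and r: "r \<noteq> 0" and x: "0 < r \<or> (x \<noteq> 0 \<and> x \<noteq> top)"
  shows "(\<lambda>n. epowr (X n) r) \<longlonglongrightarrow> epowr x r"
proof (cases x)
  case top
  hence r0: "0 < r" using x by auto
  have "(\<lambda>n. epowr (X n) r) \<longlonglongrightarrow> top"
    unfolding tendsto_top_iff_ennreal
  proof (intro allI impI)
    fix l :: real assume l: "0 \<le> l"
    have "eventually (\<lambda>n. ennreal (l powr (1 / r)) < X n) sequentially"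
      using X unfolding top tendsto_top_iff_ennreal by auto
    thus "eventually (\<lambda>n. ennreal l < epowr (X n) r) sequentially"
    proof eventually_elim
      case (elim n)
      show ?case
      proof (cases "X n")
        case (real t)
        hence t: "l powr (1 / r) < t" using elim by (simp add: ennreal_less_iff)
        hence "(l powr (1 / r)) powr r < t powr r" using r0 by (intro powr_less_mono2) auto
        hence "l < t powr r" using l r0 by (simp add: powr_powr)
        moreover have "0 < t" using t by (auto intro: le_less_trans[OF powr_ge_zero])
        ultimately show ?thesis using real r0 l by (simp add: epowr_real ennreal_less_iff)
      next
        case top
        thus ?thesis using r0 by (simp add: epowr_def)
      qed
    qed
  qed
  thus ?thesis using top r0 by (simp add: epowr_def)
next
  case (real t)
  hence t: "0 < t \<or> (t = 0 \<and> 0 < r)" using x by (cases "t = 0") auto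
  have ev: "eventually (\<lambda>n. epowr (X n) r = ennreal (enn2real (X n) powr r)) sequentially"
  proof -
    have "eventually (\<lambda>n. X n < top) sequentially" using X real by (intro order_tendstoD(2)) auto
    moreover have "eventually (\<lambda>n. 0 < X n \<or> 0 < r) sequentially"
    proof (cases "0 < r")
      case False
      hence "0 < x" using x by (simp add: zero_less_iff_neq_zero)
      from order_tendstoD(1)[OF X this] show ?thesis by eventually_elim auto
    qed auto
    ultimately show ?thesis
    proof eventually_elim
      case (elim n)
      have e: "X n = ennreal (enn2real (X n))" using elim(1) by simp
      have "0 < enn2real (X n) \<or> (enn2real (X n) = 0 \<and> 0 < r)"
        using elim by (metis e ennreal_0 enn2real_nonneg less_eq_real_def less_irrefl)
      thus ?case using epowr_real[OF r, of "enn2real (X n)"] e by simp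
    qed
  qed
  have "(\<lambda>n. enn2real (X n)) \<longlonglongrightarrow> t" using X real by (intro tendsto_enn2real) auto
  hence "(\<lambda>n. enn2real (X n) powr r) \<longlonglongrightarrow> t powr r"
    using t by (intro tendsto_powr' tendsto_const) auto
  hence "(\<lambda>n. ennreal (enn2real (X n) powr r)) \<longlonglongrightarrow> epowr x r"
    using t by (simp add: real epowr_real[OF r])
  thus ?thesis using ev by (simp add: tendsto_cong)
qed

lemma elog_mono: "x \<le> y \<Longrightarrow> elog x \<le> elog y"
  by (auto simp: elog_def)

lemma eexp_mono: "x \<le> y \<Longrightarrow> eexp x \<le> eexp y"
  by (cases x; cases y) (auto simp: eexp_def intro: ennreal_leI)

lemma eexp_tendsto:
  assumes X: "X \<longlonglongrightarrow> x" and x: "x \<noteq> - \<infinity>"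
  shows "(\<lambda>n. eexp (X n)) \<longlonglongrightarrow> eexp x"
proof (cases x)
  case (real r)
  have "eventually (\<lambda>n. X n < \<infinity>) sequentially" "eventually (\<lambda>n. - \<infinity> < X n) sequentially"
    by (rule order_tendstoD[OF X]; simp add: real)+
  hence ev: "eventually (\<lambda>n. eexp (X n) = ennreal (exp (real_of_ereal (X n)))) sequentially"
  proof eventually_elim
    case (elim n) thus ?case by (cases "X n") (auto simp: eexp_def)
  qed
  have "(\<lambda>n. real_of_ereal (X n)) \<longlonglongrightarrow> r" using X real by (intro lim_real_of_ereal) auto
  hence "(\<lambda>n. ennreal (exp (real_of_ereal (X n)))) \<longlonglongrightarrow> eexp x"
    by (auto simp: real eexp_def intro!: tendsto_intros)
  thus ?thesis using ev by (simp add: tendsto_cong)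
next
  case PInf
  have "(\<lambda>n. eexp (X n)) \<longlonglongrightarrow> top" unfolding tendsto_top_iff_ennreal
  proof (intro allI impI)
    fix l :: real assume l: "0 \<le> l"
    have "eventually (\<lambda>n. ereal (ln (l + 1)) < X n) sequentially"
      using X unfolding PInf tendsto_PInfty by auto
    thus "eventually (\<lambda>n. ennreal l < eexp (X n)) sequentially"
    proof eventually_elim
      case (elim n)
      show ?case
      proof (cases "X n")
        case (real r)
        hence "exp (ln (l + 1)) < exp r" using elim by simp
        thus ?thesis using real l by (simp add: eexp_def ennreal_less_iff)
      qed (use elim in \<open>auto simp: eexp_def\<close>)
    qed
  qed
  thus ?thesis using PInf by (simp add: eexp_def)
qed (use x in auto)

text \<open>For p < 0 both the inner power and the outer root reverse the order, so the reversals
  cancel. For p = 0 the positive and negative parts of the logarithm move in opposite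
  directions.\<close>

lemma power_mean_mono:
  assumes "\<And>\<omega>. \<omega> \<in> space M \<Longrightarrow> g \<omega> \<le> g' \<omega>"
  shows "power_mean M p g \<le> power_mean M p g'"
proof -
  consider "p = 0" | "0 < p" | "p < 0" by linarith
  thus ?thesis
  proof cases
    case 1
    have "(\<integral>\<^sup>+\<omega>. e2ennreal (elog (g \<omega>)) \<partial>M) \<le> (\<integral>\<^sup>+\<omega>. e2ennreal (elog (g' \<omega>)) \<partial>M)"
      "(\<integral>\<^sup>+\<omega>. e2ennreal (- elog (g' \<omega>)) \<partial>M) \<le> (\<integral>\<^sup>+\<omega>. e2ennreal (- elog (g \<omega>)) \<partial>M)"
      using assms by (auto intro!: nn_integral_mono e2ennreal_mono elog_mono)
    thus ?thesis unfolding power_mean_def eexpectation_def using 1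
      by (auto intro!: eexp_mono ereal_minus_mono simp: less_eq_ennreal.rep_eq[symmetric])
  next
    case 2
    have "(\<integral>\<^sup>+\<omega>. epowr (ennreal (g \<omega>)) p \<partial>M) \<le> (\<integral>\<^sup>+\<omega>. epowr (ennreal (g' \<omega>)) p \<partial>M)"
      using assms 2 by (intro nn_integral_mono epowr_mono ennreal_leI) auto
    thus ?thesis unfolding power_mean_def using 2 by (auto intro!: epowr_mono)
  next
    case 3
    have "(\<integral>\<^sup>+\<omega>. epowr (ennreal (g' \<omega>)) p \<partial>M) \<le> (\<integral>\<^sup>+\<omega>. epowr (ennreal (g \<omega>)) p \<partial>M)"
      using assms 3 by (intro nn_integral_mono epowr_antimono ennreal_leI) auto
    thus ?thesis unfolding power_mean_def using 3 by (auto intro!: epowr_antimono)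
  qed
qed

context prob_space
begin

text \<open>For functions bounded as stated, the extended powers agree with \<open>powr\<close>,
  including the value 0 when p > 0. Inequalities between ordinary integrals can therefore be read as
  inequalities between power means.\<close>

lemma power_mean_real:
  assumes [measurable]: "g \<in> borel_measurable M" and p: "p \<noteq> 0"
    and g: "\<And>\<omega>. \<omega> \<in> space M \<Longrightarrow> lo \<le> g \<omega>" "\<And>\<omega>. \<omega> \<in> space M \<Longrightarrow> g \<omega> \<le> hi"
    and lo: "0 < lo \<or> (lo = 0 \<and> 0 < p)"
  shows "power_mean M p g = ennreal ((\<integral>\<omega>. g \<omega> powr p \<partial>M) powr (1 / p))"
    and "integrable M (\<lambda>\<omega>. g \<omega> powr p)"
proof -
  have b: "g \<omega> powr p \<le> lo powr p + hi powr p" if "\<omega> \<in> space M" for \<omega>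
  proof (cases "0 < lo")
    case True
    thus ?thesis using g[OF that] by (intro powr_le_sum) auto
  next
    case False
    hence "g \<omega> powr p \<le> hi powr p" using lo g[OF that] by (intro powr_mono2) auto
    thus ?thesis by (simp add: add_increasing)
  qed
  show int: "integrable M (\<lambda>\<omega>. g \<omega> powr p)"
    using b by (intro integrable_const_bound[where B = "lo powr p + hi powr p"]) auto
  have pos: "0 < (\<integral>\<omega>. g \<omega> powr p \<partial>M) \<or> ((\<integral>\<omega>. g \<omega> powr p \<partial>M) = 0 \<and> 0 < p)"
  proof (cases "0 < lo")
    case True
    have "0 < (\<integral>\<omega>. g \<omega> powr p \<partial>M)"
    proof (rule ccontr)
      assume "\<not> ?thesis"
      moreover have "0 \<le> (\<integral>\<omega>. g \<omega> powr p \<partial>M)" by simp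
      ultimately have "(\<integral>\<omega>. g \<omega> powr p \<partial>M) = 0" by linarith
      hence "AE \<omega> in M. g \<omega> powr p = 0" using int by (subst (asm) integral_nonneg_eq_0_iff_AE) auto
      hence "AE \<omega> in M. False" using AE_space
      proof eventually_elim
        case (elim \<omega>)
        have "0 < g \<omega>" using g(1)[OF elim(2)] True by linarith
        thus ?case using elim(1) by simp
      qed
      thus False by simp
    qed
    thus ?thesis ..
  next
    case False
    have "0 \<le> (\<integral>\<omega>. g \<omega> powr p \<partial>M)" by simp
    thus ?thesis using False lo by linarith
  qed
  have "(\<integral>\<^sup>+\<omega>. epowr (ennreal (g \<omega>)) p \<partial>M) = (\<integral>\<^sup>+\<omega>. ennreal (g \<omega> powr p) \<partial>M)"
  proof (rule nn_integral_cong, rule epowr_real[OF p])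
    fix \<omega> assume "\<omega> \<in> space M"
    from g(1)[OF this] show "0 < g \<omega> \<or> (g \<omega> = 0 \<and> 0 < p)" using lo by linarith
  qed
  also have "\<dots> = ennreal (\<integral>\<omega>. g \<omega> powr p \<partial>M)" using int by (intro nn_integral_eq_integral) auto
  finally show "power_mean M p g = ennreal ((\<integral>\<omega>. g \<omega> powr p \<partial>M) powr (1 / p))"
    unfolding power_mean_def using p pos by (auto simp: epowr_real)
qed

lemma power_mean_0_real:
  assumes [measurable]: "g \<in> borel_measurable M"
    and g: "\<And>\<omega>. \<omega> \<in> space M \<Longrightarrow> lo \<le> g \<omega>" "\<And>\<omega>. \<omega> \<in> space M \<Longrightarrow> g \<omega> \<le> hi" and lo: "0 < lo"
  shows "power_mean M 0 g = ennreal (exp (\<integral>\<omega>. ln (g \<omega>) \<partial>M))"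
    and "\<And>\<omega>. \<omega> \<in> space M \<Longrightarrow> \<bar>ln (g \<omega>)\<bar> \<le> \<bar>ln lo\<bar> + \<bar>ln hi\<bar>"
    and "integrable M (\<lambda>\<omega>. ln (g \<omega>))"
proof -
  show b: "\<bar>ln (g \<omega>)\<bar> \<le> \<bar>ln lo\<bar> + \<bar>ln hi\<bar>" if "\<omega> \<in> space M" for \<omega>
  proof -
    have "ln lo \<le> ln (g \<omega>)" "ln (g \<omega>) \<le> ln hi" using g[OF that] lo by auto
    thus ?thesis by linarith
  qed
  show int: "integrable M (\<lambda>\<omega>. ln (g \<omega>))"
    using b by (intro integrable_const_bound[where B = "\<bar>ln lo\<bar> + \<bar>ln hi\<bar>"]) auto
  have e: "elog (g \<omega>) = ereal (ln (g \<omega>))" if "\<omega> \<in> space M" for \<omega>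
    using g[OF that] lo by (auto simp: elog_def)
  have fin: "(\<integral>\<^sup>+\<omega>. ennreal (ln (g \<omega>)) \<partial>M) \<noteq> top" "(\<integral>\<^sup>+\<omega>. ennreal (- ln (g \<omega>)) \<partial>M) \<noteq> top"
    using int by (auto simp: real_integrable_def)
  have "eexpectation M (\<lambda>\<omega>. elog (g \<omega>))
    = enn2ereal (\<integral>\<^sup>+\<omega>. ennreal (ln (g \<omega>)) \<partial>M) - enn2ereal (\<integral>\<^sup>+\<omega>. ennreal (- ln (g \<omega>)) \<partial>M)"
    unfolding eexpectation_def by (simp add: e cong: nn_integral_cong)
  also have "\<dots> = ereal (\<integral>\<omega>. ln (g \<omega>) \<partial>M)"
    using fin by (cases "\<integral>\<^sup>+\<omega>. ennreal (ln (g \<omega>)) \<partial>M"; cases "\<integral>\<^sup>+\<omega>. ennreal (- ln (g \<omega>)) \<partial>M")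
      (auto simp: real_lebesgue_integral_def[OF int] enn2ereal_ennreal)
  finally show "power_mean M 0 g = ennreal (exp (\<integral>\<omega>. ln (g \<omega>) \<partial>M))"
    by (simp add: power_mean_def eexp_def)
qed

text \<open>All exponents give the same mean, also for c = 0 under the conventions. This is what
  makes the exponent of a degenerate block irrelevant.\<close>

lemma power_mean_const:
  assumes [measurable]: "g \<in> borel_measurable M" and g: "AE \<omega> in M. g \<omega> = c" and c: "0 \<le> c"
  shows "power_mean M p g = ennreal c"
proof (cases "p = 0")
  case True
  have "(\<integral>\<^sup>+\<omega>. e2ennreal (elog (g \<omega>)) \<partial>M) = (\<integral>\<^sup>+\<omega>. e2ennreal (elog c) \<partial>M)"
    "(\<integral>\<^sup>+\<omega>. e2ennreal (- elog (g \<omega>)) \<partial>M) = (\<integral>\<^sup>+\<omega>. e2ennreal (- elog c) \<partial>M)"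
    by (rule nn_integral_cong_AE, use g in eventually_elim, simp)+
  hence "eexpectation M (\<lambda>\<omega>. elog (g \<omega>)) = enn2ereal (e2ennreal (elog c)) - enn2ereal (e2ennreal (- elog c))"
    by (simp add: eexpectation_def emeasure_space_1)
  also have "\<dots> = elog c"
    using c by (cases "0 \<le> ln c") (auto simp: elog_def e2ennreal_neg enn2ereal_ennreal ennreal_neg zero_ennreal.rep_eq)
  finally show ?thesis using True c by (auto simp: power_mean_def eexp_def elog_def)
next
  case False
  have "(\<integral>\<^sup>+\<omega>. epowr (ennreal (g \<omega>)) p \<partial>M) = (\<integral>\<^sup>+\<omega>. epowr (ennreal c) p \<partial>M)"
    by (rule nn_integral_cong_AE, use g in eventually_elim, simp)
  also have "\<dots> = epowr (ennreal c) p" by (simp add: emeasure_space_1)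
  finally show ?thesis using False c
    by (cases "c = 0") (auto simp: power_mean_def epowr_ennreal powr_powr epowr_def)
qed

text \<open>A nonzero mean supplies the integrability that the limit needs: for p < 0 it says that
  g^p has finite expectation, and for p = 0, together with \<open>def\<close>, that the negative
  part of log g does. For p > 0 monotone convergence suffices.\<close>

lemma power_mean_truncate:
  assumes [measurable]: "g \<in> borel_measurable M" and g: "\<And>\<omega>. \<omega> \<in> space M \<Longrightarrow> 0 \<le> g \<omega>"
    and nz: "power_mean M p g \<noteq> 0" and def: "p = 0 \<Longrightarrow> eexpectation_defined M (\<lambda>\<omega>. elog (g \<omega>))"
  shows "(\<lambda>K. power_mean M p (\<lambda>\<omega>. min (g \<omega>) (real (Suc K)))) \<longlonglongrightarrow> power_mean M p g"
proof -
  have ev: "eventually (\<lambda>K. min t (real (Suc K)) = t) sequentially" for t :: real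
  proof -
    obtain N where "t \<le> real N" using real_arch_simple by blast
    thus ?thesis by (intro eventually_sequentiallyI[of N]) auto
  qed
  consider "p = 0" | "0 < p" | "p < 0" by linarith
  thus ?thesis
  proof cases
    case 1
    define P N where "P = (\<integral>\<^sup>+\<omega>. e2ennreal (elog (g \<omega>)) \<partial>M)" and "N = (\<integral>\<^sup>+\<omega>. e2ennreal (- elog (g \<omega>)) \<partial>M)"
    have pm: "power_mean M p g = eexp (enn2ereal P - enn2ereal N)"
      unfolding power_mean_def eexpectation_def P_def N_def using 1 by (simp only: simp_thms if_True)
    have PN: "P < \<infinity> \<or> N < \<infinity>" using def[OF 1] unfolding eexpectation_defined_def P_def N_def .
    have N: "N \<noteq> top"
    proof
      assume Nt: "N = top"
      with PN obtain r where "P = ennreal r" "0 \<le> r" by (cases P) auto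
      hence "enn2ereal P - enn2ereal N = - \<infinity>" using Nt by (simp add: enn2ereal_ennreal)
      thus False using nz unfolding pm by (simp add: eexp_def)
    qed
    then obtain b where eN: "enn2ereal N = ereal b" by (cases N) (auto simp: enn2ereal_ennreal)
    have P0: "enn2ereal P \<noteq> - \<infinity>" using enn2ereal_nonneg[of P] by auto
    \<comment> \<open>The truncation levels are at least 1, so the logarithm changes only where it
      is nonnegative.\<close>
    have Neq: "(\<integral>\<^sup>+\<omega>. e2ennreal (- elog (min (g \<omega>) (real (Suc K)))) \<partial>M) = N" for K
      unfolding N_def
    proof (rule nn_integral_cong)
      fix \<omega>
      show "e2ennreal (- elog (min (g \<omega>) (real (Suc K)))) = e2ennreal (- elog (g \<omega>))"
      proof (cases "g \<omega> \<le> real (Suc K)")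
        case False
        hence "0 \<le> ln (g \<omega>)" "0 < g \<omega>" by auto
        thus ?thesis using False by (simp add: elog_def min_def ennreal_neg)
      qed (simp add: min_def)
    qed
    have "(\<lambda>K. \<integral>\<^sup>+\<omega>. e2ennreal (elog (min (g \<omega>) (real (Suc K)))) \<partial>M) \<longlonglongrightarrow> P" unfolding P_def
    proof (rule nn_integral_LIMSEQ)
      show "incseq (\<lambda>K \<omega>. e2ennreal (elog (min (g \<omega>) (real (Suc K)))))"
        by (auto simp: incseq_def le_fun_def intro!: e2ennreal_mono elog_mono)
      fix \<omega>
      show "(\<lambda>K. e2ennreal (elog (min (g \<omega>) (real (Suc K))))) \<longlonglongrightarrow> e2ennreal (elog (g \<omega>))"
        by (rule tendsto_eventually, use ev[of "g \<omega>"] in eventually_elim, simp)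
    qed measurable
    hence "(\<lambda>K. enn2ereal (\<integral>\<^sup>+\<omega>. e2ennreal (elog (min (g \<omega>) (real (Suc K)))) \<partial>M) - enn2ereal N) \<longlonglongrightarrow> enn2ereal P - enn2ereal N"
      by (intro tendsto_diff_ereal_general tendsto_enn2erealI tendsto_const) (use eN P0 in auto)
    moreover have "enn2ereal P - enn2ereal N \<noteq> - \<infinity>"
      using P0 unfolding eN by (cases "enn2ereal P") auto
    ultimately show ?thesis
      unfolding pm unfolding power_mean_def eexpectation_def Neq using 1
      by (simp only: simp_thms if_True) (rule eexp_tendsto)
  next
    case 2
    have "(\<lambda>K. \<integral>\<^sup>+\<omega>. epowr (ennreal (min (g \<omega>) (real (Suc K)))) p \<partial>M) \<longlonglongrightarrow> (\<integral>\<^sup>+\<omega>. epowr (ennreal (g \<omega>)) p \<partial>M)"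
    proof (rule nn_integral_LIMSEQ)
      show "incseq (\<lambda>K \<omega>. epowr (ennreal (min (g \<omega>) (real (Suc K)))) p)"
        using 2 by (auto simp: incseq_def le_fun_def intro!: epowr_mono ennreal_leI)
      fix \<omega>
      show "(\<lambda>K. epowr (ennreal (min (g \<omega>) (real (Suc K)))) p) \<longlonglongrightarrow> epowr (ennreal (g \<omega>)) p"
        by (rule tendsto_eventually, use ev[of "g \<omega>"] in eventually_elim, simp)
    qed measurable
    thus ?thesis using 2 by (auto simp: power_mean_def intro!: epowr_tendsto)
  next
    case 3
    define V where "V = (\<integral>\<^sup>+\<omega>. epowr (ennreal (g \<omega>)) p \<partial>M)"
    have pm: "power_mean M p g = epowr V (1 / p)" using 3 by (simp add: power_mean_def V_def)
    have V: "V \<noteq> top"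
    proof
      assume "V = top"
      thus False using nz 3 unfolding pm by (simp add: epowr_def)
    qed
    have V0: "V \<noteq> 0"
    proof
      assume "V = 0"
      hence "AE \<omega> in M. epowr (ennreal (g \<omega>)) p = 0" unfolding V_def by (subst (asm) nn_integral_0_iff_AE) auto
      moreover have "epowr (ennreal (g \<omega>)) p \<noteq> 0" for \<omega> using 3 by (auto simp: epowr_ennreal)
      ultimately show False by simp
    qed
    have "(\<lambda>K. \<integral>\<^sup>+\<omega>. epowr (ennreal (min (g \<omega>) (real (Suc K)))) p \<partial>M) \<longlonglongrightarrow> V" unfolding V_def
    \<comment> \<open>The truncated function equals either \<open>g\<close> or a level of at least
      1, whose negative powers are at most 1.\<close>
    proof (rule nn_integral_dominated_convergence[where w = "\<lambda>\<omega>. epowr (ennreal (g \<omega>)) p + 1"])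
      show "AE \<omega> in M. epowr (ennreal (min (g \<omega>) (real (Suc K)))) p \<le> epowr (ennreal (g \<omega>)) p + 1" for K
      proof (rule AE_I2)
        fix \<omega>
        have "real (Suc K) powr p \<le> 1 powr p" using 3 by (intro powr_mono2') auto
        moreover have "epowr (ennreal (real (Suc K))) p = ennreal (real (Suc K) powr p)"
          using 3 by (intro epowr_real) auto
        ultimately have le: "epowr (ennreal (real (Suc K))) p \<le> 1"
          by (metis ennreal_1 ennreal_leI powr_one_eq_one)
        show "epowr (ennreal (min (g \<omega>) (real (Suc K)))) p \<le> epowr (ennreal (g \<omega>)) p + 1"
        proof (cases "g \<omega> \<le> real (Suc K)")
          case False
          hence "min (g \<omega>) (real (Suc K)) = real (Suc K)" by linarith
          thus ?thesis using add_increasing[OF zero_le le] by (simp only:)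
        qed (simp add: min_def add_increasing2)
      qed
      show "AE \<omega> in M. (\<lambda>K. epowr (ennreal (min (g \<omega>) (real (Suc K)))) p) \<longlonglongrightarrow> epowr (ennreal (g \<omega>)) p"
      proof (rule AE_I2)
        fix \<omega>
        show "(\<lambda>K. epowr (ennreal (min (g \<omega>) (real (Suc K)))) p) \<longlonglongrightarrow> epowr (ennreal (g \<omega>)) p"
          by (rule tendsto_eventually, use ev[of "g \<omega>"] in eventually_elim, simp)
      qed
      show "(\<integral>\<^sup>+\<omega>. epowr (ennreal (g \<omega>)) p + 1 \<partial>M) < \<infinity>"
        using V by (simp add: nn_integral_add V_def[symmetric] emeasure_space_1 less_top[symmetric])
    qed measurable
    thus ?thesis using 3 V V0 by (auto simp: power_mean_def V_def[symmetric] intro!: epowr_tendsto)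
  qed
qed

end

section \<open>Removing the bounds on the functions\<close>

lemma prod_mono_ennreal:
  fixes f g :: "'b \<Rightarrow> ennreal"
  assumes "\<And>i. i \<in> A \<Longrightarrow> f i \<le> g i"
  shows "prod f A \<le> prod g A"
  using assms by (induction A rule: infinite_finite_induct) (auto intro: mult_mono)

text \<open>Multiplication on [0, \<infinity>] fails to be continuous only where 0 meets infinity;
  nonzero limits keep every partial product away from that case.\<close>

lemma tendsto_prod_ennreal:
  fixes f :: "'b \<Rightarrow> nat \<Rightarrow> ennreal"
  assumes "finite A" and f: "\<And>i. i \<in> A \<Longrightarrow> f i \<longlonglongrightarrow> l i" "\<And>i. i \<in> A \<Longrightarrow> l i \<noteq> 0"
  shows "(\<lambda>n. \<Prod>i\<in>A. f i n) \<longlonglongrightarrow> (\<Prod>i\<in>A. l i)"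
  using assms
proof (induction A rule: finite_induct)
  case (insert i A)
  have "(\<Prod>i\<in>A. l i) \<noteq> 0" using insert by (simp add: prod_zero_iff)
  thus ?case using insert by (auto intro!: tendsto_mult_ennreal)
qed simp

text \<open>Expansion of exp to second order, with the cubic remainder absorbed by h^3 <= h^2. With
  g = ln t it controls \<open>t powr (- h)\<close> for small h.\<close>

lemma exp_minus_le:
  fixes g G h :: real
  assumes g: "\<bar>g\<bar> \<le> G" and h: "0 < h" "h \<le> 1"
  shows "exp (- h * g) \<le> 1 - h * g + (G\<^sup>2 / 2 + exp G * G ^ 3) * h\<^sup>2"
proof -
  have G: "0 \<le> G" using g by linarith
  define L where "L = - h * g"
  have L: "\<bar>L\<bar> \<le> h * G" using g h by (simp add: L_def abs_mult mult_left_mono)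
  have hG: "h * G \<le> G" using h G by (simp add: mult_left_le_one_le)
  have "\<bar>exp L - (1 + L + L\<^sup>2 / 2)\<bar> \<le> exp \<bar>L\<bar> * \<bar>L\<bar> ^ 3" by (rule exp_quadratic_bound)
  also have "\<dots> \<le> exp G * (h * G) ^ 3" using L hG by (intro mult_mono power_mono) auto
  also have "\<dots> \<le> exp G * G ^ 3 * h\<^sup>2"
  proof -
    have "h ^ 3 \<le> h\<^sup>2" using h by (intro power_decreasing) auto
    hence "(exp G * G ^ 3) * h ^ 3 \<le> (exp G * G ^ 3) * h\<^sup>2" using G by (intro mult_left_mono) auto
    thus ?thesis by (simp add: power_mult_distrib mult_ac)
  qed
  finally have "exp L \<le> 1 + L + L\<^sup>2 / 2 + exp G * G ^ 3 * h\<^sup>2" by linarith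
  moreover have "L\<^sup>2 \<le> (h * G)\<^sup>2" using L by (subst abs_le_square_iff[symmetric]) (use h G in auto)
  ultimately show ?thesis by (simp add: L_def power_mult_distrib algebra_simps)
qed

context prob_space
begin

text \<open>As \<epsilon> tends to 0, positive exponents keep powers continuous at 0 and dominated
  convergence applies. As K tends to infinity, monotone convergence handles the left side, while
  truncation can only lower the power means on the right.\<close>

lemma upper_extension:
  assumes A: "finite A" and p: "\<And>i. i \<in> A \<Longrightarrow> 0 < p i"
    and g[measurable]: "\<And>i. i \<in> A \<Longrightarrow> g i \<in> borel_measurable M"
    and g0: "\<And>i \<omega>. i \<in> A \<Longrightarrow> \<omega> \<in> space M \<Longrightarrow> 0 \<le> g i \<omega>"
    and bounded: "\<And>K \<epsilon>. 0 < K \<Longrightarrow> 0 < \<epsilon> \<Longrightarrow> (\<integral>\<omega>. (\<Prod>i\<in>A. min (g i \<omega>) K + \<epsilon>) \<partial>M)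
      \<le> (\<Prod>i\<in>A. (\<integral>\<omega>. (min (g i \<omega>) K + \<epsilon>) powr p i \<partial>M) powr (1 / p i))"
  shows "(\<integral>\<^sup>+\<omega>. ennreal (\<Prod>i\<in>A. g i \<omega>) \<partial>M) \<le> (\<Prod>i\<in>A. power_mean M (p i) (g i))"
proof -
  have trunc: "(\<integral>\<^sup>+\<omega>. ennreal (\<Prod>i\<in>A. min (g i \<omega>) K) \<partial>M) \<le> (\<Prod>i\<in>A. power_mean M (p i) (\<lambda>\<omega>. min (g i \<omega>) K))"
    if K: "0 < K" for K
  proof -
    define t where "t i \<omega> = min (g i \<omega>) K" for i \<omega>
    have t[measurable]: "t i \<in> borel_measurable M" if "i \<in> A" for i using g[OF that] unfolding t_def[abs_def] by measurable
    have t0: "0 \<le> t i \<omega>" "t i \<omega> \<le> K" if "i \<in> A" "\<omega> \<in> space M" for i \<omega> using g0[OF that] K by (auto simp: t_def)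
    define a where "a i = (\<integral>\<omega>. t i \<omega> powr p i \<partial>M) powr (1 / p i)" for i
    have pm: "power_mean M (p i) (t i) = ennreal (a i)" if "i \<in> A" for i
      unfolding a_def by (rule power_mean_real(1)[where lo = 0 and hi = K]) (use t0 t p that in force)+
    define r where "r n i = (\<integral>\<omega>. (t i \<omega> + 1 / real (Suc n)) powr p i \<partial>M) powr (1 / p i)" for n i
    have lim: "(\<lambda>n. r n i) \<longlonglongrightarrow> a i" if i: "i \<in> A" for i
    proof -
      have s: "(\<lambda>n. 1 / real (Suc n)) \<longlonglongrightarrow> 0" by (rule LIMSEQ_Suc[OF lim_1_over_n])
      have pt: "(\<lambda>n. (t i \<omega> + 1 / real (Suc n)) powr p i) \<longlonglongrightarrow> t i \<omega> powr p i" if "\<omega> \<in> space M" for \<omega>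
      proof -
        have "(\<lambda>n. t i \<omega> + 1 / real (Suc n)) \<longlonglongrightarrow> t i \<omega> + 0" by (intro tendsto_add tendsto_const s)
        hence "(\<lambda>n. t i \<omega> + 1 / real (Suc n)) \<longlonglongrightarrow> t i \<omega>" by simp
        thus ?thesis using t0[OF i that] p[OF i]
          by (intro tendsto_powr' tendsto_const) (auto intro!: always_eventually)
      qed
      have "(\<lambda>n. \<integral>\<omega>. (t i \<omega> + 1 / real (Suc n)) powr p i \<partial>M) \<longlonglongrightarrow> (\<integral>\<omega>. t i \<omega> powr p i \<partial>M)"
      proof (rule integral_dominated_convergence[where w = "\<lambda>_. (K + 1) powr p i"])
        show "AE \<omega> in M. (\<lambda>n. (t i \<omega> + 1 / real (Suc n)) powr p i) \<longlonglongrightarrow> t i \<omega> powr p i"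
          using pt by (rule AE_I2)
        show "AE \<omega> in M. norm ((t i \<omega> + 1 / real (Suc n)) powr p i) \<le> (K + 1) powr p i" for n
        proof (rule AE_I2)
          fix \<omega> assume w: "\<omega> \<in> space M"
          have "1 / real (Suc n) \<le> 1" by simp
          hence "t i \<omega> + 1 / real (Suc n) \<le> K + 1" using t0[OF i w] by linarith
          moreover have "0 \<le> t i \<omega> + 1 / real (Suc n)" using t0[OF i w] by simp
          ultimately show "norm ((t i \<omega> + 1 / real (Suc n)) powr p i) \<le> (K + 1) powr p i"
            using p[OF i] by (auto intro!: powr_mono2)
        qed
        show "(\<lambda>\<omega>. t i \<omega> powr p i) \<in> borel_measurable M"
          "\<And>n. (\<lambda>\<omega>. (t i \<omega> + 1 / real (Suc n)) powr p i) \<in> borel_measurable M"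
          using t[OF i] by measurable
      qed auto
      thus ?thesis unfolding r_def a_def using p[OF i]
        by (intro tendsto_powr' tendsto_const) (auto intro!: always_eventually)
    qed
    have tb: "integrable M (\<lambda>\<omega>. \<Prod>i\<in>A. t i \<omega> + e)" if e: "0 \<le> e" for e
    proof (rule integrable_const_bound[where B = "\<Prod>i\<in>A. K + e"])
      show "AE \<omega> in M. norm (\<Prod>i\<in>A. t i \<omega> + e) \<le> (\<Prod>i\<in>A. K + e)"
      proof (rule AE_I2)
        fix \<omega> assume w: "\<omega> \<in> space M"
        show "norm (\<Prod>i\<in>A. t i \<omega> + e) \<le> (\<Prod>i\<in>A. K + e)"
          unfolding prod_norm[symmetric] using t0[OF _ w] e by (intro prod_mono) auto
      qed
      show "(\<lambda>\<omega>. \<Prod>i\<in>A. t i \<omega> + e) \<in> borel_measurable M" using t by measurable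
    qed
    have "(\<integral>\<omega>. (\<Prod>i\<in>A. t i \<omega>) \<partial>M) \<le> (\<Prod>i\<in>A. a i)"
    proof (rule LIMSEQ_le_const[OF tendsto_prod[OF lim]])
      have "(\<integral>\<omega>. (\<Prod>i\<in>A. t i \<omega>) \<partial>M) \<le> (\<Prod>i\<in>A. r n i)" for n
      proof -
        have "(\<integral>\<omega>. (\<Prod>i\<in>A. t i \<omega>) \<partial>M) \<le> (\<integral>\<omega>. (\<Prod>i\<in>A. t i \<omega> + 1 / real (Suc n)) \<partial>M)"
          using tb[of 0] tb[of "1 / real (Suc n)"] t0 by (intro integral_mono prod_mono) auto
        also have "\<dots> \<le> (\<Prod>i\<in>A. r n i)" unfolding r_def t_def using K by (intro bounded) auto
        finally show ?thesis .
      qed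
      thus "\<exists>N. \<forall>n\<ge>N. (\<integral>\<omega>. (\<Prod>i\<in>A. t i \<omega>) \<partial>M) \<le> (\<Prod>i\<in>A. r n i)" by blast
    qed
    moreover have "(\<integral>\<^sup>+\<omega>. ennreal (\<Prod>i\<in>A. t i \<omega>) \<partial>M) = ennreal (\<integral>\<omega>. (\<Prod>i\<in>A. t i \<omega>) \<partial>M)"
      using tb[of 0] t0 by (intro nn_integral_eq_integral AE_I2 prod_nonneg) auto
    moreover have "(\<Prod>i\<in>A. power_mean M (p i) (t i)) = ennreal (\<Prod>i\<in>A. a i)"
      using pm by (simp add: prod_ennreal a_def)
    ultimately have "(\<integral>\<^sup>+\<omega>. ennreal (\<Prod>i\<in>A. t i \<omega>) \<partial>M) \<le> (\<Prod>i\<in>A. power_mean M (p i) (t i))"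
      by (simp add: ennreal_leI)
    thus ?thesis by (simp add: t_def[abs_def])
  qed
  \<comment> \<open>Absolute values make the sequence increasing at every argument, also outside
    \<open>space M\<close>, as the pointwise order on functions demands.\<close>
  define u where "u n \<omega> = (\<Prod>i\<in>A. min (\<bar>g i \<omega>\<bar>) (real (Suc n)))" for n \<omega>
  have ueq: "u n \<omega> = (\<Prod>i\<in>A. min (g i \<omega>) (real (Suc n)))" if "\<omega> \<in> space M" for n \<omega>
    unfolding u_def using g0[OF _ that] by (intro prod.cong) auto
  have "(\<lambda>n. \<integral>\<^sup>+\<omega>. ennreal (u n \<omega>) \<partial>M) \<longlonglongrightarrow> (\<integral>\<^sup>+\<omega>. ennreal (\<Prod>i\<in>A. \<bar>g i \<omega>\<bar>) \<partial>M)"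
  proof (rule nn_integral_LIMSEQ)
    show "incseq (\<lambda>n \<omega>. ennreal (u n \<omega>))"
      unfolding u_def by (auto simp: incseq_def le_fun_def intro!: ennreal_leI prod_mono)
    show "(\<lambda>\<omega>. ennreal (u n \<omega>)) \<in> borel_measurable M" for n unfolding u_def using g by measurable
    fix \<omega>
    have "(\<lambda>n. min t (real (Suc n))) \<longlonglongrightarrow> t" for t :: real
    proof -
      obtain N where "t \<le> real N" using real_arch_simple by blast
      hence "eventually (\<lambda>n. min t (real (Suc n)) = t) sequentially" by (intro eventually_sequentiallyI[of N]) auto
      thus ?thesis by (rule tendsto_eventually)
    qed
    thus "(\<lambda>n. ennreal (u n \<omega>)) \<longlonglongrightarrow> ennreal (\<Prod>i\<in>A. \<bar>g i \<omega>\<bar>)"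
      unfolding u_def by (intro tendsto_ennrealI tendsto_prod)
  qed
  moreover have "(\<integral>\<^sup>+\<omega>. ennreal (u n \<omega>) \<partial>M) \<le> (\<Prod>i\<in>A. power_mean M (p i) (g i))" for n
  proof -
    have "(\<integral>\<^sup>+\<omega>. ennreal (u n \<omega>) \<partial>M) = (\<integral>\<^sup>+\<omega>. ennreal (\<Prod>i\<in>A. min (g i \<omega>) (real (Suc n))) \<partial>M)"
      by (rule nn_integral_cong) (simp only: ueq)
    also have "\<dots> \<le> (\<Prod>i\<in>A. power_mean M (p i) (\<lambda>\<omega>. min (g i \<omega>) (real (Suc n))))" by (rule trunc) simp
    also have "\<dots> \<le> (\<Prod>i\<in>A. power_mean M (p i) (g i))"
      by (intro prod_mono_ennreal power_mean_mono) auto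
    finally show ?thesis .
  qed
  ultimately have "(\<integral>\<^sup>+\<omega>. ennreal (\<Prod>i\<in>A. \<bar>g i \<omega>\<bar>) \<partial>M) \<le> (\<Prod>i\<in>A. power_mean M (p i) (g i))"
    by (auto intro: LIMSEQ_le_const2)
  also have "(\<integral>\<^sup>+\<omega>. ennreal (\<Prod>i\<in>A. \<bar>g i \<omega>\<bar>) \<partial>M) = (\<integral>\<^sup>+\<omega>. ennreal (\<Prod>i\<in>A. g i \<omega>) \<partial>M)"
  proof (rule nn_integral_cong)
    fix \<omega> assume "\<omega> \<in> space M"
    hence "(\<Prod>i\<in>A. \<bar>g i \<omega>\<bar>) = (\<Prod>i\<in>A. g i \<omega>)" using g0 by (intro prod.cong) auto
    thus "ennreal (\<Prod>i\<in>A. \<bar>g i \<omega>\<bar>) = ennreal (\<Prod>i\<in>A. g i \<omega>)" by simp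
  qed
  finally show ?thesis .
qed

text \<open>Integrating the expansion gives E t^(-h) <= 1 - h E(ln t) + C h^2 <= exp (- h E(ln t) +
  C h^2), and the decreasing power - 1 / h turns this into a lower bound: the mean with exponent - h
  is at least the geometric mean up to the factor exp (- C h).\<close>

lemma exp_mean_ln_le:
  assumes [measurable]: "t \<in> borel_measurable M" and G: "\<And>\<omega>. \<omega> \<in> space M \<Longrightarrow> \<bar>ln (t \<omega>)\<bar> \<le> (G :: real)"
    and t: "\<And>\<omega>. \<omega> \<in> space M \<Longrightarrow> 0 < t \<omega>" and h: "0 < h" "h \<le> 1"
  shows "exp ((\<integral>\<omega>. ln (t \<omega>) \<partial>M) - (G\<^sup>2 / 2 + exp G * G ^ 3) * h) \<le> (\<integral>\<omega>. t \<omega> powr (- h) \<partial>M) powr (1 / (- h))"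
proof -
  define C where "C = G\<^sup>2 / 2 + exp G * G ^ 3"
  define E where "E = (\<integral>\<omega>. ln (t \<omega>) \<partial>M)"
  have int: "integrable M (\<lambda>\<omega>. ln (t \<omega>))" using G by (intro integrable_const_bound[where B = G]) auto
  have pw: "t \<omega> powr (- h) = exp (- h * ln (t \<omega>))" if "\<omega> \<in> space M" for \<omega>
    using t[OF that] by (simp add: powr_def)
  have b: "t \<omega> powr (- h) \<le> 1 - h * ln (t \<omega>) + C * h\<^sup>2" if "\<omega> \<in> space M" for \<omega>
    unfolding pw[OF that] C_def by (rule exp_minus_le[OF G[OF that] h])
  have "t \<omega> powr (- h) \<le> exp G" "exp (- G) \<le> t \<omega> powr (- h)" if "\<omega> \<in> space M" for \<omega>
  proof -
    have "\<bar>h * ln (t \<omega>)\<bar> \<le> 1 * G" unfolding abs_mult using h G[OF that] by (intro mult_mono) auto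
    thus "t \<omega> powr (- h) \<le> exp G" "exp (- G) \<le> t \<omega> powr (- h)" unfolding pw[OF that] by (auto simp: abs_le_iff)
  qed
  note bd = this
  have ip: "integrable M (\<lambda>\<omega>. t \<omega> powr (- h))"
    using bd by (intro integrable_const_bound[where B = "exp G"]) auto
  have pos: "0 < (\<integral>\<omega>. t \<omega> powr (- h) \<partial>M)"
  proof -
    have "(\<integral>\<omega>. exp (- G) \<partial>M) \<le> (\<integral>\<omega>. t \<omega> powr (- h) \<partial>M)" using ip bd by (intro integral_mono) auto
    thus ?thesis using exp_gt_zero[of "- G"] by (simp add: prob_space del: exp_gt_zero)
  qed
  have "(\<integral>\<omega>. t \<omega> powr (- h) \<partial>M) \<le> (\<integral>\<omega>. 1 - h * ln (t \<omega>) + C * h\<^sup>2 \<partial>M)"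
    using ip int b by (intro integral_mono) auto
  also have "\<dots> = 1 + (- h * E + C * h\<^sup>2)" using int by (simp add: E_def prob_space)
  also have "\<dots> \<le> exp (- h * E + C * h\<^sup>2)" by (rule exp_ge_add_one_self)
  finally have le: "(\<integral>\<omega>. t \<omega> powr (- h) \<partial>M) \<le> exp (- h * E + C * h\<^sup>2)" .
  have "exp (E - C * h) = exp (- h * E + C * h\<^sup>2) powr (1 / (- h))"
    using h by (simp add: powr_def power2_eq_square field_simps)
  also have "\<dots> \<le> (\<integral>\<omega>. t \<omega> powr (- h) \<partial>M) powr (1 / (- h))"
    using h pos le by (intro powr_mono2') auto
  finally show ?thesis by (simp add: E_def C_def)
qed

text \<open>A vanishing exponent is approached by \<open>- h\<close>; lowering the exponents only decreases \<open>P\<close>.\<close>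

lemma lower_extension:
  assumes A: "finite A"
    and g[measurable]: "\<And>i. i \<in> A \<Longrightarrow> g i \<in> borel_measurable M"
    and g0: "\<And>i \<omega>. i \<in> A \<Longrightarrow> \<omega> \<in> space M \<Longrightarrow> 0 \<le> g i \<omega>"
    and def: "\<And>i. i \<in> A \<Longrightarrow> p i = 0 \<Longrightarrow> eexpectation_defined M (\<lambda>\<omega>. elog (g i \<omega>))"
    and bounded: "\<And>K \<epsilon> h q. 0 < K \<Longrightarrow> 0 < \<epsilon> \<Longrightarrow> 0 < h \<Longrightarrow> q = (\<lambda>i. if p i = 0 then - h else p i) \<Longrightarrow>
      (\<Prod>i\<in>A. (\<integral>\<omega>. (min (g i \<omega>) K + \<epsilon>) powr q i \<partial>M) powr (1 / q i))
      \<le> (\<integral>\<omega>. (\<Prod>i\<in>A. min (g i \<omega>) K + \<epsilon>) \<partial>M)"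
  shows "(\<Prod>i\<in>A. power_mean M (p i) (g i)) \<le> (\<integral>\<^sup>+\<omega>. ennreal (\<Prod>i\<in>A. g i \<omega>) \<partial>M)"
proof -
  have tb: "integrable M (\<lambda>\<omega>. \<Prod>i\<in>A. min (g i \<omega>) K + e)" if e: "0 \<le> e" "0 < K" for e K
  proof (rule integrable_const_bound[where B = "\<Prod>i\<in>A. K + e"])
    show "AE \<omega> in M. norm (\<Prod>i\<in>A. min (g i \<omega>) K + e) \<le> (\<Prod>i\<in>A. K + e)"
    proof (rule AE_I2)
      fix \<omega> assume w: "\<omega> \<in> space M"
      show "norm (\<Prod>i\<in>A. min (g i \<omega>) K + e) \<le> (\<Prod>i\<in>A. K + e)"
        unfolding prod_norm[symmetric] using g0[OF _ w] e by (intro prod_mono) auto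
    qed
    show "(\<lambda>\<omega>. \<Prod>i\<in>A. min (g i \<omega>) K + e) \<in> borel_measurable M" using g by measurable
  qed
  have step1: "(\<Prod>i\<in>A. power_mean M (p i) (\<lambda>\<omega>. min (g i \<omega>) K + \<epsilon>)) \<le> ennreal (\<integral>\<omega>. (\<Prod>i\<in>A. min (g i \<omega>) K + \<epsilon>) \<partial>M)"
    if K: "0 < K" and e: "0 < \<epsilon>" for K \<epsilon>
  proof -
    define t where "t i \<omega> = min (g i \<omega>) K + \<epsilon>" for i \<omega>
    have t[measurable]: "t i \<in> borel_measurable M" if "i \<in> A" for i using g[OF that] unfolding t_def[abs_def] by measurable
    have t0: "\<epsilon> \<le> t i \<omega>" "t i \<omega> \<le> K + \<epsilon>" if "i \<in> A" "\<omega> \<in> space M" for i \<omega>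
      using g0[OF that] K by (auto simp: t_def)
    define G where "G = \<bar>ln \<epsilon>\<bar> + \<bar>ln (K + \<epsilon>)\<bar>"
    define C where "C = G\<^sup>2 / 2 + exp G * G ^ 3"
    define a where "a i = (if p i = 0 then exp (\<integral>\<omega>. ln (t i \<omega>) \<partial>M) else (\<integral>\<omega>. t i \<omega> powr p i \<partial>M) powr (1 / p i))" for i
    have pm: "power_mean M (p i) (t i) = ennreal (a i)" if i: "i \<in> A" for i
      using power_mean_real(1)[OF t[OF i] _ t0(1)[OF i] t0(2)[OF i], of "p i"]
        power_mean_0_real(1)[OF t[OF i] t0(1)[OF i] t0(2)[OF i]] e by (auto simp: a_def)
    have lnG: "\<bar>ln (t i \<omega>)\<bar> \<le> G" if "i \<in> A" "\<omega> \<in> space M" for i \<omega>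
      unfolding G_def using power_mean_0_real(2)[OF t[OF that(1)] t0(1)[OF that(1)] t0(2)[OF that(1)] e that(2)] .
    \<comment> \<open>For a zero exponent this is the lower bound for the mean with exponent - 1 /
      (n + 1); it converges to the geometric mean. Other exponents are left alone.\<close>
    define r where "r n i = (if p i = 0 then exp ((\<integral>\<omega>. ln (t i \<omega>) \<partial>M) - C * (1 / real (Suc n))) else a i)" for n i
    have lim: "(\<lambda>n. r n i) \<longlonglongrightarrow> a i" for i
    proof (cases "p i = 0")
      case True
      have s: "(\<lambda>n. 1 / real (Suc n)) \<longlonglongrightarrow> 0" by (rule LIMSEQ_Suc[OF lim_1_over_n])
      have "(\<lambda>n. exp ((\<integral>\<omega>. ln (t i \<omega>) \<partial>M) - C * (1 / real (Suc n)))) \<longlonglongrightarrow> exp ((\<integral>\<omega>. ln (t i \<omega>) \<partial>M) - C * 0)"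
        by (intro tendsto_exp tendsto_diff tendsto_mult tendsto_const s)
      thus ?thesis using True by (simp add: r_def a_def)
    qed (simp add: r_def)
    have "(\<Prod>i\<in>A. a i) \<le> (\<integral>\<omega>. (\<Prod>i\<in>A. t i \<omega>) \<partial>M)"
    proof (rule LIMSEQ_le_const2[OF tendsto_prod[OF lim]])
      have "(\<Prod>i\<in>A. r n i) \<le> (\<integral>\<omega>. (\<Prod>i\<in>A. t i \<omega>) \<partial>M)" for n
      proof -
        define h where "h = 1 / real (Suc n)"
        have h: "0 < h" "h \<le> 1" by (auto simp: h_def)
        define q where "q = (\<lambda>i. if p i = 0 then - h else p i)"
        have "(\<Prod>i\<in>A. r n i) \<le> (\<Prod>i\<in>A. (\<integral>\<omega>. t i \<omega> powr q i \<partial>M) powr (1 / q i))"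
        proof (rule prod_mono, rule conjI)
          fix i assume i: "i \<in> A"
          show "0 \<le> r n i" by (auto simp: r_def a_def)
          show "r n i \<le> (\<integral>\<omega>. t i \<omega> powr q i \<partial>M) powr (1 / q i)"
          proof (cases "p i = 0")
            case True
            have "0 < t i \<omega>" if "\<omega> \<in> space M" for \<omega> using t0[OF i that] e by linarith
            from exp_mean_ln_le[OF t[OF i] lnG[OF i] this h] show ?thesis
              using True by (simp add: r_def q_def C_def h_def del: of_nat_Suc)
          qed (simp add: r_def a_def q_def)
        qed
        also have "\<dots> \<le> (\<integral>\<omega>. (\<Prod>i\<in>A. t i \<omega>) \<partial>M)"
          unfolding t_def by (rule bounded[OF K e h(1) q_def])
        finally show ?thesis .
      qed
      thus "\<exists>N. \<forall>n\<ge>N. (\<Prod>i\<in>A. r n i) \<le> (\<integral>\<omega>. (\<Prod>i\<in>A. t i \<omega>) \<partial>M)" by blast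
    qed
    moreover have "0 \<le> a i" for i by (auto simp: a_def)
    ultimately have "(\<Prod>i\<in>A. power_mean M (p i) (t i)) \<le> ennreal (\<integral>\<omega>. (\<Prod>i\<in>A. t i \<omega>) \<partial>M)"
      using pm by (simp add: prod_ennreal ennreal_leI)
    thus ?thesis by (simp add: t_def[abs_def])
  qed
  \<comment> \<open>With \<open>K\<close> fixed, only the right side needs a limit as \<epsilon>
    tends to 0, since adding \<epsilon> can only increase the power means on the left.\<close>
  have step2: "(\<Prod>i\<in>A. power_mean M (p i) (\<lambda>\<omega>. min (g i \<omega>) K)) \<le> (\<integral>\<^sup>+\<omega>. ennreal (\<Prod>i\<in>A. g i \<omega>) \<partial>M)"
    if K: "0 < K" for K
  proof -
    have s: "(\<lambda>n. 1 / real (Suc n)) \<longlonglongrightarrow> 0" by (rule LIMSEQ_Suc[OF lim_1_over_n])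
    have "(\<lambda>n. \<integral>\<omega>. (\<Prod>i\<in>A. min (g i \<omega>) K + 1 / real (Suc n)) \<partial>M) \<longlonglongrightarrow> (\<integral>\<omega>. (\<Prod>i\<in>A. min (g i \<omega>) K + 0) \<partial>M)"
    proof (rule integral_dominated_convergence[where w = "\<lambda>_. \<Prod>i\<in>A. K + 1"])
      show "AE \<omega> in M. (\<lambda>n. \<Prod>i\<in>A. min (g i \<omega>) K + 1 / real (Suc n)) \<longlonglongrightarrow> (\<Prod>i\<in>A. min (g i \<omega>) K + 0)"
        by (intro AE_I2 tendsto_prod tendsto_add tendsto_const s)
      show "AE \<omega> in M. norm (\<Prod>i\<in>A. min (g i \<omega>) K + 1 / real (Suc n)) \<le> (\<Prod>i\<in>A. K + 1)" for n
      proof (rule AE_I2)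
        fix \<omega> assume w: "\<omega> \<in> space M"
        have n: "0 \<le> 1 / real (Suc n)" "1 / real (Suc n) \<le> 1" by auto
        have "\<bar>min (g i \<omega>) K + 1 / real (Suc n)\<bar> \<le> K + 1" if "i \<in> A" for i
        proof -
          have "0 \<le> min (g i \<omega>) K" using g0[OF that w] K by simp
          moreover have "min (g i \<omega>) K \<le> K" by simp
          ultimately show ?thesis using n by linarith
        qed
        thus "norm (\<Prod>i\<in>A. min (g i \<omega>) K + 1 / real (Suc n)) \<le> (\<Prod>i\<in>A. K + 1)"
          unfolding prod_norm[symmetric] by (intro prod_mono) auto
      qed
      show "(\<lambda>\<omega>. \<Prod>i\<in>A. min (g i \<omega>) K + 0) \<in> borel_measurable M"
        "\<And>n. (\<lambda>\<omega>. \<Prod>i\<in>A. min (g i \<omega>) K + 1 / real (Suc n)) \<in> borel_measurable M"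
        using g by measurable
    qed auto
    hence lim: "(\<lambda>n. ennreal (\<integral>\<omega>. (\<Prod>i\<in>A. min (g i \<omega>) K + 1 / real (Suc n)) \<partial>M)) \<longlonglongrightarrow> ennreal (\<integral>\<omega>. (\<Prod>i\<in>A. min (g i \<omega>) K) \<partial>M)"
      by (intro tendsto_ennrealI) simp
    have "(\<Prod>i\<in>A. power_mean M (p i) (\<lambda>\<omega>. min (g i \<omega>) K)) \<le> ennreal (\<integral>\<omega>. (\<Prod>i\<in>A. min (g i \<omega>) K + 1 / real (Suc n)) \<partial>M)" for n
    proof -
      have "(\<Prod>i\<in>A. power_mean M (p i) (\<lambda>\<omega>. min (g i \<omega>) K)) \<le> (\<Prod>i\<in>A. power_mean M (p i) (\<lambda>\<omega>. min (g i \<omega>) K + 1 / real (Suc n)))"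
        by (intro prod_mono_ennreal power_mean_mono) simp
      also have "\<dots> \<le> ennreal (\<integral>\<omega>. (\<Prod>i\<in>A. min (g i \<omega>) K + 1 / real (Suc n)) \<partial>M)" by (rule step1[OF K]) simp
      finally show ?thesis .
    qed
    hence "(\<Prod>i\<in>A. power_mean M (p i) (\<lambda>\<omega>. min (g i \<omega>) K)) \<le> ennreal (\<integral>\<omega>. (\<Prod>i\<in>A. min (g i \<omega>) K) \<partial>M)"
      by (intro LIMSEQ_le_const[OF lim]) blast
    also have "\<dots> = (\<integral>\<^sup>+\<omega>. ennreal (\<Prod>i\<in>A. min (g i \<omega>) K) \<partial>M)"
      using tb[of 0 K] K g0 by (intro nn_integral_eq_integral[symmetric] AE_I2 prod_nonneg) auto
    also have "\<dots> \<le> (\<integral>\<^sup>+\<omega>. ennreal (\<Prod>i\<in>A. g i \<omega>) \<partial>M)"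
      using g0 K by (intro nn_integral_mono ennreal_leI prod_mono) auto
    finally show ?thesis .
  qed
  show ?thesis
  \<comment> \<open>A vanishing mean makes the product 0, even against infinite factors. Otherwise
    all means are nonzero, as convergence of the truncated means and of their product
    requires.\<close>
  proof (cases "\<exists>i\<in>A. power_mean M (p i) (g i) = 0")
    case True
    hence "(\<Prod>i\<in>A. power_mean M (p i) (g i)) = 0" using A by (simp add: prod_zero_iff)
    thus ?thesis by (simp only: zero_le)
  next
    case False
    have "(\<lambda>n. \<Prod>i\<in>A. power_mean M (p i) (\<lambda>\<omega>. min (g i \<omega>) (real (Suc n)))) \<longlonglongrightarrow> (\<Prod>i\<in>A. power_mean M (p i) (g i))"
      by (intro tendsto_prod_ennreal A power_mean_truncate g g0 def) (use False in auto)
    thus ?thesis by (rule LIMSEQ_le_const2) (use step2 in auto)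
  qed
qed

end

section \<open>Gaussian vectors\<close>

text \<open>The affine image of the standard normal law covers \<sigma> = 0 as well, so moments and
  characteristic functions can be computed without separating the point masses.\<close>

lemma normal_law_eq_distr:
  assumes "0 \<le> \<sigma>"
  shows "normal_law \<nu> \<sigma> = distr std_normal_distribution borel (\<lambda>x. \<nu> + \<sigma> * x)"
proof (cases "\<sigma> = 0")
  interpret real_distribution std_normal_distribution by (rule real_dist_normal_dist)
  case True
  thus ?thesis using distr_const[of \<nu> borel] by (simp add: normal_law_def)
next
  interpret real_distribution std_normal_distribution by (rule real_dist_normal_dist)
  case False
  have "distributed std_normal_distribution lborel (\<lambda>x. x) (normal_density 0 1)"
    unfolding distributed_def by (auto intro!: distr_id2)
  from normal_density_affine[OF this, of \<sigma> \<nu>] False assms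
  have "distributed std_normal_distribution lborel (\<lambda>x. \<nu> + \<sigma> * x) (normal_density \<nu> \<sigma>)"
    by simp
  hence "distr std_normal_distribution lborel (\<lambda>x. \<nu> + \<sigma> * x) = density lborel (normal_density \<nu> \<sigma>)"
    by (rule distributed_distr_eq_density)
  moreover have "distr std_normal_distribution lborel (\<lambda>x. \<nu> + \<sigma> * x) = distr std_normal_distribution borel (\<lambda>x. \<nu> + \<sigma> * x)"
    by (rule distr_cong) auto
  ultimately show ?thesis using False by (simp add: normal_law_def)
qed

lemma normal_law_moments:
  assumes S[measurable]: "S \<in> borel_measurable M" and D: "distr M borel S = normal_law \<nu> \<sigma>" and \<sigma>: "0 \<le> \<sigma>"
  shows "integrable M S" "(\<integral>\<omega>. S \<omega> \<partial>M) = \<nu>"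
    and "\<nu> = 0 \<Longrightarrow> integrable M (\<lambda>\<omega>. \<bar>S \<omega>\<bar> ^ 3)" "\<nu> = 0 \<Longrightarrow> integrable M (\<lambda>\<omega>. (S \<omega>)\<^sup>2)"
    and "\<nu> = 0 \<Longrightarrow> (\<integral>\<omega>. (S \<omega>)\<^sup>2 \<partial>M) = \<sigma>\<^sup>2"
    and "\<nu> = 0 \<Longrightarrow> (\<integral>\<omega>. cos (S \<omega>) \<partial>M) = exp (- (\<sigma>\<^sup>2 / 2))" "\<nu> = 0 \<Longrightarrow> (\<integral>\<omega>. sin (S \<omega>) \<partial>M) = 0"
proof -
  define Q where "Q = std_normal_distribution"
  interpret N: real_distribution Q unfolding Q_def by (rule real_dist_normal_dist)
  have lin[measurable]: "(\<lambda>x. \<nu> + \<sigma> * x) \<in> borel_measurable Q" by measurable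
  have D': "distr M borel S = distr Q borel (\<lambda>x. \<nu> + \<sigma> * x)"
    unfolding D normal_law_eq_distr[OF \<sigma>] Q_def ..
  have E: "(\<integral>\<omega>. h (S \<omega>) \<partial>M) = (\<integral>x. h (\<nu> + \<sigma> * x) \<partial>Q)" if "h \<in> borel_measurable borel" for h :: "real \<Rightarrow> real"
    using integral_distr[OF S that] integral_distr[OF lin that] unfolding D' by simp
  have I: "integrable M (\<lambda>\<omega>. h (S \<omega>)) \<longleftrightarrow> integrable Q (\<lambda>x. h (\<nu> + \<sigma> * x))" if "h \<in> borel_measurable borel" for h :: "real \<Rightarrow> real"
    using integrable_distr_eq[OF S that] integrable_distr_eq[OF lin that] unfolding D' by simp
  have mom: "integrable Q (\<lambda>x. x ^ k)" for k unfolding Q_def by (rule integrable_std_normal_distribution_moment)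
  have m1: "integrable Q (\<lambda>x. x)" "(\<integral>x. x \<partial>Q) = 0"
    using mom[of 1] integral_std_normal_distribution_moment_odd[of 1, folded Q_def] by simp_all
  have m2: "(\<integral>x. x\<^sup>2 \<partial>Q) = 1"
    using std_normal_distribution_even_moments(1)[of 1, folded Q_def] by (simp add: fact_2)
  have id: "(\<lambda>x. x) \<in> borel_measurable (borel :: real measure)" by simp
  have Qc: "integrable Q (\<lambda>x. \<nu>)" "integrable Q (\<lambda>x. \<sigma> * x)" by (rule N.integrable_const, intro integrable_mult_right m1)
  show "integrable M S" unfolding I[OF id] by (rule Bochner_Integration.integrable_add[OF Qc])
  have "(\<integral>x. \<nu> + \<sigma> * x \<partial>Q) = \<nu>"
    unfolding Bochner_Integration.integral_add[OF Qc] using m1 N.prob_space by simp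
  thus "(\<integral>\<omega>. S \<omega> \<partial>M) = \<nu>" unfolding E[OF id] .
  assume \<nu>: "\<nu> = 0"
  have "integrable Q (\<lambda>x. \<sigma> ^ 3 * \<bar>x\<bar> ^ 3)"
    using integrable_abs[OF mom[of 3]] by (simp add: power_abs)
  thus "integrable M (\<lambda>\<omega>. \<bar>S \<omega>\<bar> ^ 3)"
    using I[of "\<lambda>x. \<bar>x\<bar> ^ 3"] \<nu> \<sigma> by (simp add: abs_mult power_mult_distrib)
  show "integrable M (\<lambda>\<omega>. (S \<omega>)\<^sup>2)"
    using I[of "\<lambda>x. x\<^sup>2"] \<nu> mom[of 2] by (simp add: power_mult_distrib)
  show "(\<integral>\<omega>. (S \<omega>)\<^sup>2 \<partial>M) = \<sigma>\<^sup>2"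
    using E[of "\<lambda>x. x\<^sup>2"] \<nu> m2 by (simp add: power_mult_distrib)
  have ii: "integrable Q (\<lambda>x. iexp (\<sigma> * x))"
    by (rule N.integrable_iexp) auto
  have c: "(CLINT x|Q. iexp (\<sigma> * x)) = complex_of_real (exp (- (\<sigma>\<^sup>2) / 2))"
    unfolding Q_def using fun_cong[OF char_std_normal_distribution, of \<sigma>] unfolding char_def .
  have "(\<integral>x. Re (iexp (\<sigma> * x)) \<partial>Q) = exp (- (\<sigma>\<^sup>2) / 2)"
    by (subst integral_Re[OF ii], subst c) (rule Re_complex_of_real)
  thus "(\<integral>\<omega>. cos (S \<omega>) \<partial>M) = exp (- (\<sigma>\<^sup>2 / 2))" using E[of cos] \<nu> by (simp add: Re_exp)
  have "(\<integral>x. Im (iexp (\<sigma> * x)) \<partial>Q) = 0"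
    by (subst integral_Im[OF ii], subst c) (rule Im_complex_of_real)
  thus "(\<integral>\<omega>. sin (S \<omega>) \<partial>M) = 0" using E[of sin] \<nu> by (simp add: Im_exp)
qed

text \<open>Centering forces the mean of every linear combination to be 0, so its \<sigma>^2 is its
  second moment. Unit coefficient vectors give the individual coordinates.\<close>

lemma gaussian_vector_lincomb:
  fixes Y :: "'i \<Rightarrow> 'a \<Rightarrow> real"
  assumes M: "prob_space M" and I: "finite I" and gv: "gaussian_vector M I Y" and cen: "centered M I Y"
  shows "\<And>a. a \<in> I \<Longrightarrow> Y a \<in> borel_measurable M"
    and "\<And>a. a \<in> I \<Longrightarrow> integrable M (Y a)" "\<And>a. a \<in> I \<Longrightarrow> integrable M (\<lambda>\<omega>. (Y a \<omega>)\<^sup>2)"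
    "\<And>a. a \<in> I \<Longrightarrow> integrable M (\<lambda>\<omega>. \<bar>Y a \<omega>\<bar> ^ 3)"
    and "\<And>c. (\<integral>\<omega>. cos (\<Sum>a\<in>I. c a * Y a \<omega>) \<partial>M) = exp (- ((\<integral>\<omega>. (\<Sum>a\<in>I. c a * Y a \<omega>)\<^sup>2 \<partial>M) / 2))"
    and "\<And>c. (\<integral>\<omega>. sin (\<Sum>a\<in>I. c a * Y a \<omega>) \<partial>M) = 0"
proof -
  show m[measurable]: "Y a \<in> borel_measurable M" if "a \<in> I" for a using gv that by (auto simp: gaussian_vector_def)
  have law: "\<exists>\<nu> \<sigma>. 0 \<le> \<sigma> \<and> distr M borel (\<lambda>\<omega>. \<Sum>a\<in>I. c a * Y a \<omega>) = normal_law \<nu> \<sigma>" for c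
    using gv by (auto simp: gaussian_vector_def)
  have mS: "(\<lambda>\<omega>. \<Sum>a\<in>I. c a * Y a \<omega>) \<in> borel_measurable M" for c using m by measurable
  have single: "(\<Sum>b\<in>I. (if b = a then 1 else 0) * Y b \<omega>) = Y a \<omega>" if "a \<in> I" for a \<omega>
  proof -
    have "(\<Sum>b\<in>I. (if b = a then 1 else 0) * Y b \<omega>) = (\<Sum>b\<in>I. if b = a then Y a \<omega> else 0)" by (intro sum.cong) auto
    thus ?thesis using I that by simp
  qed
  have Ya: "integrable M (Y a) \<and> integrable M (\<lambda>\<omega>. (Y a \<omega>)\<^sup>2) \<and> integrable M (\<lambda>\<omega>. \<bar>Y a \<omega>\<bar> ^ 3)" if a: "a \<in> I" for a
  proof -
    obtain \<nu> \<sigma> where s: "0 \<le> \<sigma>" "distr M borel (Y a) = normal_law \<nu> \<sigma>"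
      using law[of "\<lambda>b. if b = a then 1 else 0"] unfolding single[OF a] by blast
    have "(\<integral>\<omega>. Y a \<omega> \<partial>M) = 0" using cen a by (simp add: centered_def)
    hence "\<nu> = 0" using normal_law_moments(2)[OF m[OF a] s(2,1)] by simp
    thus ?thesis using normal_law_moments(1,3,4)[OF m[OF a] s(2,1)] by simp
  qed
  show "integrable M (Y a)" "integrable M (\<lambda>\<omega>. (Y a \<omega>)\<^sup>2)" "integrable M (\<lambda>\<omega>. \<bar>Y a \<omega>\<bar> ^ 3)" if "a \<in> I" for a
    using Ya[OF that] by auto
  fix c
  obtain \<nu> \<sigma> where s: "0 \<le> \<sigma>" "distr M borel (\<lambda>\<omega>. \<Sum>a\<in>I. c a * Y a \<omega>) = normal_law \<nu> \<sigma>" using law by blast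
  have "(\<integral>\<omega>. (\<Sum>a\<in>I. c a * Y a \<omega>) \<partial>M) = (\<Sum>a\<in>I. c a * (\<integral>\<omega>. Y a \<omega> \<partial>M))"
    using Ya by (simp add: Bochner_Integration.integral_sum)
  also have "\<dots> = 0" using cen by (simp add: centered_def)
  finally have \<nu>: "\<nu> = 0" using normal_law_moments(2)[OF mS s(2,1)] by simp
  show "(\<integral>\<omega>. cos (\<Sum>a\<in>I. c a * Y a \<omega>) \<partial>M) = exp (- ((\<integral>\<omega>. (\<Sum>a\<in>I. c a * Y a \<omega>)\<^sup>2 \<partial>M) / 2))"
    using normal_law_moments(5,6)[OF mS s(2,1) \<nu>] by simp
  show "(\<integral>\<omega>. sin (\<Sum>a\<in>I. c a * Y a \<omega>) \<partial>M) = 0"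
    using normal_law_moments(7)[OF mS s(2,1) \<nu>] .
qed

text \<open>Coordinates outside \<open>I\<close> are set to zero, so that vectors of every dimension live in the same space
  of total functions.\<close>

definition law_on :: "'a measure \<Rightarrow> 'i set \<Rightarrow> ('i \<Rightarrow> 'a \<Rightarrow> real) \<Rightarrow> ('i \<Rightarrow> real) measure" where
  "law_on M I Y = distr M coords (\<lambda>\<omega> c. if c \<in> I then Y c \<omega> else 0)"

lemma law_on_measurable:
  assumes "\<And>a. a \<in> I \<Longrightarrow> Y a \<in> borel_measurable M"
  shows "(\<lambda>\<omega> c. if c \<in> I then Y c \<omega> else 0) \<in> M \<rightarrow>\<^sub>M coords"
proof (rule measurable_PiM_single')
  fix c show "(\<lambda>\<omega>. if c \<in> I then Y c \<omega> else 0) \<in> borel_measurable M"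
    using assms by (cases "c \<in> I") auto
qed auto

text \<open>Half the variance of a linear form is quadratic in the coefficients and serves as the
  exponent \<open>v\<close>. Coordinates outside \<open>I\<close> vanish, so a form over any finite
  \<open>J\<close> reduces to one over \<open>I\<close>.\<close>

lemma gaussian_stable_law:
  fixes Y :: "'i \<Rightarrow> 'a \<Rightarrow> real"
  assumes M: "prob_space M" and I: "finite I" and gv: "gaussian_vector M I Y" and cen: "centered M I Y"
  shows "stable_law (law_on M I Y) I"
proof -
  note G = gaussian_vector_lincomb[OF assms]
  interpret prob_space M by (rule M)
  have mp: "(\<lambda>\<omega> c. if c \<in> I then Y c \<omega> else 0) \<in> M \<rightarrow>\<^sub>M coords" by (rule law_on_measurable[OF G(1)])
  have E: "(\<integral>x. h x \<partial>law_on M I Y) = (\<integral>\<omega>. h (\<lambda>c. if c \<in> I then Y c \<omega> else 0) \<partial>M)"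
    if "h \<in> borel_measurable coords" for h :: "('i \<Rightarrow> real) \<Rightarrow> real"
    unfolding law_on_def by (rule integral_distr[OF mp that])
  have ps: "prob_space (law_on M I Y)" unfolding law_on_def by (rule prob_space_distr[OF mp])
  have sm: "(\<Sum>a\<in>J. c a * (if a \<in> I then Y a \<omega> else 0)) = (\<Sum>a\<in>I. (if a \<in> J then c a else 0) * Y a \<omega>)"
    if J: "finite J" for J c \<omega>
  proof -
    have "(\<Sum>a\<in>J. c a * (if a \<in> I then Y a \<omega> else 0)) = (\<Sum>a\<in>J. if a \<in> I then c a * Y a \<omega> else 0)" by (intro sum.cong) auto
    also have "\<dots> = (\<Sum>a\<in>J \<inter> I. c a * Y a \<omega>)" using J by (simp add: sum.inter_restrict)
    also have "\<dots> = (\<Sum>a\<in>I \<inter> J. c a * Y a \<omega>)" by (simp add: Int_commute)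
    also have "\<dots> = (\<Sum>a\<in>I. if a \<in> J then c a * Y a \<omega> else 0)" using I by (simp add: sum.inter_restrict)
    also have "\<dots> = (\<Sum>a\<in>I. (if a \<in> J then c a else 0) * Y a \<omega>)" by (intro sum.cong) auto
    finally show ?thesis .
  qed
  define v where "v J c = (\<integral>\<omega>. (\<Sum>a\<in>I. (if a \<in> J then c a else 0) * Y a \<omega>)\<^sup>2 \<partial>M) / 2" for J c
  show ?thesis
  proof (intro stable_law.intro coords_prob_space.intro coords_prob_space_axioms.intro stable_law_axioms.intro ps)
    show "sets (law_on M I Y) = sets coords" by (simp add: law_on_def)
    show "finite I" by (rule I)
    fix s t :: real assume st: "0 \<le> s" "0 \<le> t"
    show "distr (law_on M I Y \<Otimes>\<^sub>M law_on M I Y) coords (\<lambda>(x, y) c. sqrt s * x c + sqrt t * y c)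
      = distr (law_on M I Y) coords (\<lambda>x c. sqrt (s + t) * x c)"
    proof (rule gaussian_char_stable[OF ps _ _ _ _ st, where v = v])
      fix J :: "'i set" and c assume J: "finite J"
      show "(\<integral>x. cos (\<Sum>a\<in>J. c a * x a) \<partial>law_on M I Y) = exp (- v J c)"
        by (subst E) (simp_all add: sm[OF J] G(5) v_def)
      show "(\<integral>x. sin (\<Sum>a\<in>J. c a * x a) \<partial>law_on M I Y) = 0"
        by (subst E) (simp_all add: sm[OF J] G(6))
      fix s :: real
      have "(\<Sum>a\<in>I. (if a \<in> J then s * c a else 0) * Y a \<omega>) = s * (\<Sum>a\<in>I. (if a \<in> J then c a else 0) * Y a \<omega>)" for \<omega>
        unfolding sum_distrib_left by (intro sum.cong) auto
      thus "v J (\<lambda>a. s * c a) = s\<^sup>2 * v J c" by (simp add: v_def power_mult_distrib)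
    qed (simp add: law_on_def)
  next
    fix c assume c: "c \<in> I"
    show "(\<integral>x. x c \<partial>law_on M I Y) = 0" using c cen by (subst E) (auto simp: centered_def)
    have "(\<lambda>x. \<bar>x c\<bar> ^ 3) \<in> borel_measurable coords" by measurable
    from integrable_distr_eq[OF mp this] show "integrable (law_on M I Y) (\<lambda>x. \<bar>x c\<bar> ^ 3)"
      using G(4)[OF c] c by (simp add: law_on_def)
  qed
qed

text \<open>Translates the matrix hypotheses into second moments of linear forms, for single blocks
  as well as for the whole vector. Products of coordinates are integrable by |x y| <= x^2 +
  y^2.\<close>

lemma covariance_quadratic_form:
  assumes M: "prob_space M" and I: "finite I" and gv: "gaussian_vector M I Y" and cen: "centered M I Y" and J: "J \<subseteq> I"
  shows "(\<integral>\<omega>. (\<Sum>a\<in>J. v a * Y a \<omega>)\<^sup>2 \<partial>M) = (\<Sum>a\<in>J. \<Sum>b\<in>J. v a * covariance_matrix M Y a b * v b)"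
proof -
  note G = gaussian_vector_lincomb[OF M I gv cen]
  have T: "covariance_matrix M Y a b = (\<integral>\<omega>. Y a \<omega> * Y b \<omega> \<partial>M)" if "a \<in> I" "b \<in> I" for a b
    using cen that by (simp add: covariance_matrix_def centered_def)
  have int: "integrable M (\<lambda>\<omega>. Y a \<omega> * Y b \<omega>)" if ab: "a \<in> I" "b \<in> I" for a b
  proof (rule Bochner_Integration.integrable_bound)
    show "integrable M (\<lambda>\<omega>. (Y a \<omega>)\<^sup>2 + (Y b \<omega>)\<^sup>2)" using G(3) ab by simp
    show "(\<lambda>\<omega>. Y a \<omega> * Y b \<omega>) \<in> borel_measurable M" using G(1)[OF ab(1)] G(1)[OF ab(2)] by measurable
    have "\<bar>x * y\<bar> \<le> x\<^sup>2 + y\<^sup>2" for x y :: real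
    proof -
      have "0 \<le> (\<bar>x\<bar> - \<bar>y\<bar>)\<^sup>2" by simp
      hence "2 * (\<bar>x\<bar> * \<bar>y\<bar>) \<le> x\<^sup>2 + y\<^sup>2" by (simp add: power2_diff)
      moreover have "0 \<le> \<bar>x\<bar> * \<bar>y\<bar>" by simp
      ultimately show ?thesis unfolding abs_mult by linarith
    qed
    thus "AE \<omega> in M. norm (Y a \<omega> * Y b \<omega>) \<le> norm ((Y a \<omega>)\<^sup>2 + (Y b \<omega>)\<^sup>2)" by (intro AE_I2) simp
  qed
  have int': "integrable M (\<lambda>\<omega>. v a * v b * (Y a \<omega> * Y b \<omega>))" if "a \<in> J" "b \<in> J" for a b
    using that J by (intro integrable_mult_right int) auto
  have "(\<integral>\<omega>. (\<Sum>a\<in>J. v a * Y a \<omega>)\<^sup>2 \<partial>M) = (\<integral>\<omega>. (\<Sum>a\<in>J. \<Sum>b\<in>J. v a * v b * (Y a \<omega> * Y b \<omega>)) \<partial>M)"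
    by (simp add: power2_eq_square sum_product mult_ac)
  also have "\<dots> = (\<Sum>a\<in>J. \<integral>\<omega>. (\<Sum>b\<in>J. v a * v b * (Y a \<omega> * Y b \<omega>)) \<partial>M)"
    by (rule Bochner_Integration.integral_sum) (intro Bochner_Integration.integrable_sum int')
  also have "\<dots> = (\<Sum>a\<in>J. \<Sum>b\<in>J. \<integral>\<omega>. v a * v b * (Y a \<omega> * Y b \<omega>) \<partial>M)"
    by (intro sum.cong refl Bochner_Integration.integral_sum int')
  also have "\<dots> = (\<Sum>a\<in>J. \<Sum>b\<in>J. v a * v b * (\<integral>\<omega>. Y a \<omega> * Y b \<omega> \<partial>M))" by simp
  also have "\<dots> = (\<Sum>a\<in>J. \<Sum>b\<in>J. v a * covariance_matrix M Y a b * v b)"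
    using J by (intro sum.cong refl) (auto simp: T subset_iff)
  finally show ?thesis .
qed

text \<open>A row of a block diagonal matrix meets only its own block, so the form of P becomes the
  weighted sum of block variances that the semigroup inequality involves.\<close>

lemma sum_block_diag:
  "(\<Sum>a\<in>block_index m n. \<Sum>b\<in>block_index m n. v a * block_diag (\<lambda>i k l. q i * block T i i k l) a b * v b)
   = (\<Sum>i<m. q i * (\<Sum>a\<in>{i} \<times> {..<n i}. \<Sum>b\<in>{i} \<times> {..<n i}. v a * T a b * v b))"
proof -
  have row: "(\<Sum>b\<in>block_index m n. v (i, k) * block_diag (\<lambda>i k l. q i * block T i i k l) (i, k) b * v b)
     = (\<Sum>l<n i. q i * (v (i, k) * T (i, k) (i, l) * v (i, l)))" if "i < m" for i k
  proof -
    have "(\<Sum>b\<in>block_index m n. v (i, k) * block_diag (\<lambda>i k l. q i * block T i i k l) (i, k) b * v b)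
      = (\<Sum>j<m. \<Sum>l<n j. v (i, k) * block_diag (\<lambda>i k l. q i * block T i i k l) (i, k) (j, l) * v (j, l))"
      unfolding block_index_def by (subst sum.Sigma) (auto simp: split_beta')
    also have "\<dots> = (\<Sum>j<m. if j = i then (\<Sum>l<n i. q i * (v (i, k) * T (i, k) (i, l) * v (i, l))) else 0)"
      by (intro sum.cong) (auto simp: block_diag_def block_def intro!: sum.cong)
    also have "\<dots> = (\<Sum>l<n i. q i * (v (i, k) * T (i, k) (i, l) * v (i, l)))" using that by simp
    finally show ?thesis .
  qed
  have single: "(\<Sum>a\<in>{i} \<times> {..<n i}. h a) = (\<Sum>k<n i. h (i, k))" for i :: nat and h :: "nat \<times> nat \<Rightarrow> real"
    by (rule sum.reindex_bij_witness[of _ "Pair i" snd]) auto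
  have "(\<Sum>a\<in>block_index m n. \<Sum>b\<in>block_index m n. v a * block_diag (\<lambda>i k l. q i * block T i i k l) a b * v b)
    = (\<Sum>i<m. \<Sum>k<n i. \<Sum>b\<in>block_index m n. v (i, k) * block_diag (\<lambda>i k l. q i * block T i i k l) (i, k) b * v b)"
    by (subst (1) block_index_def) (subst sum.Sigma, auto simp: split_beta')
  also have "\<dots> = (\<Sum>i<m. \<Sum>k<n i. \<Sum>l<n i. q i * (v (i, k) * T (i, k) (i, l) * v (i, l)))"
    by (intro sum.cong refl row) auto
  also have "\<dots> = (\<Sum>i<m. q i * (\<Sum>a\<in>{i} \<times> {..<n i}. \<Sum>b\<in>{i} \<times> {..<n i}. v a * T a b * v b))"
    unfolding single by (simp add: sum_distrib_left)
  finally show ?thesis .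
qed

text \<open>The semigroup inequality is applied to F_i = h_i powr q_i, whose power 1 / q_i returns
  h_i. The bounds on h_i keep F_i between positive constants for either sign of q_i.\<close>

lemma gaussian_bounded_inequality:
  fixes X :: "nat \<Rightarrow> 'a \<Rightarrow> nat \<Rightarrow> real" and h :: "nat \<Rightarrow> (nat \<Rightarrow> real) \<Rightarrow> real"
  assumes M: "prob_space M"
    and X: "\<And>i. i < m \<Longrightarrow> X i \<in> M \<rightarrow>\<^sub>M (\<Pi>\<^sub>M k\<in>{..<n i}. borel)"
    and gv: "gaussian_vector M (block_index m n) (joint_vector X)"
    and cen: "centered M (block_index m n) (joint_vector X)"
    and T: "T = covariance_matrix M (joint_vector X)"
    and q: "\<And>i. i < m \<Longrightarrow> q i \<noteq> 0" and \<sigma>: "\<bar>\<sigma>\<bar> = 1"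
    and cov: "\<And>v. \<sigma> * (\<Sum>a\<in>block_index m n. \<Sum>b\<in>block_index m n.
       v a * (T a b - block_diag (\<lambda>i k l. q i * block T i i k l) a b) * v b) \<le> 0"
    and h: "\<And>i. i < m \<Longrightarrow> h i \<in> borel_measurable (\<Pi>\<^sub>M k\<in>{..<n i}. borel)"
    and lo: "0 < lo" and hb: "\<And>i x. i < m \<Longrightarrow> x \<in> space (\<Pi>\<^sub>M k\<in>{..<n i}. (borel :: real measure)) \<Longrightarrow> lo \<le> h i x \<and> h i x \<le> hi"
  shows "\<sigma> * ((\<integral>\<omega>. (\<Prod>i<m. h i (X i \<omega>)) \<partial>M) - (\<Prod>i<m. (\<integral>\<omega>. h i (X i \<omega>) powr q i \<partial>M) powr (1 / q i))) \<le> 0"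
proof (cases "m = 0")
  case True
  interpret prob_space M by (rule M)
  show ?thesis using True by (simp add: prob_space)
next
  case m0: False
  define I where "I = block_index m n"
  define Y where "Y = joint_vector X"
  define J where "J i = {i} \<times> {..<n i}" for i
  have I: "finite I" by (simp add: I_def block_index_def)
  have JI: "J i \<subseteq> I" if "i < m" for i using that by (auto simp: J_def I_def block_index_def)
  note gv' = gv[folded I_def Y_def] and cen' = cen[folded I_def Y_def]
  interpret L: stable_law "law_on M I Y" I by (rule gaussian_stable_law[OF M I gv' cen'])
  have Ym: "Y a \<in> borel_measurable M" if "a \<in> I" for a using gaussian_vector_lincomb(1)[OF M I gv' cen' that] .
  define y where "y \<omega> c = (if c \<in> I then Y c \<omega> else 0)" for \<omega> c
  have ym: "y \<in> M \<rightarrow>\<^sub>M coords" unfolding y_def[abs_def] by (rule law_on_measurable[OF Ym])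
  have E: "(\<integral>x. g x \<partial>law_on M I Y) = (\<integral>\<omega>. g (y \<omega>) \<partial>M)" if "g \<in> borel_measurable coords" for g :: "_ \<Rightarrow> real"
    unfolding law_on_def y_def[symmetric, abs_def] by (rule integral_distr[OF ym that])
  have quad: "(\<integral>x. (\<Sum>a\<in>K. v a * x a)\<^sup>2 \<partial>law_on M I Y) = (\<Sum>a\<in>K. \<Sum>b\<in>K. v a * T a b * v b)" if "K \<subseteq> I" for K v
  proof -
    have "(\<integral>x. (\<Sum>a\<in>K. v a * x a)\<^sup>2 \<partial>law_on M I Y) = (\<integral>\<omega>. (\<Sum>a\<in>K. v a * Y a \<omega>)\<^sup>2 \<partial>M)"
      using that by (subst E) (auto simp: y_def subset_iff intro!: Bochner_Integration.integral_cong sum.cong arg_cong[where f = "\<lambda>x. x\<^sup>2"])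
    also have "\<dots> = (\<Sum>a\<in>K. \<Sum>b\<in>K. v a * T a b * v b)"
      unfolding T Y_def[symmetric] by (rule covariance_quadratic_form[OF M I gv' cen' that])
    finally show ?thesis .
  qed
  define F where "F i z = h i (\<lambda>k\<in>{..<n i}. z (i, k)) powr q i" for i and z :: "nat \<times> nat \<Rightarrow> real"
  have proj: "(\<lambda>z. \<lambda>k\<in>{..<n i}. z (i, k)) \<in> PiM (J i) (\<lambda>_. borel :: real measure) \<rightarrow>\<^sub>M (\<Pi>\<^sub>M k\<in>{..<n i}. borel)" for i
    by (rule measurable_restrict) (auto simp: J_def)
  have Fm: "F i \<in> borel_measurable (PiM (J i) (\<lambda>_. borel))" if "i < m" for i
    unfolding F_def[abs_def] using measurable_compose[OF proj h[OF that]] by measurable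
  have hb': "lo \<le> h i (\<lambda>k\<in>{..<n i}. z (i, k))" "h i (\<lambda>k\<in>{..<n i}. z (i, k)) \<le> hi" if "i < m" for i and z :: "nat \<times> nat \<Rightarrow> real"
    using hb[OF that] by (auto simp: space_PiM)
  have lohi: "lo \<le> hi" using hb'[of 0 "\<lambda>_. 0"] m0 by linarith
  \<comment> \<open>Both endpoints are needed because a negative exponent reverses them. The minimum
    is positive, being taken over a nonempty finite set of positive numbers.\<close>
  define lo' where "lo' = Min ((\<lambda>i. min (lo powr q i) (hi powr q i)) ` {..<m})"
  define hi' where "hi' = (\<Sum>i<m. lo powr q i + hi powr q i)"
  have lo': "0 < lo'" unfolding lo'_def using m0 lo lohi by (subst Min_gr_iff) auto
  have Fb: "lo' \<le> F i z \<and> F i z \<le> hi'" if i: "i < m" for i z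
  proof
    have "lo' \<le> min (lo powr q i) (hi powr q i)" unfolding lo'_def using i by (intro Min_le) auto
    also have "\<dots> \<le> F i z"
    proof (cases "0 \<le> q i")
      case True
      hence "lo powr q i \<le> F i z" unfolding F_def using hb'[OF i] lo by (intro powr_mono2) auto
      thus ?thesis by simp
    next
      case False
      hence "hi powr q i \<le> F i z" unfolding F_def using hb'[OF i] lo by (intro powr_mono2') (auto intro: less_le_trans)
      thus ?thesis by simp
    qed
    finally show "lo' \<le> F i z" .
    have "F i z \<le> lo powr q i + hi powr q i" unfolding F_def by (rule powr_le_sum[OF lo hb'[OF i]])
    also have "\<dots> \<le> hi'" unfolding hi'_def using i by (intro member_le_sum) auto
    finally show "F i z \<le> hi'" .
  qed
  have main: "\<sigma> * ((\<integral>x. (\<Prod>i<m. F i (restrict x (J i)) powr (1 / q i)) \<partial>law_on M I Y)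
     - (\<Prod>i<m. (\<integral>x. F i (restrict x (J i)) \<partial>law_on M I Y) powr (1 / q i))) \<le> 0"
  proof (rule L.bounded_inequality[OF _ _ _ lo' \<sigma>, where hi = hi'])
    fix b :: "nat \<Rightarrow> nat \<times> nat \<Rightarrow> real"
    \<comment> \<open>The block vectors b_i are glued into one vector over all coordinates, on which
      the matrix hypothesis is tested.\<close>
    define v where "v a = b (fst a) a" for a
    have "(\<Sum>i<m. \<Sum>c\<in>J i. b i c * x c) = (\<Sum>a\<in>I. v a * x a)" for x :: "nat \<times> nat \<Rightarrow> real"
    proof -
      have "(\<Sum>c\<in>J i. b i c * x c) = (\<Sum>k<n i. v (i, k) * x (i, k))" for i
        unfolding J_def by (rule sum.reindex_bij_witness[of _ "Pair i" snd]) (auto simp: v_def)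
      moreover have "(\<Sum>a\<in>I. v a * x a) = (\<Sum>i<m. \<Sum>k<n i. v (i, k) * x (i, k))"
        unfolding I_def block_index_def by (subst sum.Sigma) (auto simp: split_beta')
      ultimately show ?thesis by simp
    qed
    hence e1: "(\<integral>x. (\<Sum>i<m. \<Sum>c\<in>J i. b i c * x c)\<^sup>2 \<partial>law_on M I Y) = (\<Sum>a\<in>I. \<Sum>b\<in>I. v a * T a b * v b)"
      by (simp add: quad)
    have e2: "(\<integral>x. (\<Sum>c\<in>J i. b i c * x c)\<^sup>2 \<partial>law_on M I Y) = (\<Sum>a\<in>J i. \<Sum>c\<in>J i. v a * T a c * v c)" if "i < m" for i
    proof -
      have "(\<Sum>c\<in>J i. b i c * x c) = (\<Sum>c\<in>J i. v c * x c)" for x :: "nat \<times> nat \<Rightarrow> real"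
        by (intro sum.cong) (auto simp: J_def v_def)
      thus ?thesis using quad[OF JI[OF that]] by simp
    qed
    have "(\<Sum>a\<in>I. \<Sum>b\<in>I. v a * T a b * v b) - (\<Sum>i<m. q i * (\<Sum>a\<in>J i. \<Sum>c\<in>J i. v a * T a c * v c))
      = (\<Sum>a\<in>I. \<Sum>b\<in>I. v a * (T a b - block_diag (\<lambda>i k l. q i * block T i i k l) a b) * v b)"
      unfolding J_def sum_block_diag[symmetric] I_def
      by (simp add: sum_subtractf[symmetric] algebra_simps)
    thus "\<sigma> * ((\<integral>x. (\<Sum>i<m. \<Sum>c\<in>J i. b i c * x c)\<^sup>2 \<partial>law_on M I Y)
       - (\<Sum>i<m. q i * (\<integral>x. (\<Sum>c\<in>J i. b i c * x c)\<^sup>2 \<partial>law_on M I Y))) \<le> 0"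
      using cov[of v] e1 e2 by (simp add: I_def)
  qed (use JI q Fm Fb in auto)
  \<comment> \<open>Elements of the product space are extensional, so reading the coordinates of
    block \<open>i\<close> back recovers X_i exactly.\<close>
  have rX: "(\<lambda>k\<in>{..<n i}. restrict (y \<omega>) (J i) (i, k)) = X i \<omega>" if "i < m" "\<omega> \<in> space M" for i \<omega>
  proof -
    have "X i \<omega> \<in> space (\<Pi>\<^sub>M k\<in>{..<n i}. borel)" using X[OF that(1)] that(2) by (rule measurable_space)
    hence "X i \<omega> \<in> extensional {..<n i}" by (simp add: space_PiM PiE_def)
    thus ?thesis using that
      by (auto simp: fun_eq_iff y_def Y_def joint_vector_def J_def I_def block_index_def extensional_def)
  qed
  have FX: "F i (restrict (y \<omega>) (J i)) = h i (X i \<omega>) powr q i" if "i < m" "\<omega> \<in> space M" for i \<omega>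
    unfolding F_def rX[OF that] ..
  have hX: "0 < h i (X i \<omega>)" if "i < m" "\<omega> \<in> space M" for i \<omega>
    using hb[OF that(1) measurable_space[OF X[OF that(1)] that(2)]] lo by linarith
  have Frm: "(\<lambda>x. F i (restrict x (J i))) \<in> borel_measurable coords" if "i < m" for i
    by (rule measurable_compose[OF _ Fm[OF that]]) (rule measurable_restrict_subset, simp)
  have i1: "(\<integral>x. F i (restrict x (J i)) \<partial>law_on M I Y) = (\<integral>\<omega>. h i (X i \<omega>) powr q i \<partial>M)" if "i < m" for i
    unfolding E[OF Frm[OF that]] by (rule Bochner_Integration.integral_cong) (use FX that in auto)
  have pm: "(\<lambda>x. \<Prod>i<m. F i (restrict x (J i)) powr (1 / q i)) \<in> borel_measurable coords"
    using Frm by measurable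
  have i2: "(\<integral>x. (\<Prod>i<m. F i (restrict x (J i)) powr (1 / q i)) \<partial>law_on M I Y) = (\<integral>\<omega>. (\<Prod>i<m. h i (X i \<omega>)) \<partial>M)"
    unfolding E[OF pm]
  proof (rule Bochner_Integration.integral_cong[OF refl], rule prod.cong[OF refl])
    fix \<omega> i assume w: "\<omega> \<in> space M" "i \<in> {..<m}"
    hence i: "i < m" by simp
    show "F i (restrict (y \<omega>) (J i)) powr (1 / q i) = h i (X i \<omega>)"
      using hX[OF i w(1)] q[OF i] by (simp add: FX[OF i w(1)] powr_powr)
  qed
  show ?thesis using main i1 unfolding i2 by simp
qed

text \<open>Both directions reduce to the inequality for min (f_i, K) + \<epsilon>, with \<sigma> =
  1 for T <= P and \<sigma> = -1 for T >= P, once the exponents are nonzero. For T <= P this is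
  achieved without changing P, for T >= P by lowering it.\<close>

theorem theorem1:
  fixes M :: "'a measure"
    and m :: nat and n :: "nat \<Rightarrow> nat" and p :: "nat \<Rightarrow> real"
    and X :: "nat \<Rightarrow> 'a \<Rightarrow> (nat \<Rightarrow> real)"
    and T P :: "nat \<times> nat \<Rightarrow> nat \<times> nat \<Rightarrow> real"
    and f :: "nat \<Rightarrow> (nat \<Rightarrow> real) \<Rightarrow> real"
  assumes "prob_space M"
    and "m > 0" and "\<And>i. i < m \<Longrightarrow> n i > 0"
    and "\<And>i. i < m \<Longrightarrow> X i \<in> M \<rightarrow>\<^sub>M (\<Pi>\<^sub>M k\<in>{..<n i}. borel)"
    and "gaussian_vector M (block_index m n) (joint_vector X)"
    and "centered M (block_index m n) (joint_vector X)"
    and "T = covariance_matrix M (joint_vector X)"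
    and "P = block_diag (\<lambda>i k l. p i * block T i i k l)"
    and "\<And>i. i < m \<Longrightarrow> f i \<in> borel_measurable (\<Pi>\<^sub>M k\<in>{..<n i}. borel)"
    and "\<And>i x. i < m \<Longrightarrow> x \<in> space (\<Pi>\<^sub>M k\<in>{..<n i}. (borel :: real measure)) \<Longrightarrow> f i x \<ge> 0"
    and "\<And>i. i < m \<Longrightarrow> p i = 0 \<Longrightarrow> eexpectation_defined M (\<lambda>\<omega>. elog (f i (X i \<omega>)))"
  shows "(matrix_le_on (block_index m n) T P \<longrightarrow>
            (\<integral>\<^sup>+\<omega>. ennreal (\<Prod>i<m. f i (X i \<omega>)) \<partial>M) \<le> (\<Prod>i<m. power_mean M (p i) (\<lambda>\<omega>. f i (X i \<omega>))))
       \<and> (matrix_le_on (block_index m n) P T \<longrightarrow>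
            (\<integral>\<^sup>+\<omega>. ennreal (\<Prod>i<m. f i (X i \<omega>)) \<partial>M) \<ge> (\<Prod>i<m. power_mean M (p i) (\<lambda>\<omega>. f i (X i \<omega>))))"
proof -
  note M = assms(1) and X = assms(4) and gv = assms(5) and cen = assms(6) and T = assms(7) and P = assms(8)
    and f = assms(9) and f0 = assms(10) and def = assms(11)
  interpret prob_space M by (rule M)
  define I where "I = block_index m n"
  have I: "finite I" by (simp add: I_def block_index_def)
  define Q where "Q q = block_diag (\<lambda>i k l. q i * block T i i k l)" for q
  have Q: "Q q (i, k) (j, l) = (if i = j then q i * T (i, k) (i, l) else 0)" for q i k j l
    by (simp add: Q_def block_diag_def block_def)
  have PQ: "P = Q p" by (simp add: P Q_def)
  have quad: "(\<integral>\<omega>. (\<Sum>a\<in>K. v a * joint_vector X a \<omega>)\<^sup>2 \<partial>M) = (\<Sum>a\<in>K. \<Sum>b\<in>K. v a * T a b * v b)" if "K \<subseteq> I" for K v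
    unfolding T by (rule covariance_quadratic_form[OF M I gv[folded I_def] cen[folded I_def] that])
  have Tdiag: "T a a = (\<integral>\<omega>. (joint_vector X a \<omega>)\<^sup>2 \<partial>M)" if "a \<in> I" for a
    using quad[of "{a}" "\<lambda>_. 1"] that by simp
  have fX: "f i (X i \<omega>) \<ge> 0" if "i < m" "\<omega> \<in> space M" for i \<omega>
    using f0[OF that(1) measurable_space[OF X[OF that(1)] that(2)]] .
  have gm: "(\<lambda>\<omega>. f i (X i \<omega>)) \<in> borel_measurable M" if "i < m" for i
    by (rule measurable_compose[OF X[OF that] f[OF that]])
  have bdd: "\<sigma> * ((\<integral>\<omega>. (\<Prod>i<m. min (f i (X i \<omega>)) K + \<epsilon>) \<partial>M)
      - (\<Prod>i<m. (\<integral>\<omega>. (min (f i (X i \<omega>)) K + \<epsilon>) powr q i \<partial>M) powr (1 / q i))) \<le> 0"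
    if q: "\<And>i. i < m \<Longrightarrow> q i \<noteq> 0" and \<sigma>: "\<bar>\<sigma>\<bar> = 1" and K: "0 < K" "0 < \<epsilon>"
      and cov: "\<And>v. \<sigma> * (\<Sum>a\<in>I. \<Sum>b\<in>I. v a * (T a b - Q q a b) * v b) \<le> 0" for q \<sigma> K \<epsilon>
  proof (rule gaussian_bounded_inequality[OF M X gv cen T q \<sigma>, where h = "\<lambda>i x. min (f i x) K + \<epsilon>" and lo = \<epsilon> and hi = "K + \<epsilon>"])
    show "\<sigma> * (\<Sum>a\<in>block_index m n. \<Sum>b\<in>block_index m n.
       v a * (T a b - block_diag (\<lambda>i k l. q i * block T i i k l) a b) * v b) \<le> 0" for v
      using cov[of v] by (simp add: I_def Q_def)
    show "(\<lambda>x. min (f i x) K + \<epsilon>) \<in> borel_measurable (\<Pi>\<^sub>M k\<in>{..<n i}. borel)" if "i < m" for i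
      using f[OF that] by measurable
    show "\<epsilon> \<le> min (f i x) K + \<epsilon> \<and> min (f i x) K + \<epsilon> \<le> K + \<epsilon>"
      if "i < m" "x \<in> space (\<Pi>\<^sub>M k\<in>{..<n i}. (borel :: real measure))" for i x
      using f0[OF that] K by simp
  qed (use K in auto)
  show ?thesis
  proof (intro conjI impI)
    assume le: "matrix_le_on (block_index m n) T P"
    have psd: "0 \<le> (\<Sum>a\<in>I. \<Sum>b\<in>I. v a * (Q p a b - T a b) * v b)" for v
      using le unfolding matrix_le_on_def psd_on_def I_def PQ by blast
    \<comment> \<open>If \<open>T\<^sub>i\<^sub>i = 0\<close> then \<open>f i (X i)\<close> is almost surely constant and its exponent is irrelevant;
      otherwise \<open>T \<le> P\<close> forces \<open>p i \<ge> 1\<close>.\<close>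
    define p' where "p' i = (if \<forall>k<n i. T (i, k) (i, k) = 0 then 1 else p i)" for i
    have zero: "AE \<omega> in M. joint_vector X a \<omega> = 0" if "a \<in> I" "T a a = 0" for a
    proof -
      note G = gaussian_vector_lincomb[OF M I gv[folded I_def] cen[folded I_def]]
      have "(\<integral>\<omega>. (joint_vector X a \<omega>)\<^sup>2 \<partial>M) = 0" using Tdiag[OF that(1)] that(2) by simp
      hence "AE \<omega> in M. (joint_vector X a \<omega>)\<^sup>2 = 0"
        by (subst (asm) integral_nonneg_eq_0_iff_AE) (use G(3)[OF that(1)] in auto)
      thus ?thesis by simp
    qed
    \<comment> \<open>A coordinate of variance zero vanishes almost surely and so do its
      covariances; a block with zero diagonal is therefore zero altogether.\<close>
    have off: "T (i, k) (i, l) = 0" if "i < m" "k < n i" "l < n i" "T (i, k) (i, k) = 0" for i k l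
    proof -
      have "(i, k) \<in> I" "(i, l) \<in> I" using that by (auto simp: I_def block_index_def)
      hence "T (i, k) (i, l) = (\<integral>\<omega>. joint_vector X (i, k) \<omega> * joint_vector X (i, l) \<omega> \<partial>M)"
        using cen by (simp add: T covariance_matrix_def centered_def I_def)
      also have "\<dots> = 0"
        using zero[OF \<open>(i, k) \<in> I\<close> that(4)] by (intro integral_eq_zero_AE) (auto elim!: eventually_mono)
      finally show ?thesis .
    qed
    \<comment> \<open>The exponent is changed only where it multiplies a zero block.\<close>
    have Qeq: "Q p' a b = Q p a b" if "a \<in> I" "b \<in> I" for a b
    proof -
      obtain i k j l where ab: "a = (i, k)" "b = (j, l)" using surj_pair[of a] surj_pair[of b] by blast
      have ik: "i < m" "k < n i" "l < n j" using that by (auto simp: ab I_def block_index_def)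
      show ?thesis
      proof (cases "i = j \<and> (\<forall>k<n i. T (i, k) (i, k) = 0)")
        case True
        have "T (i, k) (i, l) = 0" by (rule off[OF ik(1,2)]) (use ik True in auto)
        thus ?thesis using True by (simp add: ab Q)
      next
        case False
        hence "i = j \<Longrightarrow> p' i = p i" unfolding p'_def by (intro if_not_P) blast
        thus ?thesis by (simp add: ab Q)
      qed
    qed
    \<comment> \<open>Testing P - T on the unit vector of a coordinate \<open>a\<close> with
      positive variance gives (p_i - 1) T_aa >= 0.\<close>
    have p1: "1 \<le> p' i" if i: "i < m" for i
    proof (cases "\<forall>k<n i. T (i, k) (i, k) = 0")
      case False
      then obtain k where k: "k < n i" "T (i, k) (i, k) \<noteq> 0" by auto
      define a where "a = (i, k)"
      have aI: "a \<in> I" using i k by (simp add: a_def I_def block_index_def)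
      have "0 < T a a" using k Tdiag[OF aI] unfolding a_def[symmetric] by (simp add: less_le)
      moreover have "0 \<le> (p i - 1) * T a a"
      proof -
        have "(\<Sum>x\<in>I. \<Sum>y\<in>I. (if x = a then 1 else 0) * (Q p x y - T x y) * (if y = a then 1 else 0))
          = (\<Sum>x\<in>I. if x = a then Q p a a - T a a else 0)"
        proof (intro sum.cong refl)
          fix x
          have "(\<Sum>y\<in>I. (if x = a then 1 else 0) * (Q p x y - T x y) * (if y = a then 1 else 0))
            = (\<Sum>y\<in>I. if y = a then (if x = a then Q p a a - T a a else 0) else 0)"
            by (intro sum.cong) auto
          thus "(\<Sum>y\<in>I. (if x = a then 1 else 0) * (Q p x y - T x y) * (if y = a then 1 else 0))
            = (if x = a then Q p a a - T a a else 0)" using I aI by simp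
        qed
        also have "\<dots> = Q p a a - T a a" using I aI by simp
        finally show ?thesis using psd[of "\<lambda>x. if x = a then 1 else 0"]
          by (simp add: a_def Q algebra_simps)
      qed
      ultimately have "1 \<le> p i" by (simp add: zero_le_mult_iff)
      thus ?thesis unfolding p'_def if_not_P[OF False] .
    next
      case True
      show ?thesis unfolding p'_def if_P[OF True] by (rule order_refl)
    qed
    have cov: "1 * (\<Sum>a\<in>I. \<Sum>b\<in>I. v a * (T a b - Q p' a b) * v b) \<le> 0" for v
    proof -
      have "(\<Sum>a\<in>I. \<Sum>b\<in>I. v a * (T a b - Q p' a b) * v b) = - (\<Sum>a\<in>I. \<Sum>b\<in>I. v a * (Q p a b - T a b) * v b)"
        unfolding sum_negf[symmetric] by (intro sum.cong refl) (simp add: Qeq algebra_simps)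
      thus ?thesis using psd[of v] by simp
    qed
    have "(\<integral>\<^sup>+\<omega>. ennreal (\<Prod>i<m. f i (X i \<omega>)) \<partial>M) \<le> (\<Prod>i<m. power_mean M (p' i) (\<lambda>\<omega>. f i (X i \<omega>)))"
    proof (rule upper_extension)
      show "(\<integral>\<omega>. (\<Prod>i<m. min (f i (X i \<omega>)) K + \<epsilon>) \<partial>M)
        \<le> (\<Prod>i<m. (\<integral>\<omega>. (min (f i (X i \<omega>)) K + \<epsilon>) powr p' i \<partial>M) powr (1 / p' i))" if "0 < K" "0 < \<epsilon>" for K \<epsilon>
      proof -
        have "p' i \<noteq> 0" if "i < m" for i using p1[OF that] by simp
        from bdd[OF this _ that cov] show ?thesis by simp
      qed
      show "0 < p' i" if "i \<in> {..<m}" for i using p1[of i] that by simp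
    qed (use gm fX in auto)
    also have "\<dots> = (\<Prod>i<m. power_mean M (p i) (\<lambda>\<omega>. f i (X i \<omega>)))"
    proof (rule prod.cong[OF refl])
      fix i assume "i \<in> {..<m}"
      hence i: "i < m" by simp
      show "power_mean M (p' i) (\<lambda>\<omega>. f i (X i \<omega>)) = power_mean M (p i) (\<lambda>\<omega>. f i (X i \<omega>))"
      proof (cases "\<forall>k<n i. T (i, k) (i, k) = 0")
        case True
        \<comment> \<open>The zero vector as an extensional function. X_i equals it almost surely,
          so both power means are f_i c.\<close>
        define c where "c = (\<lambda>k\<in>{..<n i}. 0 :: real)"
        have "AE \<omega> in M. \<forall>k\<in>{..<n i}. X i \<omega> k = 0"
        proof (subst AE_finite_all)
          show "\<forall>k\<in>{..<n i}. AE \<omega> in M. X i \<omega> k = 0"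
          proof
            fix k assume "k \<in> {..<n i}"
            hence "(i, k) \<in> I" "T (i, k) (i, k) = 0" using i True by (auto simp: I_def block_index_def)
            from zero[OF this] show "AE \<omega> in M. X i \<omega> k = 0" by (simp add: joint_vector_def)
          qed
        qed simp
        hence "AE \<omega> in M. f i (X i \<omega>) = f i c" using AE_space
        proof eventually_elim
          case (elim \<omega>)
          have "X i \<omega> \<in> extensional {..<n i}"
            using measurable_space[OF X[OF i] elim(2)] by (simp add: space_PiM PiE_def)
          hence "X i \<omega> = c" using elim(1) by (auto simp: c_def fun_eq_iff extensional_def)
          thus ?case by simp
        qed
        moreover have "0 \<le> f i c" by (rule f0[OF i]) (simp add: c_def space_PiM)
        ultimately show ?thesis using power_mean_const[OF gm[OF i]] by simp
      next
        case False
        show ?thesis unfolding p'_def if_not_P[OF False] ..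
      qed
    qed
    finally show "(\<integral>\<^sup>+\<omega>. ennreal (\<Prod>i<m. f i (X i \<omega>)) \<partial>M) \<le> (\<Prod>i<m. power_mean M (p i) (\<lambda>\<omega>. f i (X i \<omega>)))" .
  next
    assume ge: "matrix_le_on (block_index m n) P T"
    have psd: "0 \<le> (\<Sum>a\<in>I. \<Sum>b\<in>I. v a * (T a b - Q p a b) * v b)" for v
      using ge unfolding matrix_le_on_def psd_on_def I_def PQ by blast
    show "(\<Prod>i<m. power_mean M (p i) (\<lambda>\<omega>. f i (X i \<omega>))) \<le> (\<integral>\<^sup>+\<omega>. ennreal (\<Prod>i<m. f i (X i \<omega>)) \<partial>M)"
    proof (rule lower_extension)
      fix K \<epsilon> h :: real and q assume K: "0 < K" "0 < \<epsilon>" and h: "0 < h" and q: "q = (\<lambda>i. if p i = 0 then - h else p i)"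
      have cov: "- 1 * (\<Sum>a\<in>I. \<Sum>b\<in>I. v a * (T a b - Q q a b) * v b) \<le> 0" for v
      proof -
        have Qd: "(\<Sum>a\<in>I. \<Sum>b\<in>I. v a * Q r a b * v b)
          = (\<Sum>i<m. r i * (\<integral>\<omega>. (\<Sum>a\<in>{i} \<times> {..<n i}. v a * joint_vector X a \<omega>)\<^sup>2 \<partial>M))" for r
          unfolding Q_def I_def sum_block_diag
          by (intro sum.cong refl arg_cong2[where f = "(*)"] quad[symmetric]) (auto simp: I_def block_index_def)
        \<comment> \<open>Each exponent multiplies a nonnegative second moment, so replacing 0 by -
          h can only lower the form.\<close>
        have "(\<Sum>a\<in>I. \<Sum>b\<in>I. v a * Q q a b * v b) \<le> (\<Sum>a\<in>I. \<Sum>b\<in>I. v a * Q p a b * v b)"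
          unfolding Qd using h by (intro sum_mono mult_right_mono) (auto simp: q)
        moreover have "(\<Sum>a\<in>I. \<Sum>b\<in>I. v a * (T a b - Q r a b) * v b)
          = (\<Sum>a\<in>I. \<Sum>b\<in>I. v a * T a b * v b) - (\<Sum>a\<in>I. \<Sum>b\<in>I. v a * Q r a b * v b)" for r
          by (simp add: sum_subtractf[symmetric] algebra_simps)
        ultimately show ?thesis using psd[of v] by simp
      qed
      show "(\<Prod>i<m. (\<integral>\<omega>. (min (f i (X i \<omega>)) K + \<epsilon>) powr q i \<partial>M) powr (1 / q i))
        \<le> (\<integral>\<omega>. (\<Prod>i<m. min (f i (X i \<omega>)) K + \<epsilon>) \<partial>M)"
      proof -
        have "q i \<noteq> 0" for i using h by (simp add: q)
        from bdd[OF this _ K cov] show ?thesis by simp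
      qed
    qed (use gm fX def in auto)
  qed
qed

end
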